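(* Let $\tau:E\to M$ be a smooth vector bundle. A Loday bracket $[\cdot,\cdot]$ on the real space $\mathrm{Sec}(E)$ of sections of $E$ defines a Loday algebroid structure if and only if there are vector bundle morphisms $$\rho:E\to TM,\qquad \alpha:E\to TM\otimes_M\mathrm{End}(E),$$ covering the identity on $M$, such that, for all $X,Y\in\mathrm{Sec}(E)$ and all $f\in C^\infty(M)$, $$[X,fY]=f[X,Y]+\rho(X)(f)Y,\qquad [fX,Y]=f[X,Y]-\rho(Y)(f)X+\alpha(Y)(\mathrm{d}f\otimes X).$$ If this is the case, the anchors $\rho$ and $\alpha$ are uniquely determined, and the left anchor $\rho$ induces a homomorphism of the Loday bracket into the bracket $[\cdot,\cdot]_{vf}$ of vector fields: $$\rho([X,Y])=[\rho(X),\rho(Y)]_{vf}.$$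
   Context: All objects are smooth. A Loday bracket on a real vector space is an $\mathbb{R}$-bilinear bracket satisfying the (left) Jacobi identity $[x,[y,z]]=[[x,y],z]+[y,[x,z]]$ (no skew-symmetry required). For an $\mathbb{R}$-bilinear map $B:\mathrm{Sec}(E)\times\mathrm{Sec}(E)\to\mathrm{Sec}(E)$ and $f\in C^\infty(M)$, set $(\delta_1(f)B)(X,Y)=B(fX,Y)-fB(X,Y)$ and $(\delta_2(f)B)(X,Y)=B(X,fY)-fB(X,Y)$. $B$ is a bidifferential operator of total degree $\le 1$ if $\delta_i(f)\delta_j(g)B=0$ for all $f,g\in C^\infty(M)$ and $i,j\in\{1,2\}$. An $\mathbb R$-linear map $D:\mathrm{Sec}(E)\to\mathrm{Sec}(E)$ is a derivative endomorphism if for every $f\in C^\infty(M)$ there is $\widehat f\in C^\infty(M)$ with $D(fY)-fD(Y)=\widehat fY$ for all $Y$. A Loday algebroid on $E$ is a Loday bracket on the $C^\infty(M)$-module $\mathrm{Sec}(E)$ which is a bidifferential operator of total degree $\le 1$ and for which every adjoint operator $\mathrm{ad}_X=[X,\cdot]$ is a derivative endomorphism. $\mathrm{End}(E)$ is the endomorphism bundle; a section of $TM\otimes_M\mathrm{End}(E)$ acts on sections of $T^*M\otimes_ME$ by $(V\otimes\Phi)(\omega\otimes X)=\langle V,\omega\rangle\Phi(X)$. $\rho(X)$ and $\alpha(X)$ denote the sections $\rho\circ X$, $\alpha\circ X$. The module $\mathrm{Sec}(E)$ is assumed faithful over $C^\infty(M)$ (i.e. $E$ has nonzero rank). *)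

theory Defs
  imports "HOL-Analysis.Analysis"
begin

section \<open>Finite-dimensional model spaces\<close>

text \<open>The class \<^class>\<open>euclidean_space\<close> excludes dimension 0. The following class contains it and
  also allows the zero space, so that manifolds of dimension 0 are covered.\<close>

class finite_dim_inner = real_inner +
  assumes ex_finite_spanning: "\<exists>B. finite B \<and> (\<forall>x. \<exists>r. x = (\<Sum>b\<in>B. r b *\<^sub>R b))"

instance euclidean_space \<subseteq> finite_dim_inner
proof
  show "\<exists>B. finite B \<and> (\<forall>x. \<exists>r. x = (\<Sum>b\<in>B. r b *\<^sub>R (b::'a)))"
    by (intro exI[of _ Basis] conjI allI finite_Basis exI[of _ "inner x" for x])
      (simp add: euclidean_representation)
qed


section \<open>Smooth maps between open subsets of normed spaces\<close>

text \<open>Used for open sets in finite-dimensional domains only; there the existence and continuity of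
  all iterated directional derivatives gives the usual notion.\<close>

primrec Ck_on :: "nat \<Rightarrow> 'a::real_normed_vector set \<Rightarrow> ('a \<Rightarrow> 'b::real_normed_vector) \<Rightarrow> bool" where
  "Ck_on 0 S f \<longleftrightarrow> continuous_on S f"
| "Ck_on (Suc k) S f \<longleftrightarrow> (\<forall>x\<in>S. f differentiable (at x)) \<and>
     (\<forall>v. Ck_on k S (\<lambda>x. frechet_derivative f (at x) v))"

definition smooth_on :: "'a::real_normed_vector set \<Rightarrow> ('a \<Rightarrow> 'b::real_normed_vector) \<Rightarrow> bool" where
  "smooth_on S f \<longleftrightarrow> (\<forall>k. Ck_on k S f)"


section \<open>Smooth manifolds\<close>

text \<open>The manifold is the whole type \<open>'m\<close>; a chart is a pair \<open>(U, c)\<close> of an open set and a map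
  that is relevant on \<open>U\<close> only.\<close>

type_synonym ('m, 'a) atlas = "('m set \<times> ('m \<Rightarrow> 'a)) set"

definition smooth_manifold ::
  "('m::{t2_space, second_countable_topology}, 'a::finite_dim_inner) atlas \<Rightarrow> bool" where
  "smooth_manifold A \<longleftrightarrow>
     (\<Union>(U, c)\<in>A. U) = UNIV \<and>
     (\<forall>(U, c)\<in>A. open U \<and> open (c ` U) \<and> homeomorphism U (c ` U) c (inv_into U c)) \<and>
     (\<forall>(U, c)\<in>A. \<forall>(V, d)\<in>A. smooth_on (c ` (U \<inter> V)) (d \<circ> inv_into U c))"

definition smooth_fun_on ::
  "('m, 'a::real_normed_vector) atlas \<Rightarrow> 'm set \<Rightarrow> ('m \<Rightarrow> 'b::real_normed_vector) \<Rightarrow> bool" where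
  "smooth_fun_on A W f \<longleftrightarrow> (\<forall>(U, c)\<in>A. smooth_on (c ` (U \<inter> W)) (f \<circ> inv_into U c))"

definition smooth_family_on ::
  "('m, 'a::real_normed_vector) atlas \<Rightarrow> 'm set \<Rightarrow>
    ('m \<Rightarrow> 'f::real_normed_vector \<Rightarrow> 'g::real_normed_vector) \<Rightarrow> bool"
  \<comment> \<open>\<open>(p, v) \<mapsto> h p v\<close> is smooth on the product manifold \<open>W \<times> 'f\<close>\<close> where
  "smooth_family_on A W h \<longleftrightarrow>
     (\<forall>(U, c)\<in>A. smooth_on (c ` (U \<inter> W) \<times> UNIV) (\<lambda>(x, v). h (inv_into U c x) v))"

definition Cinf :: "('m, 'a::real_normed_vector) atlas \<Rightarrow> ('m \<Rightarrow> real) set" where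
  "Cinf A = {f. smooth_fun_on A UNIV f}"


section \<open>Smooth vector bundles\<close>

text \<open>A bundle \<open>\<tau> : E \<rightarrow> M\<close> is given by its fibres \<open>fibre E p = \<tau>\<^sup>-\<^sup>1(p)\<close> with their vector space
  operations, and by a vector bundle atlas. A local trivialisation \<open>\<tau>\<^sup>-\<^sup>1(U) \<rightarrow> U \<times> 'f\<close> is a pair
  \<open>(U, \<phi>)\<close>, where \<open>\<phi> p\<close> is the map on the fibre over \<open>p \<in> U\<close>. The total space is
  \<open>Sigma UNIV (fibre E)\<close>, so fibres over different points may overlap as sets; its smooth structure
  is the one determined by the trivialisations.\<close>

record ('m, 'e, 'f) vbundle =
  fibre :: "'m \<Rightarrow> 'e set"
  vzero :: "'m \<Rightarrow> 'e"
  vadd :: "'m \<Rightarrow> 'e \<Rightarrow> 'e \<Rightarrow> 'e"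
  vscale :: "'m \<Rightarrow> real \<Rightarrow> 'e \<Rightarrow> 'e"
  trivs :: "('m set \<times> ('m \<Rightarrow> 'e \<Rightarrow> 'f)) set"

definition linear_wrt ::
  "'v set \<Rightarrow> ('v \<Rightarrow> 'v \<Rightarrow> 'v) \<Rightarrow> (real \<Rightarrow> 'v \<Rightarrow> 'v) \<Rightarrow> ('w \<Rightarrow> 'w \<Rightarrow> 'w) \<Rightarrow> (real \<Rightarrow> 'w \<Rightarrow> 'w) \<Rightarrow>
    ('v \<Rightarrow> 'w) \<Rightarrow> bool" where
  "linear_wrt S add scl add' scl' h \<longleftrightarrow>
     (\<forall>x\<in>S. \<forall>y\<in>S. h (add x y) = add' (h x) (h y)) \<and>
     (\<forall>r. \<forall>x\<in>S. h (scl r x) = scl' r (h x))"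

text \<open>The vector space axioms of the fibres need not be listed: they are transported from \<open>'f\<close>
  along the linear bijections \<open>\<phi> p\<close>. The last clause says that the transition maps between
  trivialisations are smooth.\<close>

definition vector_bundle ::
  "('m::{t2_space, second_countable_topology}, 'a::finite_dim_inner) atlas \<Rightarrow>
    ('m, 'e, 'f::finite_dim_inner) vbundle \<Rightarrow> bool" where
  "vector_bundle A E \<longleftrightarrow>
     (\<forall>p. vzero E p \<in> fibre E p \<and>
          (\<forall>x\<in>fibre E p. \<forall>y\<in>fibre E p. vadd E p x y \<in> fibre E p) \<and>
          (\<forall>r. \<forall>x\<in>fibre E p. vscale E p r x \<in> fibre E p)) \<and>
     (\<Union>(U, \<phi>)\<in>trivs E. U) = UNIV \<and>
     (\<forall>(U, \<phi>)\<in>trivs E. open U \<and>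
        (\<forall>p\<in>U. bij_betw (\<phi> p) (fibre E p) UNIV \<and> \<phi> p (vzero E p) = 0 \<and>
               linear_wrt (fibre E p) (vadd E p) (vscale E p) (+) (*\<^sub>R) (\<phi> p))) \<and>
     (\<forall>(U, \<phi>)\<in>trivs E. \<forall>(V, \<psi>)\<in>trivs E.
        smooth_family_on A (U \<inter> V) (\<lambda>p v. \<psi> p (inv_into (fibre E p) (\<phi> p) v)))"

definition Sec ::
  "('m, 'a::real_normed_vector) atlas \<Rightarrow> ('m, 'e, 'f::real_normed_vector) vbundle \<Rightarrow> ('m \<Rightarrow> 'e) set"
  where
  "Sec A E = {X. (\<forall>p. X p \<in> fibre E p) \<and>
                 (\<forall>(U, \<phi>)\<in>trivs E. smooth_fun_on A U (\<lambda>p. \<phi> p (X p)))}"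

definition bundle_morphism ::
  "('m, 'a::real_normed_vector) atlas \<Rightarrow> ('m, 'e, 'f::real_normed_vector) vbundle \<Rightarrow>
    ('m, 'd, 'g::real_normed_vector) vbundle \<Rightarrow> ('m \<Rightarrow> 'e \<Rightarrow> 'd) \<Rightarrow> bool"
  \<comment> \<open>morphisms covering the identity, as families of maps \<open>h p\<close> between the fibres over \<open>p\<close>\<close> where
  "bundle_morphism A E E' h \<longleftrightarrow>
     (\<forall>p. h p \<in> fibre E p \<rightarrow> fibre E' p \<and>
          linear_wrt (fibre E p) (vadd E p) (vscale E p) (vadd E' p) (vscale E' p) (h p)) \<and>
     (\<forall>(U, \<phi>)\<in>trivs E. \<forall>(V, \<psi>)\<in>trivs E'.
        smooth_family_on A (U \<inter> V) (\<lambda>p v. \<psi> p (h p (inv_into (fibre E p) (\<phi> p) v))))"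

definition sec_zero :: "('m, 'e, 'f) vbundle \<Rightarrow> 'm \<Rightarrow> 'e" where
  "sec_zero E = (\<lambda>p. vzero E p)"

definition sec_add :: "('m, 'e, 'f) vbundle \<Rightarrow> ('m \<Rightarrow> 'e) \<Rightarrow> ('m \<Rightarrow> 'e) \<Rightarrow> 'm \<Rightarrow> 'e" where
  "sec_add E X Y = (\<lambda>p. vadd E p (X p) (Y p))"

definition sec_scale :: "('m, 'e, 'f) vbundle \<Rightarrow> ('m \<Rightarrow> real) \<Rightarrow> ('m \<Rightarrow> 'e) \<Rightarrow> 'm \<Rightarrow> 'e" where
  "sec_scale E f X = (\<lambda>p. vscale E p (f p) (X p))"

definition sec_diff :: "('m, 'e, 'f) vbundle \<Rightarrow> ('m \<Rightarrow> 'e) \<Rightarrow> ('m \<Rightarrow> 'e) \<Rightarrow> 'm \<Rightarrow> 'e" where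
  "sec_diff E X Y = sec_add E X (sec_scale E (\<lambda>p. -1) Y)"


section \<open>The tangent bundle\<close>

text \<open>Tangent vectors at \<open>p\<close> are the derivations of \<open>Cinf A\<close> at \<open>p\<close>, made \<open>undefined\<close> on
  non-smooth functions so that equality of tangent vectors is equality in HOL.\<close>

definition tangent_space ::
  "('m, 'a::real_normed_vector) atlas \<Rightarrow> 'm \<Rightarrow> (('m \<Rightarrow> real) \<Rightarrow> real) set" where
  "tangent_space A p = {v \<in> extensional (Cinf A).
     (\<forall>f\<in>Cinf A. \<forall>g\<in>Cinf A. v (\<lambda>q. f q + g q) = v f + v g) \<and>
     (\<forall>r. \<forall>f\<in>Cinf A. v (\<lambda>q. r * f q) = r * v f) \<and>
     (\<forall>f\<in>Cinf A. \<forall>g\<in>Cinf A. v (\<lambda>q. f q * g q) = f p * v g + g p * v f)}"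

text \<open>The trivialisation over a chart \<open>(U, c)\<close> sends \<open>v\<close> to its coordinate vector \<open>a\<close>, that is,
  \<open>v\<close> is the directional derivative along \<open>a\<close> in the chart.\<close>

definition tangent_bundle ::
  "('m, 'a::real_normed_vector) atlas \<Rightarrow> ('m, ('m \<Rightarrow> real) \<Rightarrow> real, 'a) vbundle" where
  "tangent_bundle A = \<lparr>
     fibre = tangent_space A,
     vzero = (\<lambda>p. \<lambda>f\<in>Cinf A. 0),
     vadd = (\<lambda>p v w. \<lambda>f\<in>Cinf A. v f + w f),
     vscale = (\<lambda>p r v. \<lambda>f\<in>Cinf A. r * v f),
     trivs = {(U, \<lambda>p v. THE a. \<forall>f\<in>Cinf A.
                 v f = frechet_derivative (f \<circ> inv_into U c) (at (c p)) a) | U c. (U, c) \<in> A}\<rparr>"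

definition vf_apply :: "('m \<Rightarrow> ('m \<Rightarrow> real) \<Rightarrow> real) \<Rightarrow> ('m \<Rightarrow> real) \<Rightarrow> 'm \<Rightarrow> real" where
  "vf_apply V f = (\<lambda>p. V p f)"

definition vf_bracket ::
  "('m, 'a::real_normed_vector) atlas \<Rightarrow> ('m \<Rightarrow> ('m \<Rightarrow> real) \<Rightarrow> real) \<Rightarrow>
    ('m \<Rightarrow> ('m \<Rightarrow> real) \<Rightarrow> real) \<Rightarrow> 'm \<Rightarrow> ('m \<Rightarrow> real) \<Rightarrow> real" where
  "vf_bracket A V W = (\<lambda>p. \<lambda>f\<in>Cinf A. V p (vf_apply W f) - W p (vf_apply V f))"

definition differential ::
  "('m, 'a::real_normed_vector) atlas \<Rightarrow> ('m \<Rightarrow> real) \<Rightarrow> 'm \<Rightarrow> (('m \<Rightarrow> real) \<Rightarrow> real) \<Rightarrow> real" where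
  "differential A f = (\<lambda>p. \<lambda>v\<in>tangent_space A p. v f)"


section \<open>Endomorphism and tensor product bundles\<close>

definition End_bundle ::
  "('m, 'e, 'f::real_normed_vector) vbundle \<Rightarrow> ('m, 'e \<Rightarrow> 'e, 'f \<Rightarrow>\<^sub>L 'f) vbundle" where
  "End_bundle E = \<lparr>
     fibre = (\<lambda>p. {\<Phi> \<in> fibre E p \<rightarrow>\<^sub>E fibre E p.
        linear_wrt (fibre E p) (vadd E p) (vscale E p) (vadd E p) (vscale E p) \<Phi>}),
     vzero = (\<lambda>p. \<lambda>x\<in>fibre E p. vzero E p),
     vadd = (\<lambda>p \<Phi> \<Psi>. \<lambda>x\<in>fibre E p. vadd E p (\<Phi> x) (\<Psi> x)),
     vscale = (\<lambda>p r \<Phi>. \<lambda>x\<in>fibre E p. vscale E p r (\<Phi> x)),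
     trivs = {(U, \<lambda>p \<Phi>. Blinfun (\<lambda>v. \<phi> p (\<Phi> (inv_into (fibre E p) (\<phi> p) v)))) | U \<phi>.
        (U, \<phi>) \<in> trivs E}\<rparr>"

definition dual_fibre :: "('m, 'e, 'f) vbundle \<Rightarrow> 'm \<Rightarrow> ('e \<Rightarrow> real) set" where
  "dual_fibre E p = {\<xi> \<in> extensional (fibre E p).
     linear_wrt (fibre E p) (vadd E p) (vscale E p) (+) (*) \<xi>}"

text \<open>As the fibres have finite dimension, an element of \<open>V\<^sub>p \<otimes> W\<^sub>p\<close> is identified with the
  linear map from the dual of \<open>V\<^sub>p\<close> to \<open>W\<^sub>p\<close> that it induces: \<open>v \<otimes> w\<close> is \<open>\<xi> \<mapsto> \<xi>(v) w\<close>, and the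
  tensor product consists of the finite sums of such elements.\<close>

definition elem_tensor ::
  "('m, 'v, 'f) vbundle \<Rightarrow> ('m, 'w, 'g) vbundle \<Rightarrow> 'm \<Rightarrow> 'v \<Rightarrow> 'w \<Rightarrow> ('v \<Rightarrow> real) \<Rightarrow> 'w" where
  "elem_tensor V W p v w = (\<lambda>\<xi>\<in>dual_fibre V p. vscale W p (\<xi> v) w)"

definition tensor_zero ::
  "('m, 'v, 'f) vbundle \<Rightarrow> ('m, 'w, 'g) vbundle \<Rightarrow> 'm \<Rightarrow> ('v \<Rightarrow> real) \<Rightarrow> 'w" where
  "tensor_zero V W p = (\<lambda>\<xi>\<in>dual_fibre V p. vzero W p)"

definition tensor_add ::
  "('m, 'v, 'f) vbundle \<Rightarrow> ('m, 'w, 'g) vbundle \<Rightarrow> 'm \<Rightarrow>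
    (('v \<Rightarrow> real) \<Rightarrow> 'w) \<Rightarrow> (('v \<Rightarrow> real) \<Rightarrow> 'w) \<Rightarrow> ('v \<Rightarrow> real) \<Rightarrow> 'w" where
  "tensor_add V W p s t = (\<lambda>\<xi>\<in>dual_fibre V p. vadd W p (s \<xi>) (t \<xi>))"

definition tensor_scale ::
  "('m, 'v, 'f) vbundle \<Rightarrow> ('m, 'w, 'g) vbundle \<Rightarrow> 'm \<Rightarrow>
    real \<Rightarrow> (('v \<Rightarrow> real) \<Rightarrow> 'w) \<Rightarrow> ('v \<Rightarrow> real) \<Rightarrow> 'w" where
  "tensor_scale V W p r t = (\<lambda>\<xi>\<in>dual_fibre V p. vscale W p r (t \<xi>))"

inductive_set tensor_fibre ::
  "('m, 'v, 'f) vbundle \<Rightarrow> ('m, 'w, 'g) vbundle \<Rightarrow> 'm \<Rightarrow> (('v \<Rightarrow> real) \<Rightarrow> 'w) set"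
  for V W p where
  zero: "tensor_zero V W p \<in> tensor_fibre V W p"
| add: "v \<in> fibre V p \<Longrightarrow> w \<in> fibre W p \<Longrightarrow> t \<in> tensor_fibre V W p \<Longrightarrow>
    tensor_add V W p (elem_tensor V W p v w) t \<in> tensor_fibre V W p"

text \<open>The model fibre of \<open>V \<otimes> W\<close> is likewise realised as the linear maps from the dual of \<open>'f\<close>
  to \<open>'g\<close>; in the induced trivialisation \<open>v \<otimes> w\<close> becomes \<open>\<eta> \<mapsto> \<eta>(\<phi> v) \<psi>(w)\<close>.\<close>

definition tensor_bundle ::
  "('m, 'v, 'f::real_normed_vector) vbundle \<Rightarrow> ('m, 'w, 'g::real_normed_vector) vbundle \<Rightarrow>
    ('m, ('v \<Rightarrow> real) \<Rightarrow> 'w, ('f \<Rightarrow>\<^sub>L real) \<Rightarrow>\<^sub>L 'g) vbundle" where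
  "tensor_bundle V W = \<lparr>
     fibre = tensor_fibre V W,
     vzero = tensor_zero V W,
     vadd = tensor_add V W,
     vscale = tensor_scale V W,
     trivs = {(U \<inter> U', \<lambda>p t. Blinfun (\<lambda>\<eta>. \<psi> p (t (\<lambda>x\<in>fibre V p. blinfun_apply \<eta> (\<phi> p x)))))
       | U \<phi> U' \<psi>. (U, \<phi>) \<in> trivs V \<and> (U', \<psi>) \<in> trivs W}\<rparr>"

definition tensor_act ::
  "('m \<Rightarrow> ('v \<Rightarrow> real) \<Rightarrow> 'e \<Rightarrow> 'e) \<Rightarrow> ('m \<Rightarrow> 'v \<Rightarrow> real) \<Rightarrow> ('m \<Rightarrow> 'e) \<Rightarrow> 'm \<Rightarrow> 'e"
  \<comment> \<open>the action of a section \<open>S\<close> of \<open>TM \<otimes> End(E)\<close> on \<open>\<omega> \<otimes> X\<close>\<close> where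
  "tensor_act S \<omega> X = (\<lambda>p. S p (\<omega> p) (X p))"

lemma tensor_act_elem_tensor:
  assumes "\<And>p. \<omega> p \<in> dual_fibre (tangent_bundle A) p" and "\<And>p. X p \<in> fibre E p"
  shows "tensor_act (\<lambda>p. elem_tensor (tangent_bundle A) (End_bundle E) p (V p) (\<Phi> p)) \<omega> X
       = sec_scale E (\<lambda>p. \<omega> p (V p)) (\<lambda>p. \<Phi> p (X p))"
  using assms by (simp add: tensor_act_def elem_tensor_def End_bundle_def sec_scale_def)


section \<open>Loday brackets and Loday algebroids\<close>

definition real_linear_sec ::
  "('m, 'a::real_normed_vector) atlas \<Rightarrow> ('m, 'e, 'f::real_normed_vector) vbundle \<Rightarrow>
    (('m \<Rightarrow> 'e) \<Rightarrow> ('m \<Rightarrow> 'e)) \<Rightarrow> bool" where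
  "real_linear_sec A E D \<longleftrightarrow> D \<in> Sec A E \<rightarrow> Sec A E \<and>
     linear_wrt (Sec A E) (sec_add E) (\<lambda>r. sec_scale E (\<lambda>p. r))
       (sec_add E) (\<lambda>r. sec_scale E (\<lambda>p. r)) D"

definition real_bilinear_sec ::
  "('m, 'a::real_normed_vector) atlas \<Rightarrow> ('m, 'e, 'f::real_normed_vector) vbundle \<Rightarrow>
    (('m \<Rightarrow> 'e) \<Rightarrow> ('m \<Rightarrow> 'e) \<Rightarrow> ('m \<Rightarrow> 'e)) \<Rightarrow> bool" where
  "real_bilinear_sec A E B \<longleftrightarrow>
     (\<forall>X\<in>Sec A E. real_linear_sec A E (\<lambda>Y. B X Y)) \<and>
     (\<forall>Y\<in>Sec A E. real_linear_sec A E (\<lambda>X. B X Y))"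

definition loday_bracket ::
  "('m, 'a::real_normed_vector) atlas \<Rightarrow> ('m, 'e, 'f::real_normed_vector) vbundle \<Rightarrow>
    (('m \<Rightarrow> 'e) \<Rightarrow> ('m \<Rightarrow> 'e) \<Rightarrow> ('m \<Rightarrow> 'e)) \<Rightarrow> bool" where
  "loday_bracket A E B \<longleftrightarrow> real_bilinear_sec A E B \<and>
     (\<forall>X\<in>Sec A E. \<forall>Y\<in>Sec A E. \<forall>Z\<in>Sec A E.
        B X (B Y Z) = sec_add E (B (B X Y) Z) (B Y (B X Z)))"

definition delta1 ::
  "('m, 'e, 'f) vbundle \<Rightarrow> ('m \<Rightarrow> real) \<Rightarrow> (('m \<Rightarrow> 'e) \<Rightarrow> ('m \<Rightarrow> 'e) \<Rightarrow> ('m \<Rightarrow> 'e)) \<Rightarrow>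
    ('m \<Rightarrow> 'e) \<Rightarrow> ('m \<Rightarrow> 'e) \<Rightarrow> ('m \<Rightarrow> 'e)" where
  "delta1 E f B X Y = sec_diff E (B (sec_scale E f X) Y) (sec_scale E f (B X Y))"

definition delta2 ::
  "('m, 'e, 'f) vbundle \<Rightarrow> ('m \<Rightarrow> real) \<Rightarrow> (('m \<Rightarrow> 'e) \<Rightarrow> ('m \<Rightarrow> 'e) \<Rightarrow> ('m \<Rightarrow> 'e)) \<Rightarrow>
    ('m \<Rightarrow> 'e) \<Rightarrow> ('m \<Rightarrow> 'e) \<Rightarrow> ('m \<Rightarrow> 'e)" where
  "delta2 E f B X Y = sec_diff E (B X (sec_scale E f Y)) (sec_scale E f (B X Y))"

definition bidiff_degree_le_1 ::
  "('m, 'a::real_normed_vector) atlas \<Rightarrow> ('m, 'e, 'f::real_normed_vector) vbundle \<Rightarrow>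
    (('m \<Rightarrow> 'e) \<Rightarrow> ('m \<Rightarrow> 'e) \<Rightarrow> ('m \<Rightarrow> 'e)) \<Rightarrow> bool" where
  "bidiff_degree_le_1 A E B \<longleftrightarrow> real_bilinear_sec A E B \<and>
     (\<forall>\<delta>\<^sub>i\<in>{delta1 E, delta2 E}. \<forall>\<delta>\<^sub>j\<in>{delta1 E, delta2 E}.
        \<forall>f\<in>Cinf A. \<forall>g\<in>Cinf A. \<forall>X\<in>Sec A E. \<forall>Y\<in>Sec A E.
          \<delta>\<^sub>i f (\<delta>\<^sub>j g B) X Y = sec_zero E)"

definition derivative_endomorphism ::
  "('m, 'a::real_normed_vector) atlas \<Rightarrow> ('m, 'e, 'f::real_normed_vector) vbundle \<Rightarrow>
    (('m \<Rightarrow> 'e) \<Rightarrow> ('m \<Rightarrow> 'e)) \<Rightarrow> bool" where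
  "derivative_endomorphism A E D \<longleftrightarrow> real_linear_sec A E D \<and>
     (\<forall>f\<in>Cinf A. \<exists>f'\<in>Cinf A. \<forall>Y\<in>Sec A E.
        sec_diff E (D (sec_scale E f Y)) (sec_scale E f (D Y)) = sec_scale E f' Y)"

definition loday_algebroid ::
  "('m, 'a::real_normed_vector) atlas \<Rightarrow> ('m, 'e, 'f::real_normed_vector) vbundle \<Rightarrow>
    (('m \<Rightarrow> 'e) \<Rightarrow> ('m \<Rightarrow> 'e) \<Rightarrow> ('m \<Rightarrow> 'e)) \<Rightarrow> bool" where
  "loday_algebroid A E B \<longleftrightarrow> loday_bracket A E B \<and> bidiff_degree_le_1 A E B \<and>
     (\<forall>X\<in>Sec A E. derivative_endomorphism A E (\<lambda>Y. B X Y))"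

definition along :: "('m \<Rightarrow> 'e \<Rightarrow> 'd) \<Rightarrow> ('m \<Rightarrow> 'e) \<Rightarrow> 'm \<Rightarrow> 'd"
  \<comment> \<open>the section \<open>h \<circ> X\<close> for a bundle morphism \<open>h\<close> and a section \<open>X\<close>\<close> where
  "along h X = (\<lambda>p. h p (X p))"

definition anchors ::
  "('m, 'a::real_normed_vector) atlas \<Rightarrow> ('m, 'e, 'f::real_normed_vector) vbundle \<Rightarrow>
    (('m \<Rightarrow> 'e) \<Rightarrow> ('m \<Rightarrow> 'e) \<Rightarrow> ('m \<Rightarrow> 'e)) \<Rightarrow>
    ('m \<Rightarrow> 'e \<Rightarrow> ('m \<Rightarrow> real) \<Rightarrow> real) \<Rightarrow>
    ('m \<Rightarrow> 'e \<Rightarrow> ((('m \<Rightarrow> real) \<Rightarrow> real) \<Rightarrow> real) \<Rightarrow> 'e \<Rightarrow> 'e) \<Rightarrow> bool" where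
  "anchors A E B \<rho> \<alpha> \<longleftrightarrow>
     bundle_morphism A E (tangent_bundle A) \<rho> \<and>
     bundle_morphism A E (tensor_bundle (tangent_bundle A) (End_bundle E)) \<alpha> \<and>
     (\<forall>X\<in>Sec A E. \<forall>Y\<in>Sec A E. \<forall>f\<in>Cinf A.
        B X (sec_scale E f Y) =
          sec_add E (sec_scale E f (B X Y)) (sec_scale E (vf_apply (along \<rho> X) f) Y) \<and>
        B (sec_scale E f X) Y =
          sec_add E
            (sec_diff E (sec_scale E f (B X Y)) (sec_scale E (vf_apply (along \<rho> Y) f) X))
            (tensor_act (along \<alpha> Y) (differential A f) X))"

end

theory Submission
  imports Defs
begin

text \<open>The proof looks at the symbols of the bracket. For a function \<open>f\<close> let
  \<open>\<delta>\<^sub>2(f)B(X, Y) = [X, fY] - f[X, Y]\<close> and \<open>\<delta>\<^sub>1(f)B(X, Y) = [fX, Y] - f[X, Y]\<close>. In a Loday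
  algebroid the first has the form \<open>\<rho>(X)(f) Y\<close>, because \<open>ad\<^sub>X\<close> is a derivative endomorphism;
  the function \<open>\<rho>(X)(f)\<close> (\<open>left_symbol\<close>) is unique, since some section does not vanish at a given
  point. Uniqueness turns identities of the bracket into identities of \<open>\<rho>\<close>: expanding
  \<open>[X, (fg)Y]\<close> shows that \<open>\<rho>(X)\<close> is a derivation, and total degree \<open>\<le> 1\<close> makes \<open>\<rho>(X)(f)\<close>
  linear over the smooth functions in \<open>X\<close>. The same degree condition makes \<open>\<delta>\<^sub>1(f)B\<close>
  function-linear in both arguments, and the expansion of \<open>[(fg)X, Y]\<close> shows that it is a
  derivation in \<open>f\<close>. Hence \<open>\<delta>\<^sub>1(f)B(X, Y) + \<rho>(Y)(f)X\<close> (\<open>right_symbol\<close>) depends at \<open>p\<close> only on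
  \<open>X(p)\<close>, \<open>Y(p)\<close> and \<open>df(p)\<close>, and this dependence is \<open>\<alpha>\<close>.

  Two facts turn these algebraic statements into bundle morphisms. A function-linear operator is
  evaluated by the frame formula \<open>T X = \<Sum>\<^sub>b X\<^sub>b(p) T(s\<^sub>b)\<close>, where the \<open>s\<^sub>b\<close> are global sections that
  form a frame near \<open>p\<close> (\<open>tensorial_frame_expand\<close>). A derivation at \<open>p\<close> is evaluated by
  \<open>v f = \<Sum>\<^sub>b v(x\<^sub>b) \<partial>\<^sub>b f\<close>, where the \<open>x\<^sub>b\<close> are global functions that are coordinates near \<open>p\<close>
  (\<open>tangent_eq_dirder\<close>, from Hadamard's lemma). Both formulas hold with the same \<open>s\<^sub>b\<close> and
  \<open>x\<^sub>b\<close> at all points near \<open>p\<close>, so they show pointwise dependence and at the same time write the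
  anchors in trivialisations as finite sums with smooth coefficients. Bump functions provide the
  global objects.

  Conversely, the two anchor equations express both symbols by terms that are function-linear in
  \<open>X\<close> and \<open>Y\<close>, so a second \<open>\<delta>\<close> kills them. The anchors are determined because every vector is the
  value of a section and every covector is the differential of a function. Finally, the Jacobi
  identity for \<open>X, Y, fZ\<close> leaves, after the terms with \<open>f\<close>, \<open>\<rho>(X)(f)\<close> and \<open>\<rho>(Y)(f)\<close> in front of a
  bracket cancel, the equation \<open>\<rho>([X, Y])(f) Z = (\<rho>(X)\<rho>(Y)(f) - \<rho>(Y)\<rho>(X)(f)) Z\<close>.\<close>

section \<open>Finite-dimensional inner product spaces\<close>

text \<open>Gram-Schmidt: a new vector contributes its normalised component orthogonal to the previous ones,
  or nothing if that component vanishes.\<close>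

lemma finite_subset_span_orthonormal:
  fixes S :: "'a::real_inner set"
  assumes "finite S"
  shows "\<exists>T. finite T \<and> (\<forall>b\<in>T. \<forall>b'\<in>T. b \<bullet> b' = (if b = b' then 1 else 0)) \<and> S \<subseteq> span T"
  using assms
proof (induction S rule: finite_induct)
  case empty
  then show ?case by (intro exI[of _ "{}"]) auto
next
  case (insert a S)
  then obtain T where T: "finite T" "\<forall>b\<in>T. \<forall>b'\<in>T. b \<bullet> b' = (if b = b' then 1 else 0)" "S \<subseteq> span T"
    by auto
  define u where "u = (\<Sum>b\<in>T. (a \<bullet> b) *\<^sub>R b)"
  define c where "c = a - u"
  have u: "u \<in> span T" unfolding u_def by (intro span_sum span_scale span_base)
  have ub: "u \<bullet> b = a \<bullet> b" if "b \<in> T" for b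
  proof -
    have "u \<bullet> b = (\<Sum>b'\<in>T. if b' = b then a \<bullet> b' else 0)"
      unfolding u_def inner_sum_left using T(2) that by (intro sum.cong) auto
    also have "\<dots> = a \<bullet> b" using T(1) that by simp
    finally show ?thesis .
  qed
  have cb: "c \<bullet> b = 0" "b \<bullet> c = 0" if "b \<in> T" for b
    using ub[OF that] by (simp_all add: c_def inner_diff_left inner_diff_right inner_commute[of b])
  show ?case
  proof (cases "c = 0")
    case True
    then have "a \<in> span T" using u by (simp add: c_def)
    then show ?thesis using T by (intro exI[of _ T]) auto
  next
    case False
    define e where "e = (1 / norm c) *\<^sub>R c"
    have ee: "e \<bullet> e = 1" using False by (simp add: e_def dot_square_norm power2_eq_square)
    have eb: "e \<bullet> b = 0" "b \<bullet> e = 0" if "b \<in> T" for b using cb[OF that] by (simp_all add: e_def)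
    have "e \<notin> T" using ee eb by force
    have "c = norm c *\<^sub>R e" using False by (simp add: e_def)
    then have "a = u + norm c *\<^sub>R e" by (simp add: c_def algebra_simps)
    moreover have "u + norm c *\<^sub>R e \<in> span (insert e T)"
      using u by (intro span_add span_scale) (auto intro: span_base span_mono[THEN subsetD, of T])
    ultimately have "a \<in> span (insert e T)" by simp
    moreover have "S \<subseteq> span (insert e T)" using T(3) span_mono[of T "insert e T"] by blast
    ultimately show ?thesis using T ee eb \<open>e \<notin> T\<close>
      by (intro exI[of _ "insert e T"]) auto
  qed
qed

text \<open>A replacement for \<open>Basis\<close>; it is empty for the zero space.\<close>

definition onb :: "'a::finite_dim_inner set" where
  "onb = (SOME T. finite T \<and> (\<forall>b\<in>T. \<forall>b'\<in>T. b \<bullet> b' = (if b = b' then 1 else 0)) \<and> span T = UNIV)"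

lemma onb_props:
  "finite (onb::'a::finite_dim_inner set) \<and>
   (\<forall>b\<in>onb. \<forall>b'\<in>onb. (b::'a) \<bullet> b' = (if b = b' then 1 else 0)) \<and> span onb = (UNIV::'a set)"
proof -
  obtain S :: "'a set" where S: "finite S" "\<forall>x. \<exists>r. x = (\<Sum>b\<in>S. r b *\<^sub>R b)"
    using ex_finite_spanning by blast
  have "x \<in> span S" for x
  proof -
    obtain r where "x = (\<Sum>b\<in>S. r b *\<^sub>R b)" using S(2) by blast
    then show ?thesis by (simp add: span_sum span_scale span_base)
  qed
  then have "span S = UNIV" by auto
  moreover obtain T where T: "finite T" "\<forall>b\<in>T. \<forall>b'\<in>T. b \<bullet> b' = (if b = b' then 1 else 0)" "S \<subseteq> span T"
    using finite_subset_span_orthonormal[OF S(1)] by blast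
  ultimately have "span T = UNIV" using span_minimal[OF T(3) subspace_span] by auto
  then show ?thesis unfolding onb_def using T by - (rule someI[of _ T], auto)
qed

lemma finite_onb [simp]: "finite (onb::'a::finite_dim_inner set)"
  and inner_onb: "(b::'a) \<in> onb \<Longrightarrow> b' \<in> onb \<Longrightarrow> b \<bullet> b' = (if b = b' then 1 else 0)"
  and span_onb: "span onb = (UNIV::'a set)"
  using onb_props by auto

lemma inner_sum_onb:
  assumes "b \<in> onb"
  shows "(\<Sum>b'\<in>onb. r b' *\<^sub>R b') \<bullet> b = r (b::'a::finite_dim_inner)"
proof -
  have "(\<Sum>b'\<in>onb. r b' *\<^sub>R b') \<bullet> b = (\<Sum>b'\<in>onb. if b' = b then r b' else 0)"
    unfolding inner_sum_left using assms by (intro sum.cong) (auto simp: inner_onb)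
  then show ?thesis using assms by simp
qed

lemma onb_expand: "(\<Sum>b\<in>onb. (x \<bullet> b) *\<^sub>R b) = (x::'a::finite_dim_inner)"
proof -
  have "x \<in> span onb" by (simp add: span_onb)
  then obtain r where "x = (\<Sum>b\<in>onb. r b *\<^sub>R b)" by (auto simp: span_finite)
  then show ?thesis by (simp add: inner_sum_onb)
qed

lemma onb_eqI: "(\<And>b. b \<in> onb \<Longrightarrow> x \<bullet> b = y \<bullet> b) \<Longrightarrow> (x::'a::finite_dim_inner) = y"
  by (subst onb_expand[symmetric, of x], subst onb_expand[symmetric, of y]) (auto intro: sum.cong)

lemma linear_onb_expand:
  assumes "linear f"
  shows "f x = (\<Sum>b\<in>onb. (x \<bullet> b) *\<^sub>R f (b::'a::finite_dim_inner))"
  by (subst onb_expand[symmetric, of x]) (simp add: linear_sum[OF assms] linear_cmul[OF assms])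

lemma linear_imp_bounded_linear:
  fixes f :: "'a::finite_dim_inner \<Rightarrow> 'b::real_normed_vector"
  assumes "linear f"
  shows "bounded_linear f"
proof -
  have "bounded_linear (\<lambda>x. \<Sum>b\<in>onb. (x \<bullet> b) *\<^sub>R f b)"
    by (intro bounded_linear_sum bounded_linear_scaleR_const bounded_linear_inner_left)
  moreover have "f = (\<lambda>x. \<Sum>b\<in>onb. (x \<bullet> b) *\<^sub>R f b)" using linear_onb_expand[OF assms] by blast
  ultimately show ?thesis by simp
qed

text \<open>Compactness of closed balls makes the supports of bump functions on a manifold closed;
  completeness is needed to differentiate under the integral in Hadamard's lemma.\<close>

instance finite_dim_inner \<subseteq> heine_borel
proof
  fix f :: "nat \<Rightarrow> 'a"
  assume f: "bounded (range f)"
  have "\<forall>d\<subseteq>onb. \<exists>l::'a. \<exists>r. strict_mono r \<and>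
      (\<forall>e>0. eventually (\<lambda>n. \<forall>i\<in>d. dist (f (r n) \<bullet> i) (l \<bullet> i) < e) sequentially)"
    by (rule compact_lemma_general[where unproj="\<lambda>e. \<Sum>i\<in>onb. e i *\<^sub>R i"])
      (auto intro!: f bounded_linear_inner_left bounded_linear_image simp: onb_expand inner_sum_onb)
  then obtain l :: 'a and r where r: "strict_mono r"
    "\<And>e. e > 0 \<Longrightarrow> eventually (\<lambda>n. \<forall>i\<in>onb. dist (f (r n) \<bullet> i) (l \<bullet> i) < e) sequentially"
    by blast
  have "(\<lambda>n. f (r n) \<bullet> i) \<longlonglongrightarrow> l \<bullet> i" if "i \<in> onb" for i
    unfolding tendsto_iff
  proof (intro allI impI)
    fix e :: real assume "e > 0"
    show "\<forall>\<^sub>F n in sequentially. dist (f (r n) \<bullet> i) (l \<bullet> i) < e"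
      using r(2)[OF \<open>e > 0\<close>] by eventually_elim (use that in auto)
  qed
  then have "(\<lambda>n. \<Sum>i\<in>onb. (f (r n) \<bullet> i) *\<^sub>R i) \<longlonglongrightarrow> (\<Sum>i\<in>onb. (l \<bullet> i) *\<^sub>R i)"
    by (intro tendsto_sum tendsto_scaleR tendsto_const)
  then have "(f \<circ> r) \<longlonglongrightarrow> l" by (simp add: onb_expand o_def)
  then show "\<exists>l r. strict_mono r \<and> (f \<circ> r) \<longlonglongrightarrow> l" using r(1) by blast
qed

instance finite_dim_inner \<subseteq> banach ..

text \<open>Smooth families are maps on a product of model spaces, and the chain rule needs finite-dimensional
  intermediate spaces.\<close>

instance prod :: (finite_dim_inner, finite_dim_inner) finite_dim_inner
proof
  show "\<exists>B. finite B \<and> (\<forall>x. \<exists>r. x = (\<Sum>b\<in>B. r b *\<^sub>R (b::'a \<times> 'b)))"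
  proof (intro exI[of _ "(\<lambda>b. (b, 0)) ` onb \<union> (\<lambda>b. (0, b)) ` onb"] conjI allI)
    let ?f = "\<lambda>b::'a. (b, 0::'b)" and ?g = "\<lambda>b::'b. (0::'a, b)"
    fix x :: "'a \<times> 'b"
    have nz: "(0::'a) \<notin> onb" using inner_onb[of "0::'a" 0] by auto
    have nz': "(0::'b) \<notin> onb" using inner_onb[of "0::'b" 0] by auto
    have "(\<Sum>b\<in>?f ` onb \<union> ?g ` onb. (x \<bullet> b) *\<^sub>R b)
        = (\<Sum>b\<in>?f ` onb. (x \<bullet> b) *\<^sub>R b) + (\<Sum>b\<in>?g ` onb. (x \<bullet> b) *\<^sub>R b)"
      using nz nz' by (intro sum.union_disjoint) auto
    also have "\<dots> = (\<Sum>b\<in>onb. (x \<bullet> ?f b) *\<^sub>R ?f b) + (\<Sum>b\<in>onb. (x \<bullet> ?g b) *\<^sub>R ?g b)"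
      by (subst sum.reindex, simp add: inj_on_def, subst sum.reindex, simp add: inj_on_def) simp
    also have "\<dots> = x"
      by (rule prod_eqI) (simp_all add: fst_sum snd_sum onb_expand inner_prod_def)
    finally show "\<exists>r. x = (\<Sum>b\<in>?f ` onb \<union> ?g ` onb. r b *\<^sub>R b)"
      by (intro exI[of _ "inner x"]) simp
  qed simp
qed

section \<open>Calculus of smooth maps\<close>

lemma Ck_on_cong:
  assumes "open S" "Ck_on k S f" "\<And>x. x \<in> S \<Longrightarrow> f x = g x"
  shows "Ck_on k S g"
  using assms(2,3)
proof (induction k arbitrary: f g)
  case 0
  then show ?case by (simp cong: continuous_on_cong)
next
  case (Suc k)
  have D: "(g has_derivative frechet_derivative f (at x)) (at x)" if "x \<in> S" for x
    by (rule has_derivative_transform_within_open[of f _ _ _ S])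
      (use Suc.prems that assms(1) in \<open>auto simp: frechet_derivative_works\<close>)
  have "Ck_on k S (\<lambda>x. frechet_derivative g (at x) v)" for v
    by (rule Suc.IH[of "\<lambda>x. frechet_derivative f (at x) v"])
      (use Suc.prems(1) frechet_derivative_at[OF D] in auto)
  then show ?case using D by (auto simp: differentiable_def)
qed

text \<open>Any candidate for the derivative may be used, not only the chosen one.\<close>

lemma Ck_on_SucI:
  assumes "open S" "\<And>x. x \<in> S \<Longrightarrow> (f has_derivative f' x) (at x)" "\<And>v. Ck_on k S (\<lambda>x. f' x v)"
  shows "Ck_on (Suc k) S f"
proof -
  have "Ck_on k S (\<lambda>x. frechet_derivative f (at x) v)" for v
    by (rule Ck_on_cong[OF assms(1,3)]) (simp add: frechet_derivative_at[OF assms(2)])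
  then show ?thesis using assms(2) by (auto simp: differentiable_def)
qed

lemma Ck_on_SucD:
  assumes "Ck_on (Suc k) S f"
  shows "x \<in> S \<Longrightarrow> (f has_derivative frechet_derivative f (at x)) (at x)"
    and "Ck_on k S (\<lambda>x. frechet_derivative f (at x) v)"
  using assms by (auto simp: frechet_derivative_works)

lemma Ck_on_subset: "Ck_on k S f \<Longrightarrow> T \<subseteq> S \<Longrightarrow> Ck_on k T f"
  by (induction k arbitrary: f) (auto intro: continuous_on_subset)

lemma Ck_on_Suc: "Ck_on (Suc k) S f \<Longrightarrow> Ck_on k S f"
proof (induction k arbitrary: f)
  case 0
  then show ?case
    by (auto intro!: continuous_at_imp_continuous_on differentiable_imp_continuous_within)
next
  case (Suc k)
  have "Ck_on k S (\<lambda>x. frechet_derivative f (at x) v)" for v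
    using Suc.prems by (intro Suc.IH) (simp del: Ck_on.simps(2) add: Ck_on.simps(2)[of "Suc k"])
  moreover have "\<forall>x\<in>S. f differentiable (at x)" using Suc.prems by simp
  ultimately show ?case by simp
qed

lemma Ck_on_local:
  assumes "\<And>x. x \<in> S \<Longrightarrow> \<exists>T. open T \<and> x \<in> T \<and> Ck_on k T f"
  shows "Ck_on k S f"
  using assms
proof (induction k arbitrary: f)
  case 0
  show ?case unfolding Ck_on.simps
  proof (rule continuous_at_imp_continuous_on, rule ballI)
    fix x assume "x \<in> S"
    then obtain T where "open T" "x \<in> T" "continuous_on T f" using 0 by force
    then show "isCont f x" by (simp add: continuous_on_eq_continuous_at)
  qed
next
  case (Suc k)
  have "f differentiable (at x)" if "x \<in> S" for x using Suc.prems[OF that] by auto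
  moreover have "Ck_on k S (\<lambda>x. frechet_derivative f (at x) v)" for v
    using Suc.prems by (intro Suc.IH) fastforce
  ultimately show ?case by simp
qed

lemma Ck_on_const: "open S \<Longrightarrow> Ck_on k S (\<lambda>x. c)"
proof (induction k arbitrary: c)
  case (Suc k)
  show ?case by (rule Ck_on_SucI[OF Suc.prems has_derivative_const]) (rule Suc.IH[OF Suc.prems])
qed simp

lemma Ck_on_bounded_linear:
  assumes "open S" "bounded_linear L" "Ck_on k S f"
  shows "Ck_on k S (\<lambda>x. L (f x))"
  using assms(3)
proof (induction k arbitrary: f)
  case 0
  then show ?case using assms(2) by (simp add: bounded_linear.continuous_on)
next
  case (Suc k)
  show ?case
    by (rule Ck_on_SucI[OF assms(1) bounded_linear.has_derivative[OF assms(2)]])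
      (rule Ck_on_SucD(1)[OF Suc.prems] Suc.IH Ck_on_SucD(2)[OF Suc.prems] | assumption)+
qed

lemma Ck_on_add:
  assumes "open S" "Ck_on k S f" "Ck_on k S g"
  shows "Ck_on k S (\<lambda>x. f x + g x)"
  using assms(2,3)
proof (induction k arbitrary: f g)
  case 0
  then show ?case by (simp add: continuous_on_add)
next
  case (Suc k)
  show ?case
    by (rule Ck_on_SucI[OF assms(1) has_derivative_add])
      (rule Ck_on_SucD(1)[OF Suc.prems(1)] Ck_on_SucD(1)[OF Suc.prems(2)]
         Suc.IH Ck_on_SucD(2)[OF Suc.prems(1)] Ck_on_SucD(2)[OF Suc.prems(2)] | assumption)+
qed

lemma Ck_on_sum:
  assumes "open S" "\<And>i. i \<in> I \<Longrightarrow> Ck_on k S (f i)"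
  shows "Ck_on k S (\<lambda>x. \<Sum>i\<in>I. f i x)"
  using assms(2)
  by (induction I rule: infinite_finite_induct) (auto simp: assms(1) Ck_on_const Ck_on_add)

lemma Ck_on_bilinear:
  assumes "open S" "bounded_bilinear \<beta>" "Ck_on k S f" "Ck_on k S g"
  shows "Ck_on k S (\<lambda>x. \<beta> (f x) (g x))"
  using assms(3,4)
proof (induction k arbitrary: f g)
  case 0
  then show ?case using assms(2) by (simp add: bounded_bilinear.continuous_on)
next
  case (Suc k)
  show ?case
  proof (rule Ck_on_SucI[OF assms(1) bounded_bilinear.FDERIV[OF assms(2)]])
    show "Ck_on k S (\<lambda>x. \<beta> (f x) (frechet_derivative g (at x) v)
        + \<beta> (frechet_derivative f (at x) v) (g x))" for v
      by (intro Ck_on_add assms Suc.IH Ck_on_Suc[OF Suc.prems(1)] Ck_on_Suc[OF Suc.prems(2)]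
          Ck_on_SucD(2)[OF Suc.prems(1)] Ck_on_SucD(2)[OF Suc.prems(2)])
  qed (rule Ck_on_SucD(1)[OF Suc.prems(1)] Ck_on_SucD(1)[OF Suc.prems(2)] | assumption)+
qed

lemma Ck_on_linear_map:
  assumes "open S" "bounded_linear L"
  shows "Ck_on k S L"
proof (cases k)
  case 0
  then show ?thesis using assms(2) by (simp add: linear_continuous_on)
next
  case (Suc j)
  then show ?thesis
    using Ck_on_SucI[OF assms(1) bounded_linear_imp_has_derivative[OF assms(2)] Ck_on_const[OF assms(1)]]
    by blast
qed

lemma Ck_on_compose:
  fixes f :: "'a::real_normed_vector \<Rightarrow> 'b::finite_dim_inner"
  assumes "open S" "open T" "Ck_on k S f" "Ck_on k T g" "f ` S \<subseteq> T"
  shows "Ck_on k S (\<lambda>x. g (f x))"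
  using assms(3,4)
proof (induction k arbitrary: g)
  case 0
  then show ?case using assms(5) continuous_on_compose2[of T g S f] by simp
next
  case (Suc k)
  let ?f' = "\<lambda>x. frechet_derivative f (at x)" and ?g' = "\<lambda>x. frechet_derivative g (at x)"
  note f = Ck_on_SucD[OF Suc.prems(1)] and g = Ck_on_SucD[OF Suc.prems(2)]
  \<comment> \<open>The order of smoothness is described by derivatives in fixed directions, but the inner derivative supplies a
    varying direction. Expanding it in an orthonormal basis separates the two dependences.\<close>
  show ?case
  proof (rule Ck_on_SucI[OF assms(1)])
    show "((\<lambda>x. g (f x)) has_derivative (\<lambda>v. \<Sum>b\<in>onb. (?f' x v \<bullet> b) *\<^sub>R ?g' (f x) b)) (at x)"
      if "x \<in> S" for x
    proof -
      have fx: "f x \<in> T" using that assms(5) by auto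
      have "((\<lambda>x. g (f x)) has_derivative (\<lambda>v. ?g' (f x) (?f' x v))) (at x)"
        by (rule has_derivative_compose[OF f(1)[OF that] g(1)[OF fx]])
      moreover have "(\<lambda>v. ?g' (f x) (?f' x v)) = (\<lambda>v. \<Sum>b\<in>onb. (?f' x v \<bullet> b) *\<^sub>R ?g' (f x) b)"
        by (rule ext, rule linear_onb_expand) (rule has_derivative_linear[OF g(1)[OF fx]])
      ultimately show ?thesis by (simp only:)
    qed
    show "Ck_on k S (\<lambda>x. \<Sum>b\<in>onb. (?f' x v \<bullet> b) *\<^sub>R ?g' (f x) b)" for v
      by (intro Ck_on_sum assms Ck_on_bilinear[OF _ bounded_bilinear_scaleR]
          Ck_on_bounded_linear[OF _ bounded_linear_inner_left] f(2) Suc.IH Ck_on_Suc[OF Suc.prems(1)] g(2))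
  qed
qed

text \<open>Smoothness near a point. On a manifold all arguments are local, and this form is stable under
  changes away from the point.\<close>

definition smooth_at :: "('a::real_normed_vector \<Rightarrow> 'b::real_normed_vector) \<Rightarrow> 'a \<Rightarrow> bool" where
  "smooth_at f x \<longleftrightarrow> (\<exists>S. open S \<and> x \<in> S \<and> smooth_on S f)"

lemma smooth_on_Ck_on_Int:
  "smooth_on S f \<Longrightarrow> Ck_on k (S \<inter> T) f" "smooth_on T f \<Longrightarrow> Ck_on k (S \<inter> T) f"
  unfolding smooth_on_def by (auto elim!: allE[of _ k] Ck_on_subset)

lemma smooth_on_iff_smooth_at:
  assumes "open S"
  shows "smooth_on S f \<longleftrightarrow> (\<forall>x\<in>S. smooth_at f x)"
proof
  assume "\<forall>x\<in>S. smooth_at f x"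
  then show "smooth_on S f"
    unfolding smooth_on_def smooth_at_def by (intro allI Ck_on_local) blast
qed (use assms smooth_at_def in blast)

lemma smooth_at_cong:
  assumes "smooth_at f x" "\<forall>\<^sub>F y in nhds x. f y = g y"
  shows "smooth_at g x"
proof -
  obtain S where S: "open S" "x \<in> S" "smooth_on S f" using assms(1) smooth_at_def by blast
  obtain T where T: "open T" "x \<in> T" "\<forall>y\<in>T. f y = g y" using assms(2) unfolding eventually_nhds by blast
  have "smooth_on (S \<inter> T) g" unfolding smooth_on_def
    using S T by (intro allI Ck_on_cong[of "S \<inter> T" _ f g] open_Int smooth_on_Ck_on_Int(1)) auto
  then show ?thesis unfolding smooth_at_def using S T by (intro exI[of _ "S \<inter> T"]) auto
qed

lemma smooth_at_has_derivative:
  assumes "smooth_at f x"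
  shows "(f has_derivative frechet_derivative f (at x)) (at x)"
  using assms Ck_on_SucD(1) unfolding smooth_at_def smooth_on_def by blast

lemma smooth_at_frechet_derivative:
  assumes "smooth_at f x"
  shows "smooth_at (\<lambda>y. frechet_derivative f (at y) v) x"
  using assms Ck_on_SucD(2) unfolding smooth_at_def smooth_on_def by blast

lemma smooth_at_const: "smooth_at (\<lambda>x. c) x"
  unfolding smooth_at_def smooth_on_def using Ck_on_const open_UNIV by blast

lemma smooth_at_linear_map: "bounded_linear L \<Longrightarrow> smooth_at L x"
  unfolding smooth_at_def smooth_on_def using Ck_on_linear_map open_UNIV by blast

lemma smooth_at_ident: "smooth_at (\<lambda>x. x) x"
  by (rule smooth_at_linear_map[OF bounded_linear_ident])

lemma smooth_at_bounded_linear: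
  assumes "bounded_linear L" "smooth_at f x"
  shows "smooth_at (\<lambda>y. L (f y)) x"
  using assms Ck_on_bounded_linear unfolding smooth_at_def smooth_on_def by blast

lemma smooth_at_bilinear:
  assumes "bounded_bilinear \<beta>" "smooth_at f x" "smooth_at g x"
  shows "smooth_at (\<lambda>y. \<beta> (f y) (g y)) x"
proof -
  obtain S where S: "open S" "x \<in> S" "smooth_on S f" using assms(2) smooth_at_def by blast
  obtain T where T: "open T" "x \<in> T" "smooth_on T g" using assms(3) smooth_at_def by blast
  have "smooth_on (S \<inter> T) (\<lambda>y. \<beta> (f y) (g y))" unfolding smooth_on_def
    by (rule allI, rule Ck_on_bilinear[OF open_Int[OF S(1) T(1)] assms(1)
          smooth_on_Ck_on_Int(1)[OF S(3)] smooth_on_Ck_on_Int(2)[OF T(3)]])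
  then show ?thesis unfolding smooth_at_def using S T by (intro exI[of _ "S \<inter> T"]) auto
qed

lemma smooth_at_scaleR: "smooth_at f x \<Longrightarrow> smooth_at g x \<Longrightarrow> smooth_at (\<lambda>y. f y *\<^sub>R g y) x"
  by (rule smooth_at_bilinear[OF bounded_bilinear_scaleR])

lemma smooth_at_mult:
  "smooth_at f x \<Longrightarrow> smooth_at g x \<Longrightarrow> smooth_at (\<lambda>y. f y * g y :: real) x"
  by (rule smooth_at_bilinear[OF bounded_bilinear_mult])

lemma smooth_at_inner: "smooth_at f x \<Longrightarrow> smooth_at g x \<Longrightarrow> smooth_at (\<lambda>y. f y \<bullet> g y) x"
  by (rule smooth_at_bilinear[OF bounded_bilinear_inner])

lemma smooth_at_add:
  assumes "smooth_at f x" "smooth_at g x"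
  shows "smooth_at (\<lambda>y. f y + g y) x"
proof -
  obtain S where S: "open S" "x \<in> S" "smooth_on S f" using assms(1) smooth_at_def by blast
  obtain T where T: "open T" "x \<in> T" "smooth_on T g" using assms(2) smooth_at_def by blast
  have "smooth_on (S \<inter> T) (\<lambda>y. f y + g y)" unfolding smooth_on_def
    using S T by (intro allI Ck_on_add open_Int smooth_on_Ck_on_Int)
  then show ?thesis unfolding smooth_at_def using S T by (intro exI[of _ "S \<inter> T"]) auto
qed

lemma smooth_at_sum:
  "(\<And>i. i \<in> I \<Longrightarrow> smooth_at (f i) x) \<Longrightarrow> smooth_at (\<lambda>y. \<Sum>i\<in>I. f i y) x"
  by (induction I rule: infinite_finite_induct) (auto simp: smooth_at_const smooth_at_add)

lemma smooth_at_diff: "smooth_at f x \<Longrightarrow> smooth_at g x \<Longrightarrow> smooth_at (\<lambda>y. f y - g y) x"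
  using smooth_at_add[of f x "\<lambda>y. - g y"] smooth_at_bounded_linear[OF bounded_linear_minus[OF bounded_linear_ident]]
  by fastforce

lemma smooth_at_Pair:
  assumes "smooth_at f x" "smooth_at g x"
  shows "smooth_at (\<lambda>y. (f y, g y)) x"
proof -
  have "smooth_at (\<lambda>y. (f y, 0) + (0, g y)) x"
    by (intro smooth_at_add smooth_at_bounded_linear[of "\<lambda>u. (u, 0)"]
        smooth_at_bounded_linear[of "\<lambda>u. (0, u)"] assms)
      (auto intro!: bounded_linear_Pair bounded_linear_ident bounded_linear_zero)
  then show ?thesis by simp
qed

lemma smooth_at_compose:
  fixes f :: "'a::real_normed_vector \<Rightarrow> 'b::finite_dim_inner"
  assumes "smooth_at f x" "smooth_at g (f x)"
  shows "smooth_at (\<lambda>y. g (f y)) x"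
proof -
  obtain S where S: "open S" "x \<in> S" "smooth_on S f" using assms(1) smooth_at_def by blast
  obtain T where T: "open T" "f x \<in> T" "smooth_on T g" using assms(2) smooth_at_def by blast
  have "continuous_on S f" using S(3) unfolding smooth_on_def using Ck_on.simps(1) by blast
  then have o: "open (S \<inter> f -` T)" using S(1) T(1) by (rule continuous_open_preimage)
  have "smooth_on (S \<inter> f -` T) (\<lambda>y. g (f y))" unfolding smooth_on_def
    by (rule allI, rule Ck_on_compose[OF o T(1) smooth_on_Ck_on_Int(1)[OF S(3)]])
      (use T(3) in \<open>auto simp: smooth_on_def\<close>)
  with o show ?thesis unfolding smooth_at_def using S T by (intro exI[of _ "S \<inter> f -` T"]) auto
qed

section \<open>Bump functions\<close>

text \<open>The factor \<open>t ^ n\<close> gives a family that is closed under differentiation up to linear combinations,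
  so that smoothness follows by induction on the order, for all \<open>n\<close> at once.\<close>

definition flat :: "nat \<Rightarrow> real \<Rightarrow> real" where
  "flat n t = (if t > 0 then exp (- 1 / t) / t ^ n else 0)"

lemma flat_has_derivative:
  "(flat n has_real_derivative (flat (n + 2) t - n * flat (n + 1) t)) (at t)"
proof -
  consider "t > 0" | "t < 0" | "t = 0" by linarith
  then show ?thesis
  proof cases
    case 1
    have p: "real n * t ^ (n - 1) = real n * t ^ n / t" using 1 by (cases n) auto
    have "((\<lambda>t. exp (- 1 / t) / t ^ n) has_real_derivative
        (exp (- 1 / t) * (1 / t\<^sup>2) * t ^ n - exp (- 1 / t) * (real n * t ^ (n - 1))) / (t ^ n * t ^ n)) (at t)"
      using 1 by (auto intro!: derivative_eq_intros simp: power2_eq_square)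
    also have "(exp (- 1 / t) * (1 / t\<^sup>2) * t ^ n - exp (- 1 / t) * (real n * t ^ (n - 1))) / (t ^ n * t ^ n)
        = flat (n + 2) t - n * flat (n + 1) t"
      unfolding p using 1 by (simp add: flat_def power2_eq_square field_simps)
    finally have "((\<lambda>t. exp (- 1 / t) / t ^ n) has_real_derivative (flat (n + 2) t - n * flat (n + 1) t)) (at t)" .
    then show ?thesis
      by (rule DERIV_cong_ev[THEN iffD1, rotated -1])
        (use 1 in \<open>auto simp: flat_def eventually_nhds intro!: exI[of _ "{0<..}"]\<close>)
  next
    case 2
    have "((\<lambda>t. 0) has_real_derivative (flat (n + 2) t - n * flat (n + 1) t)) (at t)"
      using 2 by (auto simp: flat_def)
    then show ?thesis
      by (rule DERIV_cong_ev[THEN iffD1, rotated -1])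
        (use 2 in \<open>auto simp: flat_def eventually_nhds intro!: exI[of _ "{..<0}"]\<close>)
  next
    case 3
    have "((\<lambda>h. inverse h ^ (n + 1) / exp (inverse h)) \<longlongrightarrow> (0::real)) (at_right 0)"
      by (rule filterlim_compose[OF tendsto_power_div_exp_0 filterlim_inverse_at_top_right])
    then have "((\<lambda>h. flat n h / h) \<longlongrightarrow> 0) (at_right 0)"
      by (rule tendsto_cong[THEN iffD1, rotated])
        (auto simp: flat_def eventually_at_right_field exp_minus field_simps intro!: exI[of _ 1])
    moreover have "((\<lambda>h. flat n h / h) \<longlongrightarrow> 0) (at_left 0)"
      by (rule tendsto_cong[THEN iffD1, rotated, OF tendsto_const])
        (auto simp: flat_def eventually_at_left_field intro!: exI[of _ "-1"])
    ultimately have "((\<lambda>h. flat n h / h) \<longlongrightarrow> 0) (at 0)" by (simp add: filterlim_at_split)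
    then show ?thesis using 3 by (simp add: DERIV_def flat_def)
  qed
qed

lemma Ck_on_flat: "Ck_on k UNIV (flat n)"
proof (induction k arbitrary: n)
  case 0
  then show ?case
    by (auto intro!: continuous_at_imp_continuous_on DERIV_isCont[OF flat_has_derivative])
next
  case (Suc k)
  show ?case
  proof (rule Ck_on_SucI)
    show "(flat n has_derivative (\<lambda>v. (flat (n + 2) t + (- real n) * flat (n + 1) t) * v)) (at t)" for t
      using flat_has_derivative[of n t] by (simp add: has_field_derivative_def)
    show "Ck_on k UNIV (\<lambda>t. (flat (n + 2) t + (- real n) * flat (n + 1) t) * v)" for v
      by (intro Ck_on_bounded_linear[OF _ bounded_linear_mult_left] Ck_on_add
          Ck_on_bounded_linear[OF _ bounded_linear_mult_right] Suc.IH open_UNIV)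
  qed simp
qed

lemma smooth_at_flat: "smooth_at (flat n) t"
  unfolding smooth_at_def smooth_on_def using Ck_on_flat by blast

text \<open>The composite \<open>t \<mapsto> flat 0 (1/2 - flat 0 t)\<close> is a positive constant for \<open>t \<le> 0\<close> and zero as soon as
  \<open>flat 0 t \<ge> 1/2\<close>, which holds for \<open>t \<ge> 2\<close>. Inserting a rescaled squared distance gives a function
  that is constant on a ball and vanishes outside the ball of twice the radius.\<close>

lemma ex_bump:
  fixes x0 :: "'a::finite_dim_inner"
  assumes "\<epsilon> > 0"
  obtains \<beta> :: "'a \<Rightarrow> real" where "\<And>x. smooth_at \<beta> x" "\<And>x. dist x0 x \<le> \<epsilon> \<Longrightarrow> \<beta> x = 1"
    "\<And>x. dist x0 x \<ge> 2 * \<epsilon> \<Longrightarrow> \<beta> x = 0"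
proof
  define s where "s x = 2 * (((x - x0) \<bullet> (x - x0)) / \<epsilon>\<^sup>2 - 1)" for x
  define \<beta> where "\<beta> x = flat 0 (1/2 - flat 0 (s x)) * (1 / flat 0 (1/2))" for x
  have s: "smooth_at s x" for x
    unfolding s_def divide_inverse
    by (intro smooth_at_mult smooth_at_diff smooth_at_inner smooth_at_const smooth_at_ident)
  have "smooth_at (\<lambda>x. flat 0 (s x)) x" for x
    by (rule smooth_at_compose[OF s smooth_at_flat])
  then have "smooth_at (\<lambda>x. 1/2 - flat 0 (s x)) x" for x
    by (intro smooth_at_diff smooth_at_const)
  then have "smooth_at (\<lambda>x. flat 0 (1/2 - flat 0 (s x))) x" for x
    by (rule smooth_at_compose[OF _ smooth_at_flat])
  then show "smooth_at \<beta> x" for x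
    unfolding \<beta>_def by (intro smooth_at_mult smooth_at_const)
  have d: "(x - x0) \<bullet> (x - x0) = (dist x0 x)\<^sup>2" for x
    by (simp add: dist_norm norm_minus_commute dot_square_norm)
  show "\<beta> x = 1" if "dist x0 x \<le> \<epsilon>" for x
  proof -
    have "(dist x0 x)\<^sup>2 \<le> \<epsilon>\<^sup>2" using that by (intro power_mono) auto
    then have "(dist x0 x)\<^sup>2 / \<epsilon>\<^sup>2 \<le> 1" using assms by simp
    then have "s x \<le> 0" by (simp add: s_def d)
    then show ?thesis by (simp add: \<beta>_def flat_def)
  qed
  show "\<beta> x = 0" if "dist x0 x \<ge> 2 * \<epsilon>" for x
  proof -
    have "(dist x0 x)\<^sup>2 \<ge> (2 * \<epsilon>)\<^sup>2" using that assms by (intro power_mono) auto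
    then have "(dist x0 x)\<^sup>2 / \<epsilon>\<^sup>2 \<ge> 4" using assms by (simp add: field_simps power_mult_distrib)
    then have "s x \<ge> 2" by (simp add: s_def d)
    then have "1 / s x \<le> 1/2" by (simp add: field_simps)
    \<comment> \<open>The bound \<open>exp y \<ge> 1 + y\<close> gives \<open>exp (-1/t) \<ge> 1/2\<close> for \<open>t \<ge> 2\<close>.\<close>
    moreover have "exp (- (1 / s x)) \<ge> 1 + - (1 / s x)" by (rule exp_ge_add_one_self)
    ultimately have "exp (- (1 / s x)) \<ge> 1/2" by linarith
    then have "flat 0 (s x) \<ge> 1/2" using \<open>s x \<ge> 2\<close> by (simp add: flat_def)
    then show ?thesis by (simp add: \<beta>_def flat_def)
  qed
qed

section \<open>Hadamard's lemma\<close>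

text \<open>Differentiating under the integral in direction \<open>v\<close> produces an integral of the same kind, with \<open>H\<close>
  replaced by its directional derivative and with one more power of \<open>t\<close>. The weight \<open>t ^ m\<close> makes the
  family closed under this operation.\<close>

lemma smooth_radial_integral:
  fixes H :: "'a::finite_dim_inner \<Rightarrow> real"
  assumes "open S" "convex S" "x0 \<in> S" "smooth_on S H"
  shows "smooth_on S (\<lambda>x. integral {0..1} (\<lambda>t. t ^ m * H (x0 + t *\<^sub>R (x - x0))))"
proof -
  have seg: "x0 + t *\<^sub>R (x - x0) \<in> S" if "x \<in> S" "t \<in> {0..1}" for x t
    using convexD_alt[OF assms(2,3) that(1), of t] that(2) by (simp add: algebra_simps)
  have deriv: "((\<lambda>x. integral {0..1} (\<lambda>t. t ^ m * H (x0 + t *\<^sub>R (x - x0)))) has_derivative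
      (\<lambda>v. integral {0..1} (\<lambda>t. t ^ Suc m * frechet_derivative H (at (x0 + t *\<^sub>R (x - x0))) v))) (at x)"
    if H: "smooth_on S H" and x: "x \<in> S" for H :: "'a \<Rightarrow> real" and m x
  proof -
    let ?D = "\<lambda>y. frechet_derivative H (at y)"
    \<comment> \<open>the derivative as a continuous map into bounded linear functionals, as Leibniz' rule requires\<close>
    define D where "D y = (\<Sum>b\<in>onb. ?D y b *\<^sub>R blinfun_inner_left b)" for y
    have H': "(H has_derivative ?D y) (at y)" if "y \<in> S" for y
      using H that smooth_at_has_derivative smooth_on_iff_smooth_at[OF assms(1)] by blast
    have D: "blinfun_apply (D y) v = ?D y v" if "y \<in> S" for y v
      using linear_onb_expand[OF has_derivative_linear[OF H'[OF that]], of v]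
      by (simp add: D_def blinfun.sum_left blinfun.scaleR_left inner_commute mult.commute)
    have contD: "continuous_on S (\<lambda>y. ?D y v)" for v
      using H Ck_on_SucD(2)[of 0 S H] unfolding smooth_on_def Ck_on.simps(1) by blast
    have contD': "continuous_on S D" unfolding D_def by (intro continuous_intros contD)
    have contH: "continuous_on S H" using H unfolding smooth_on_def using Ck_on.simps(1) by blast
    define G where "G x t = t ^ Suc m *\<^sub>R D (x0 + t *\<^sub>R (x - x0))" for x t
    have cont: "continuous_on (S \<times> cbox 0 1) (\<lambda>(x, t). G x t)"
      unfolding G_def split_beta
      by (intro continuous_intros continuous_on_compose2[OF contD']) (auto intro: seg)
    have contx: "continuous_on (cbox 0 1) (G x)" if "x \<in> S" for x
      unfolding G_def
      by (intro continuous_intros continuous_on_compose2[OF contD']) (auto intro: seg that)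
    have "((\<lambda>x. integral (cbox 0 1) (\<lambda>t. t ^ m * H (x0 + t *\<^sub>R (x - x0)))) has_derivative
        integral (cbox 0 1) (G x)) (at x within S)"
    proof (rule leibniz_rule[where f = "\<lambda>x t. t ^ m * H (x0 + t *\<^sub>R (x - x0))", OF _ _ cont x assms(2)])
      fix x and t :: real assume x: "x \<in> S" and "t \<in> cbox 0 1"
      then have t: "t \<in> {0..1}" by simp
      have "((\<lambda>x. H (x0 + t *\<^sub>R (x - x0))) has_derivative (\<lambda>v. ?D (x0 + t *\<^sub>R (x - x0)) (t *\<^sub>R v))) (at x)"
        by (rule has_derivative_compose[of "\<lambda>x. x0 + t *\<^sub>R (x - x0)", OF _ H'[OF seg[OF x t]]])
          (auto intro!: derivative_eq_intros)
      then have "((\<lambda>x. t ^ m * H (x0 + t *\<^sub>R (x - x0))) has_derivative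
          (\<lambda>v. t ^ m * ?D (x0 + t *\<^sub>R (x - x0)) (t *\<^sub>R v))) (at x)"
        by (rule has_derivative_mult_right)
      moreover have "t ^ m * ?D (x0 + t *\<^sub>R (x - x0)) (t *\<^sub>R v) = blinfun_apply (G x t) v" for v
        using linear_cmul[OF has_derivative_linear[OF H'[OF seg[OF x t]]], of t v]
        by (simp add: G_def blinfun.scaleR_left D[OF seg[OF x t]])
      ultimately show "((\<lambda>x. t ^ m * H (x0 + t *\<^sub>R (x - x0))) has_derivative blinfun_apply (G x t)) (at x within S)"
        using has_derivative_at_withinI by (metis (no_types, lifting) ext)
    next
      fix x assume "x \<in> S"
      then show "(\<lambda>t. t ^ m * H (x0 + t *\<^sub>R (x - x0))) integrable_on cbox 0 1"
        by (intro integrable_continuous continuous_intros continuous_on_compose2[OF contH]) (auto intro: seg)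
    qed
    moreover have "blinfun_apply (integral (cbox 0 1) (G x))
        = (\<lambda>v. integral {0..1} (\<lambda>t. t ^ Suc m * ?D (x0 + t *\<^sub>R (x - x0)) v))"
    proof
      fix v
      have "blinfun_apply (integral (cbox 0 1) (G x)) v = integral (cbox 0 1) ((\<lambda>b. blinfun_apply b v) \<circ> G x)"
        by (rule integral_linear[symmetric, OF integrable_continuous[OF contx[OF x]]
              blinfun.bounded_linear_left])
      also have "\<dots> = integral {0..1} (\<lambda>t. t ^ Suc m * ?D (x0 + t *\<^sub>R (x - x0)) v)"
        by (simp, intro integral_cong) (auto simp: G_def blinfun.scaleR_left D[OF seg[OF x]])
      finally show "blinfun_apply (integral (cbox 0 1) (G x)) v
        = integral {0..1} (\<lambda>t. t ^ Suc m * ?D (x0 + t *\<^sub>R (x - x0)) v)" .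
    qed
    ultimately show ?thesis
      unfolding at_within_open[OF x assms(1)] cbox_interval by (simp only:)
  qed
  have "Ck_on k S (\<lambda>x. integral {0..1} (\<lambda>t. t ^ m * H (x0 + t *\<^sub>R (x - x0))))"
    if "smooth_on S H" for k m and H :: "'a \<Rightarrow> real"
    using that
  proof (induction k arbitrary: H m)
    case 0
    then show ?case using deriv[OF 0]
      by (auto intro!: continuous_at_imp_continuous_on has_derivative_continuous)
  next
    case (Suc k)
    have "smooth_on S (\<lambda>y. frechet_derivative H (at y) v)" for v
      using Suc.prems Ck_on_SucD(2) unfolding smooth_on_def by blast
    then show ?case by (intro Ck_on_SucI[OF assms(1) deriv[OF Suc.prems]] Suc.IH)
  qed
  then show ?thesis using assms(4) by (simp add: smooth_on_def)
qed

text \<open>Integrate the derivative of \<open>F\<close> along the segment from \<open>x0\<close> to \<open>x\<close>.\<close>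

lemma Hadamard:
  fixes F :: "'a::finite_dim_inner \<Rightarrow> real"
  assumes "open S" "convex S" "x0 \<in> S" "smooth_on S F"
  obtains G where "\<And>b. smooth_on S (G b)" "\<And>b. G b x0 = frechet_derivative F (at x0) b"
    "\<And>x. x \<in> S \<Longrightarrow> F x = F x0 + (\<Sum>b\<in>onb. ((x - x0) \<bullet> b) * G b x)"
proof
  let ?D = "\<lambda>y. frechet_derivative F (at y)"
  define G where "G b x = integral {0..1} (\<lambda>t::real. t ^ 0 * ?D (x0 + t *\<^sub>R (x - x0)) b)" for b x
  have sm: "smooth_on S (\<lambda>y. ?D y b)" for b
    using assms(4) Ck_on_SucD(2) unfolding smooth_on_def by blast
  then show "smooth_on S (G b)" for b
    unfolding G_def by (rule smooth_radial_integral[OF assms(1-3)])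
  show "G b x0 = ?D x0 b" for b by (simp add: G_def)
  have seg: "x0 + t *\<^sub>R (x - x0) \<in> S" if "x \<in> S" "t \<in> {0..1}" for x t
    using convexD_alt[OF assms(2,3) that(1), of t] that(2) by (simp add: algebra_simps)
  have F': "(F has_derivative ?D y) (at y)" if "y \<in> S" for y
    using assms(4) that smooth_at_has_derivative smooth_on_iff_smooth_at[OF assms(1)] by blast
  fix x assume x: "x \<in> S"
  have "((\<lambda>t. ?D (x0 + t *\<^sub>R (x - x0)) (x - x0)) has_integral
      F (x0 + 1 *\<^sub>R (x - x0)) - F (x0 + 0 *\<^sub>R (x - x0))) {0..1}"
  proof (rule fundamental_theorem_of_calculus)
    fix t :: real assume t: "t \<in> {0..1}"
    have "((\<lambda>t. F (x0 + t *\<^sub>R (x - x0))) has_derivative (\<lambda>h. ?D (x0 + t *\<^sub>R (x - x0)) (h *\<^sub>R (x - x0)))) (at t)"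
      by (rule has_derivative_compose[of "\<lambda>t. x0 + t *\<^sub>R (x - x0)", OF _ F'[OF seg[OF x t]]])
        (auto intro!: derivative_eq_intros)
    then show "((\<lambda>t. F (x0 + t *\<^sub>R (x - x0))) has_vector_derivative
        ?D (x0 + t *\<^sub>R (x - x0)) (x - x0)) (at t within {0..1})"
      unfolding has_vector_derivative_def
      by (simp add: linear_cmul[OF has_derivative_linear[OF F'[OF seg[OF x t]]]] has_derivative_at_withinI)
  qed simp
  then have "integral {0..1} (\<lambda>t. ?D (x0 + t *\<^sub>R (x - x0)) (x - x0)) = F x - F x0"
    by (simp add: integral_unique)
  moreover have "integral {0..1} (\<lambda>t. ?D (x0 + t *\<^sub>R (x - x0)) (x - x0))
      = integral {0..1} (\<lambda>t. \<Sum>b\<in>onb. ((x - x0) \<bullet> b) * ?D (x0 + t *\<^sub>R (x - x0)) b)"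
  proof (rule integral_cong)
    fix t :: real assume "t \<in> {0..1}"
    then show "?D (x0 + t *\<^sub>R (x - x0)) (x - x0) = (\<Sum>b\<in>onb. ((x - x0) \<bullet> b) * ?D (x0 + t *\<^sub>R (x - x0)) b)"
      using linear_onb_expand[OF has_derivative_linear[OF F'[OF seg[OF x]]], of t "x - x0"] by simp
  qed
  moreover have "\<dots> = (\<Sum>b\<in>onb. ((x - x0) \<bullet> b) * G b x)"
  proof -
    have "(\<lambda>t. ?D (x0 + t *\<^sub>R (x - x0)) b) integrable_on {0..1}" for b
    proof (rule integrable_continuous_interval)
      have "continuous_on S (\<lambda>y. ?D y b)" using sm unfolding smooth_on_def using Ck_on.simps(1) by blast
      then show "continuous_on {0..1} (\<lambda>t. ?D (x0 + t *\<^sub>R (x - x0)) b)"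
        by (rule continuous_on_compose2) (auto intro!: continuous_intros seg x)
    qed
    then have "(\<lambda>t. ((x - x0) \<bullet> b) * ?D (x0 + t *\<^sub>R (x - x0)) b) integrable_on {0..1}" for b
      using integrable_cmul[of _ _ "(x - x0) \<bullet> b"] by fastforce
    then show ?thesis by (subst integral_sum) (auto simp: G_def)
  qed
  ultimately show "F x = F x0 + (\<Sum>b\<in>onb. ((x - x0) \<bullet> b) * G b x)" by simp
qed

section \<open>Smooth functions on a manifold\<close>

text \<open>Smoothness near a point in all charts around it; \<open>msmooth_at_chartI\<close> reduces this to one chart.\<close>

definition msmooth_at ::
  "('m, 'a::real_normed_vector) atlas \<Rightarrow> ('m \<Rightarrow> 'b::real_normed_vector) \<Rightarrow> 'm \<Rightarrow> bool" where
  "msmooth_at A f p \<longleftrightarrow> (\<forall>(U, c)\<in>A. p \<in> U \<longrightarrow> smooth_at (\<lambda>x. f (inv_into U c x)) (c p))"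

text \<open>Smoothness near \<open>(p, v)\<close> of a map on the product of the manifold with a vector space.\<close>

definition mfamily_at ::
  "('m, 'a::real_normed_vector) atlas \<Rightarrow> ('m \<Rightarrow> 'f::real_normed_vector \<Rightarrow> 'g::real_normed_vector) \<Rightarrow>
    'm \<Rightarrow> 'f \<Rightarrow> bool" where
  "mfamily_at A h p v \<longleftrightarrow>
     (\<forall>(U, c)\<in>A. p \<in> U \<longrightarrow> smooth_at (\<lambda>(x, v). h (inv_into U c x) v) (c p, v))"

locale smooth_mfd =
  fixes A :: "('m::{t2_space, second_countable_topology}, 'a::finite_dim_inner) atlas"
  assumes smooth_manifold: "smooth_manifold A"
begin

lemma ex_chart: obtains U c where "(U, c) \<in> A" "p \<in> U"
proof -
  have "p \<in> (\<Union>(U, c)\<in>A. U)" using smooth_manifold by (simp add: smooth_manifold_def)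
  then show ?thesis using that by auto
qed

lemma chart:
  assumes "(U, c) \<in> A"
  shows "open U" "open (c ` U)" "homeomorphism U (c ` U) c (inv_into U c)"
  using smooth_manifold assms unfolding smooth_manifold_def by blast+

lemma chart_inv [simp]:
  assumes "(U, c) \<in> A"
  shows "p \<in> U \<Longrightarrow> inv_into U c (c p) = p" "x \<in> c ` U \<Longrightarrow> c (inv_into U c x) = x"
  using chart(3)[OF assms] by (auto simp: homeomorphism_def)

lemma open_chart_image:
  assumes "(U, c) \<in> A" "open W"
  shows "open (c ` (U \<inter> W))"
proof -
  have "continuous_on (c ` U) (inv_into U c)" using chart(3)[OF assms(1)] by (simp add: homeomorphism_def)
  then have "open (c ` U \<inter> inv_into U c -` W)"
    using chart(2)[OF assms(1)] assms(2) by (rule continuous_open_preimage)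
  moreover have "c ` U \<inter> inv_into U c -` W = c ` (U \<inter> W)" using chart_inv[OF assms(1)] by force
  ultimately show ?thesis by simp
qed

lemma eventually_chart_inv:
  assumes "(U, c) \<in> A" "p \<in> U" "\<forall>\<^sub>F q in nhds p. P q"
  shows "\<forall>\<^sub>F x in nhds (c p). x \<in> c ` U \<and> P (inv_into U c x)"
proof -
  obtain W where W: "open W" "p \<in> W" "\<forall>q\<in>W. P q" using assms(3) unfolding eventually_nhds by blast
  show ?thesis unfolding eventually_nhds
    using open_chart_image[OF assms(1) W(1)] W assms(2) chart_inv(1)[OF assms(1)]
    by (intro exI[of _ "c ` (U \<inter> W)"]) auto
qed

lemma eventually_chart:
  assumes "(U, c) \<in> A" "p \<in> U" "\<forall>\<^sub>F x in nhds (c p). P x"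
  shows "\<forall>\<^sub>F q in nhds p. q \<in> U \<and> P (c q)"
proof -
  obtain W where W: "open W" "c p \<in> W" "\<forall>q\<in>W. P q" using assms(3) unfolding eventually_nhds by blast
  have "continuous_on U c" using chart(3)[OF assms(1)] by (simp add: homeomorphism_def)
  then have "open (U \<inter> c -` W)" using chart(1)[OF assms(1)] W(1) by (rule continuous_open_preimage)
  then show ?thesis unfolding eventually_nhds using W assms(2) by (intro exI[of _ "U \<inter> c -` W"]) auto
qed

lemma transition_smooth:
  assumes "(U, c) \<in> A" "(V, d) \<in> A" "p \<in> U" "p \<in> V"
  shows "smooth_at (\<lambda>x. d (inv_into U c x)) (c p)"
proof -
  have "smooth_on (c ` (U \<inter> V)) (d \<circ> inv_into U c)"
    using smooth_manifold assms unfolding smooth_manifold_def by blast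
  then show ?thesis unfolding smooth_at_def o_def
    using open_chart_image[OF assms(1) chart(1)[OF assms(2)]] assms by blast
qed

lemma msmooth_at_chartI:
  assumes "(U, c) \<in> A" "p \<in> U" "smooth_at (\<lambda>x. f (inv_into U c x)) (c p)"
  shows "msmooth_at A f p"
  unfolding msmooth_at_def
proof safe
  fix V d assume d: "(V, d) \<in> A" "p \<in> V"
  have "smooth_at (\<lambda>x. f (inv_into U c (c (inv_into V d x)))) (d p)"
    using smooth_at_compose[OF transition_smooth[OF d(1) assms(1) d(2) assms(2)],
      of "\<lambda>x. f (inv_into U c x)"] assms(3) chart_inv(1)[OF d(1,2)] by simp
  moreover have "\<forall>\<^sub>F x in nhds (d p). x \<in> d ` V \<and> inv_into V d x \<in> U"
    by (rule eventually_chart_inv[OF d eventually_nhds_in_open[OF chart(1)[OF assms(1)] assms(2)]])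
  then have "\<forall>\<^sub>F x in nhds (d p). f (inv_into U c (c (inv_into V d x))) = f (inv_into V d x)"
    by eventually_elim (simp add: assms(1))
  ultimately show "smooth_at (\<lambda>x. f (inv_into V d x)) (d p)" by (rule smooth_at_cong)
qed

lemma msmooth_atD:
  "msmooth_at A f p \<Longrightarrow> (U, c) \<in> A \<Longrightarrow> p \<in> U \<Longrightarrow> smooth_at (\<lambda>x. f (inv_into U c x)) (c p)"
  unfolding msmooth_at_def by blast

lemma smooth_fun_on_iff:
  assumes "open W"
  shows "smooth_fun_on A W f \<longleftrightarrow> (\<forall>p\<in>W. msmooth_at A f p)"
proof -
  have "smooth_on (c ` (U \<inter> W)) (f \<circ> inv_into U c)
      \<longleftrightarrow> (\<forall>p\<in>U \<inter> W. smooth_at (\<lambda>x. f (inv_into U c x)) (c p))" if "(U, c) \<in> A" for U c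
    using smooth_on_iff_smooth_at[OF open_chart_image[OF that assms], of "f \<circ> inv_into U c"]
    by (auto simp: o_def)
  then have "smooth_fun_on A W f
      \<longleftrightarrow> (\<forall>(U, c)\<in>A. \<forall>p\<in>U \<inter> W. smooth_at (\<lambda>x. f (inv_into U c x)) (c p))"
    unfolding smooth_fun_on_def by (intro ball_cong) auto
  then show ?thesis unfolding msmooth_at_def by auto
qed

lemma Cinf_iff: "f \<in> Cinf A \<longleftrightarrow> (\<forall>p. msmooth_at A f p)"
  by (simp add: Cinf_def smooth_fun_on_iff)

lemma smooth_family_on_iff:
  assumes "open W"
  shows "smooth_family_on A W h \<longleftrightarrow> (\<forall>p\<in>W. \<forall>v. mfamily_at A h p v)"
proof -
  have "smooth_on (c ` (U \<inter> W) \<times> UNIV) (\<lambda>(x, v). h (inv_into U c x) v)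
      \<longleftrightarrow> (\<forall>p\<in>U \<inter> W. \<forall>v. smooth_at (\<lambda>(x, v). h (inv_into U c x) v) (c p, v))" if "(U, c) \<in> A" for U c
    by (subst smooth_on_iff_smooth_at[OF open_Times[OF open_chart_image[OF that assms] open_UNIV]]) auto
  then have "smooth_family_on A W h \<longleftrightarrow>
      (\<forall>(U, c)\<in>A. \<forall>p\<in>U \<inter> W. \<forall>v. smooth_at (\<lambda>(x, v). h (inv_into U c x) v) (c p, v))"
    unfolding smooth_family_on_def by (intro ball_cong) auto
  then show ?thesis unfolding mfamily_at_def case_prod_beta by blast
qed

lemma msmooth_at_cong:
  assumes "msmooth_at A f p" "\<forall>\<^sub>F q in nhds p. f q = g q"
  shows "msmooth_at A g p"
proof -
  obtain U c where c: "(U, c) \<in> A" "p \<in> U" by (rule ex_chart)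
  have "\<forall>\<^sub>F x in nhds (c p). f (inv_into U c x) = g (inv_into U c x)"
    using eventually_chart_inv[OF c assms(2)] by eventually_elim simp
  from msmooth_at_chartI[OF c smooth_at_cong[OF msmooth_atD[OF assms(1) c] this]] show ?thesis .
qed

lemma msmooth_at_const: "msmooth_at A (\<lambda>q. c) p"
  and msmooth_at_add: "msmooth_at A f p \<Longrightarrow> msmooth_at A g p \<Longrightarrow> msmooth_at A (\<lambda>q. f q + g q) p"
  and msmooth_at_diff: "msmooth_at A f p \<Longrightarrow> msmooth_at A g p \<Longrightarrow> msmooth_at A (\<lambda>q. f q - g q) p"
  and msmooth_at_scaleR: "msmooth_at A k p \<Longrightarrow> msmooth_at A f p \<Longrightarrow> msmooth_at A (\<lambda>q. k q *\<^sub>R f q) p"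
  and msmooth_at_bounded_linear: "bounded_linear L \<Longrightarrow> msmooth_at A f p \<Longrightarrow> msmooth_at A (\<lambda>q. L (f q)) p"
  by (auto simp: msmooth_at_def intro: smooth_at_const smooth_at_add smooth_at_diff smooth_at_scaleR
      smooth_at_bounded_linear)

lemma msmooth_at_mult:
  "msmooth_at A f p \<Longrightarrow> msmooth_at A g p \<Longrightarrow> msmooth_at A (\<lambda>q. f q * g q :: real) p"
  using msmooth_at_scaleR[of f p g] by simp

lemma msmooth_at_inner_const: "msmooth_at A f p \<Longrightarrow> msmooth_at A (\<lambda>q. f q \<bullet> b) p"
  by (rule msmooth_at_bounded_linear[OF bounded_linear_inner_left])

lemma msmooth_at_sum:
  "(\<And>i. i \<in> I \<Longrightarrow> msmooth_at A (f i) p) \<Longrightarrow> msmooth_at A (\<lambda>q. \<Sum>i\<in>I. f i q) p"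
  by (induction I rule: infinite_finite_induct) (auto simp: msmooth_at_const msmooth_at_add)

lemma msmooth_at_compose:
  fixes f :: "'m \<Rightarrow> 'c::finite_dim_inner"
  assumes "msmooth_at A f p" "smooth_at g (f p)"
  shows "msmooth_at A (\<lambda>q. g (f q)) p"
proof -
  obtain U c where c: "(U, c) \<in> A" "p \<in> U" by (rule ex_chart)
  show ?thesis
    by (rule msmooth_at_chartI[OF c], rule smooth_at_compose[OF msmooth_atD[OF assms(1) c]])
      (simp add: c assms(2))
qed

lemma msmooth_at_chart:
  assumes "(U, c) \<in> A" "p \<in> U"
  shows "msmooth_at A c p"
  by (rule msmooth_at_chartI[OF assms transition_smooth[OF assms(1,1,2,2)]])

lemma Cinf_const: "(\<lambda>p. r) \<in> Cinf A"
  and Cinf_add: "f \<in> Cinf A \<Longrightarrow> g \<in> Cinf A \<Longrightarrow> (\<lambda>p. f p + g p) \<in> Cinf A"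
  and Cinf_diff: "f \<in> Cinf A \<Longrightarrow> g \<in> Cinf A \<Longrightarrow> (\<lambda>p. f p - g p) \<in> Cinf A"
  and Cinf_mult: "f \<in> Cinf A \<Longrightarrow> g \<in> Cinf A \<Longrightarrow> (\<lambda>p. f p * g p) \<in> Cinf A"
  and Cinf_sum: "(\<And>i. i \<in> I \<Longrightarrow> k i \<in> Cinf A) \<Longrightarrow> (\<lambda>p. \<Sum>i\<in>I. k i p) \<in> Cinf A"
  by (auto simp: Cinf_iff msmooth_at_const msmooth_at_add msmooth_at_diff msmooth_at_mult msmooth_at_sum)

lemma mfamily_at_compose:
  fixes g :: "'m \<Rightarrow> 'f::finite_dim_inner"
  assumes "mfamily_at A h p (g p)" "msmooth_at A g p"
  shows "msmooth_at A (\<lambda>q. h q (g q)) p"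
proof -
  obtain U c where c: "(U, c) \<in> A" "p \<in> U" by (rule ex_chart)
  have "smooth_at (\<lambda>x. (x, g (inv_into U c x))) (c p)"
    by (intro smooth_at_Pair smooth_at_ident msmooth_atD[OF assms(2) c])
  moreover have "smooth_at (\<lambda>(x, v). h (inv_into U c x) v) (c p, g (inv_into U c (c p)))"
    using assms(1) c unfolding mfamily_at_def by auto
  ultimately have "smooth_at (\<lambda>x. h (inv_into U c x) (g (inv_into U c x))) (c p)"
    using smooth_at_compose[of "\<lambda>x. (x, g (inv_into U c x))" "c p" "\<lambda>(x, v). h (inv_into U c x) v"]
    by simp
  then show ?thesis by (rule msmooth_at_chartI[OF c])
qed

text \<open>Bundle morphisms are linear on fibres, so their smoothness only concerns the coefficients on a basis.\<close>

lemma mfamily_at_linearI: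
  fixes k :: "'f::finite_dim_inner \<Rightarrow> 'm \<Rightarrow> 'g::real_normed_vector"
  assumes "\<forall>\<^sub>F q in nhds p. \<forall>v. h q v = (\<Sum>b\<in>onb. (v \<bullet> b) *\<^sub>R k b q)"
    and "\<And>b. b \<in> onb \<Longrightarrow> msmooth_at A (k b) p"
  shows "mfamily_at A h p v"
  unfolding mfamily_at_def
proof safe
  fix U c assume c: "(U, c) \<in> A" "p \<in> U"
  have "smooth_at (\<lambda>y. \<Sum>b\<in>onb. (snd y \<bullet> b) *\<^sub>R k b (inv_into U c (fst y))) (c p, v)"
  proof (intro smooth_at_sum smooth_at_scaleR)
    fix b :: 'f assume "b \<in> onb"
    show "smooth_at (\<lambda>y. snd y \<bullet> b) (c p, v)"
      by (rule smooth_at_linear_map)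
        (rule bounded_linear_compose[OF bounded_linear_inner_left bounded_linear_snd])
    show "smooth_at (\<lambda>y. k b (inv_into U c (fst y))) (c p, v)"
      by (rule smooth_at_compose[OF smooth_at_linear_map[OF bounded_linear_fst]])
        (simp add: msmooth_atD[OF assms(2)[OF \<open>b \<in> onb\<close>] c])
  qed
  moreover have "\<forall>\<^sub>F y in nhds (c p, v).
      (\<Sum>b\<in>onb. (snd y \<bullet> b) *\<^sub>R k b (inv_into U c (fst y))) = (\<lambda>(x, v). h (inv_into U c x) v) y"
  proof -
    have "\<forall>\<^sub>F x in nhds (c p). \<forall>v. h (inv_into U c x) v = (\<Sum>b\<in>onb. (v \<bullet> b) *\<^sub>R k b (inv_into U c x))"
      using eventually_chart_inv[OF c assms(1)] by eventually_elim simp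
    then have "\<forall>\<^sub>F y in nhds (c p) \<times>\<^sub>F nhds v. \<forall>v. h (inv_into U c (fst y)) v
        = (\<Sum>b\<in>onb. (v \<bullet> b) *\<^sub>R k b (inv_into U c (fst y)))"
      by (rule eventually_compose_filterlim[OF _ filterlim_fst])
    then show ?thesis unfolding nhds_prod by eventually_elim (simp add: split_beta)
  qed
  ultimately show "smooth_at (\<lambda>(x, v). h (inv_into U c x) v) (c p, v)" by (rule smooth_at_cong)
qed

text \<open>The bump function of a chart is extended by zero. It vanishes outside a compact set \<open>K\<close>, which is
  closed in the whole manifold by the Hausdorff property; so the extension is smooth at points outside
  the chart domain as well.\<close>

lemma ex_manifold_bump:
  assumes "open W" "p \<in> W"
  obtains \<beta> K where "\<beta> \<in> Cinf A" "\<forall>\<^sub>F q in nhds p. \<beta> q = 1" "closed K" "K \<subseteq> W" "\<And>q. q \<notin> K \<Longrightarrow> \<beta> q = 0"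
proof -
  obtain U c where c: "(U, c) \<in> A" "p \<in> U" by (rule ex_chart)
  have "open (c ` (U \<inter> W))" by (rule open_chart_image[OF c(1) assms(1)])
  then obtain r where r: "r > 0" "cball (c p) r \<subseteq> c ` (U \<inter> W)"
    using c assms open_contains_cball by blast
  obtain \<beta>0 where \<beta>0: "\<And>x. smooth_at \<beta>0 x" "\<And>x. dist (c p) x \<le> r / 2 \<Longrightarrow> \<beta>0 x = 1"
    "\<And>x. dist (c p) x \<ge> 2 * (r / 2) \<Longrightarrow> \<beta>0 x = (0::real)"
    using ex_bump[of "r / 2" "c p"] r(1) by auto
  define \<beta> where "\<beta> q = (if q \<in> U then \<beta>0 (c q) else 0)" for q
  define K where "K = inv_into U c ` cball (c p) r"
  have "continuous_on (cball (c p) r) (inv_into U c)"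
    using chart(3)[OF c(1)] r(2) by (auto simp: homeomorphism_def intro: continuous_on_subset)
  then have "closed K"
    unfolding K_def by (intro compact_imp_closed compact_continuous_image compact_cball)
  have KW: "K \<subseteq> U \<inter> W" using r(2) chart_inv(1)[OF c(1)] unfolding K_def by fastforce
  have out: "\<beta> q = 0" if "q \<notin> K" for q
  proof (cases "q \<in> U")
    case True
    then have "c q \<notin> cball (c p) r" using that chart_inv(1)[OF c(1) True] unfolding K_def by force
    then show ?thesis using \<beta>0(3) by (simp add: \<beta>_def)
  qed (simp add: \<beta>_def)
  have "msmooth_at A \<beta> q" for q
  proof (cases "q \<in> U")
    case True
    have "msmooth_at A (\<lambda>q. \<beta>0 (c q)) q" by (rule msmooth_at_compose[OF msmooth_at_chart[OF c(1) True] \<beta>0(1)])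
    then show ?thesis
      by (rule msmooth_at_cong) (use eventually_nhds_in_open[OF chart(1)[OF c(1)] True] in
          \<open>eventually_elim, simp add: \<beta>_def\<close>)
  next
    case False
    then have "q \<in> - K" using KW by auto
    then have "\<forall>\<^sub>F q in nhds q. q \<in> - K" using \<open>closed K\<close> by (intro eventually_nhds_in_open) auto
    then have "\<forall>\<^sub>F q in nhds q. 0 = \<beta> q" by eventually_elim (simp add: out)
    then show ?thesis by (rule msmooth_at_cong[OF msmooth_at_const])
  qed
  then have "\<beta> \<in> Cinf A" by (simp add: Cinf_iff)
  moreover have "\<forall>\<^sub>F x in nhds (c p). x \<in> cball (c p) (r / 2)"
    using r(1) unfolding eventually_nhds by (intro exI[of _ "ball (c p) (r / 2)"]) auto
  from eventually_chart[OF c this] have "\<forall>\<^sub>F q in nhds p. \<beta> q = 1"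
    by eventually_elim (simp add: \<beta>_def \<beta>0(2))
  ultimately show ?thesis using that \<open>closed K\<close> KW out by blast
qed

lemma Cinf_extend_by_zero:
  fixes f :: "'m \<Rightarrow> real"
  assumes "open W" "\<And>q. q \<in> W \<Longrightarrow> msmooth_at A f q"
    and \<beta>: "\<beta> \<in> Cinf A" "closed K" "K \<subseteq> W" "\<And>q. q \<notin> K \<Longrightarrow> \<beta> q = 0"
  shows "(\<lambda>q. if q \<in> W then \<beta> q * f q else 0) \<in> Cinf A" (is "?g \<in> _")
  unfolding Cinf_iff
proof
  fix q
  show "msmooth_at A ?g q"
  proof (cases "q \<in> W")
    case True
    have "msmooth_at A (\<lambda>q. \<beta> q * f q) q"
      using \<beta>(1) assms(2)[OF True] by (intro msmooth_at_mult) (auto simp: Cinf_iff)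
    then show ?thesis
      by (rule msmooth_at_cong) (use eventually_nhds_in_open[OF assms(1) True] in
          \<open>eventually_elim, simp\<close>)
  next
    case False
    then have "q \<in> - K" using \<beta>(3) by auto
    then have "\<forall>\<^sub>F q in nhds q. q \<in> - K" using \<beta>(2) by (intro eventually_nhds_in_open) auto
    then have "\<forall>\<^sub>F q in nhds q. 0 = ?g q" by eventually_elim (simp add: \<beta>(4))
    then show ?thesis by (rule msmooth_at_cong[OF msmooth_at_const])
  qed
qed

lemma smooth_extension:
  fixes f :: "'m \<Rightarrow> real"
  assumes "open W" "p \<in> W" "\<And>q. q \<in> W \<Longrightarrow> msmooth_at A f q"
  obtains g where "g \<in> Cinf A" "\<forall>\<^sub>F q in nhds p. g q = f q"
proof -
  obtain \<beta> K where \<beta>: "\<beta> \<in> Cinf A" "\<forall>\<^sub>F q in nhds p. \<beta> q = 1" "closed K" "K \<subseteq> W" "\<And>q. q \<notin> K \<Longrightarrow> \<beta> q = 0"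
    using ex_manifold_bump[OF assms(1,2)] by blast
  have "(\<lambda>q. if q \<in> W then \<beta> q * f q else 0) \<in> Cinf A"
    using assms(1,3) \<beta> by (intro Cinf_extend_by_zero) auto
  moreover have "\<forall>\<^sub>F q in nhds p. (if q \<in> W then \<beta> q * f q else 0) = f q"
    using \<beta>(2) eventually_nhds_in_open[OF assms(1,2)] by eventually_elim simp
  ultimately show ?thesis by (rule that)
qed

section \<open>Tangent vectors in coordinates\<close>

lemma tangentD:
  assumes "v \<in> tangent_space A p"
  shows "f \<in> Cinf A \<Longrightarrow> g \<in> Cinf A \<Longrightarrow> v (\<lambda>q. f q + g q) = v f + v g"
    and "f \<in> Cinf A \<Longrightarrow> v (\<lambda>q. r * f q) = r * v f"
    and "f \<in> Cinf A \<Longrightarrow> g \<in> Cinf A \<Longrightarrow> v (\<lambda>q. f q * g q) = f p * v g + g p * v f"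
    and "f \<notin> Cinf A \<Longrightarrow> v f = undefined"
  using assms by (auto simp: tangent_space_def extensional_def)

lemma tangent_const:
  assumes "v \<in> tangent_space A p"
  shows "v (\<lambda>q. r) = 0"
  using tangentD(2)[OF assms Cinf_const[of 1], of r] tangentD(3)[OF assms Cinf_const[of 1] Cinf_const[of 1]]
  by simp

lemma tangent_diff:
  assumes "v \<in> tangent_space A p" "f \<in> Cinf A" "g \<in> Cinf A"
  shows "v (\<lambda>q. f q - g q) = v f - v g"
  using tangentD(1)[OF assms(1,2), of "\<lambda>q. (-1) * g q"] tangentD(2)[OF assms(1,3), of "-1"]
    Cinf_mult[OF Cinf_const[of "-1"] assms(3)] by simp

lemma tangent_sum:
  assumes "v \<in> tangent_space A p" "\<And>i. i \<in> I \<Longrightarrow> k i \<in> Cinf A"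
  shows "v (\<lambda>q. \<Sum>i\<in>I. k i q) = (\<Sum>i\<in>I. v (k i))"
  using assms(2)
  by (induction I rule: infinite_finite_induct)
    (simp_all add: tangent_const[OF assms(1)] tangentD(1)[OF assms(1)] Cinf_sum)

text \<open>Multiplying \<open>f - g\<close> by a bump function supported where \<open>f = g\<close> gives the zero function.\<close>

lemma tangent_local:
  assumes v: "v \<in> tangent_space A p" and fg: "f \<in> Cinf A" "g \<in> Cinf A" "\<forall>\<^sub>F q in nhds p. f q = g q"
  shows "v f = v g"
proof -
  obtain W where W: "open W" "p \<in> W" "\<forall>q\<in>W. f q = g q" using fg(3) unfolding eventually_nhds by blast
  obtain \<beta> K where \<beta>: "\<beta> \<in> Cinf A" "\<forall>\<^sub>F q in nhds p. \<beta> q = 1" "closed K" "K \<subseteq> W" "\<And>q. q \<notin> K \<Longrightarrow> \<beta> q = 0"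
    using ex_manifold_bump[OF W(1,2)] by blast
  have "(\<lambda>q. \<beta> q * (f q - g q)) = (\<lambda>q. 0)"
  proof
    show "\<beta> q * (f q - g q) = 0" for q using W(3) \<beta>(4,5) by (cases "q \<in> K") auto
  qed
  then have "0 = v (\<lambda>q. \<beta> q * (f q - g q))" using tangent_const[OF v, of 0] by simp
  also have "\<dots> = \<beta> p * v (\<lambda>q. f q - g q) + (f p - g p) * v \<beta>"
    by (rule tangentD(3)[OF v \<beta>(1) Cinf_diff[OF fg(1,2)]])
  also have "\<dots> = v f - v g"
    using eventually_nhds_x_imp_x[OF \<beta>(2)] eventually_nhds_x_imp_x[OF fg(3)] tangent_diff[OF v fg(1,2)] by simp
  finally show ?thesis by simp
qed

text \<open>Derivations act on global functions only, so the coordinates of a chart have to be replaced by global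
  functions that agree with them near \<open>p\<close>.\<close>

definition is_coords :: "'m set \<Rightarrow> ('m \<Rightarrow> 'a) \<Rightarrow> 'm \<Rightarrow> ('a \<Rightarrow> 'm \<Rightarrow> real) \<Rightarrow> bool" where
  "is_coords U c p x \<longleftrightarrow> (U, c) \<in> A \<and> p \<in> U \<and> (\<forall>b. x b \<in> Cinf A) \<and> (\<forall>\<^sub>F q in nhds p. \<forall>b. x b q = c q \<bullet> b)"

lemma ex_coords:
  assumes "(U, c) \<in> A" "p \<in> U"
  obtains x where "is_coords U c p x"
proof -
  obtain \<beta> K where \<beta>: "\<beta> \<in> Cinf A" "\<forall>\<^sub>F q in nhds p. \<beta> q = 1" "closed K" "K \<subseteq> U" "\<And>q. q \<notin> K \<Longrightarrow> \<beta> q = 0"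
    using ex_manifold_bump[OF chart(1)[OF assms(1)] assms(2)] by blast
  define x where "x b q = (if q \<in> U then \<beta> q * (c q \<bullet> b) else 0)" for b q
  have "x b \<in> Cinf A" for b
    unfolding x_def
    using \<beta> by (intro Cinf_extend_by_zero chart(1)[OF assms(1)] msmooth_at_inner_const
        msmooth_at_chart[OF assms(1)]) auto
  moreover have "\<forall>\<^sub>F q in nhds p. \<forall>b. x b q = c q \<bullet> b"
    using \<beta>(2) eventually_nhds_in_open[OF chart(1)[OF assms(1)] assms(2)]
    by eventually_elim (simp add: x_def)
  ultimately show ?thesis using assms that by (auto simp: is_coords_def)
qed

lemma eventually_is_coords:
  assumes "is_coords U c p x"
  shows "\<forall>\<^sub>F q in nhds p. is_coords U c q x"
proof -
  have c: "(U, c) \<in> A" "p \<in> U" using assms by (auto simp: is_coords_def)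
  have "\<forall>\<^sub>F q in nhds p. \<forall>\<^sub>F q in nhds q. \<forall>b. x b q = c q \<bullet> b"
    using assms by (simp add: is_coords_def eventually_eventually)
  with eventually_nhds_in_open[OF chart(1)[OF c(1)] c(2)] show ?thesis
    by eventually_elim (use assms in \<open>simp add: is_coords_def\<close>)
qed

text \<open>The tangent vector with coordinate vector \<open>a\<close> in the chart \<open>c\<close>.\<close>

definition dirder :: "'m set \<Rightarrow> ('m \<Rightarrow> 'a) \<Rightarrow> 'm \<Rightarrow> 'a \<Rightarrow> ('m \<Rightarrow> real) \<Rightarrow> real" where
  "dirder U c p a = (\<lambda>f\<in>Cinf A. frechet_derivative (f \<circ> inv_into U c) (at (c p)) a)"

lemma Cinf_chart_smooth_at:
  "f \<in> Cinf A \<Longrightarrow> (U, c) \<in> A \<Longrightarrow> p \<in> U \<Longrightarrow> smooth_at (f \<circ> inv_into U c) (c p)"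
  unfolding o_def by (auto simp: Cinf_iff intro: msmooth_atD)

lemma Cinf_chart_derivative:
  assumes "f \<in> Cinf A" "(U, c) \<in> A" "p \<in> U"
  shows "((f \<circ> inv_into U c) has_derivative frechet_derivative (f \<circ> inv_into U c) (at (c p))) (at (c p))"
  by (rule smooth_at_has_derivative[OF Cinf_chart_smooth_at[OF assms]])

lemma dirder_tangent:
  assumes c: "(U, c) \<in> A" "p \<in> U"
  shows "dirder U c p a \<in> tangent_space A p"
proof -
  note D = Cinf_chart_derivative[OF _ c]
  have "frechet_derivative ((\<lambda>q. f q + g q) \<circ> inv_into U c) (at (c p)) a
      = frechet_derivative (f \<circ> inv_into U c) (at (c p)) a + frechet_derivative (g \<circ> inv_into U c) (at (c p)) a"
    if "f \<in> Cinf A" "g \<in> Cinf A" for f g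
    using frechet_derivative_at[OF has_derivative_add[OF D[OF that(1)] D[OF that(2)]]]
    by (simp add: o_def fun_eq_iff)
  moreover have "frechet_derivative ((\<lambda>q. r * f q) \<circ> inv_into U c) (at (c p)) a
      = r * frechet_derivative (f \<circ> inv_into U c) (at (c p)) a" if "f \<in> Cinf A" for f r
    using frechet_derivative_at[OF has_derivative_mult_right[OF D[OF that]], of r]
    by (simp add: o_def fun_eq_iff)
  moreover have "frechet_derivative ((\<lambda>q. f q * g q) \<circ> inv_into U c) (at (c p)) a
      = f p * frechet_derivative (g \<circ> inv_into U c) (at (c p)) a
        + g p * frechet_derivative (f \<circ> inv_into U c) (at (c p)) a" if "f \<in> Cinf A" "g \<in> Cinf A" for f g
    using frechet_derivative_at[OF has_derivative_mult[OF D[OF that(1)] D[OF that(2)]]]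
    by (simp add: o_def fun_eq_iff c mult.commute)
  ultimately show ?thesis
    unfolding tangent_space_def dirder_def
    by (auto simp: Cinf_add Cinf_mult Cinf_const)
qed

lemma dirder_coords:
  assumes "is_coords U c p x"
  shows "dirder U c p a (x b) = a \<bullet> b"
proof -
  have c: "(U, c) \<in> A" "p \<in> U" and x: "x b \<in> Cinf A" using assms by (auto simp: is_coords_def)
  have ev: "\<forall>\<^sub>F q in nhds p. x b q = c q \<bullet> b"
    using assms unfolding is_coords_def by (auto elim: eventually_mono)
  have "\<forall>\<^sub>F y in nhds (c p). y \<bullet> b = (x b \<circ> inv_into U c) y"
    using eventually_chart_inv[OF c ev] by eventually_elim (simp add: c)
  then obtain T where T: "open T" "c p \<in> T" "\<And>y. y \<in> T \<Longrightarrow> y \<bullet> b = (x b \<circ> inv_into U c) y"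
    unfolding eventually_nhds by blast
  have "((x b \<circ> inv_into U c) has_derivative (\<lambda>y. y \<bullet> b)) (at (c p))"
    by (rule has_derivative_transform_within_open[OF _ T])
      (auto intro!: bounded_linear_imp_has_derivative bounded_linear_inner_left)
  from frechet_derivative_at[OF this, symmetric] x show ?thesis by (simp add: dirder_def)
qed

text \<open>Hadamard's lemma writes \<open>f\<close> near \<open>p\<close> as \<open>f p + (\<Sum>\<^sub>b (x\<^sub>b - x\<^sub>b(p)) g\<^sub>b)\<close> with \<open>g\<^sub>b(p) = \<partial>\<^sub>b f\<close>, and the product
  rule leaves only the terms \<open>g\<^sub>b(p) v(x\<^sub>b)\<close>. The functions \<open>g\<^sub>b\<close> are smooth only near \<open>p\<close> and are
  replaced by global ones.\<close>

lemma tangent_eq_dirder: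
  assumes x: "is_coords U c p x" and v: "v \<in> tangent_space A p"
  shows "v = dirder U c p (\<Sum>b\<in>onb. v (x b) *\<^sub>R b)"
proof
  fix f
  have c: "(U, c) \<in> A" "p \<in> U" and xC: "\<And>b. x b \<in> Cinf A"
    and xe: "\<forall>\<^sub>F q in nhds p. \<forall>b. x b q = c q \<bullet> b" using x by (auto simp: is_coords_def)
  show "v f = dirder U c p (\<Sum>b\<in>onb. v (x b) *\<^sub>R b) f"
  proof (cases "f \<in> Cinf A")
    case f: True
    let ?F = "f \<circ> inv_into U c"
    obtain r where r: "r > 0" "ball (c p) r \<subseteq> c ` U"
      using chart(2)[OF c(1)] c(2) open_contains_ball by blast
    have "smooth_on (ball (c p) r) ?F"
      using r(2) Cinf_chart_smooth_at[OF f c(1)] by (subst smooth_on_iff_smooth_at) auto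
    then obtain G where G: "\<And>b. smooth_on (ball (c p) r) (G b)"
      "\<And>b. G b (c p) = frechet_derivative ?F (at (c p)) b"
      "\<And>y. y \<in> ball (c p) r \<Longrightarrow> ?F y = ?F (c p) + (\<Sum>b\<in>onb. ((y - c p) \<bullet> b) * G b y)"
      using Hadamard[OF open_ball convex_ball, of "c p" "c p" r ?F] r(1) by auto
    have "\<forall>\<^sub>F y in nhds (c p). y \<in> ball (c p) r" using r(1) by (intro eventually_nhds_in_open) auto
    from eventually_chart[OF c this]
    obtain W where W: "open W" "p \<in> W" "\<And>q. q \<in> W \<Longrightarrow> q \<in> U \<and> c q \<in> ball (c p) r"
      unfolding eventually_nhds by blast
    have "\<exists>g. g \<in> Cinf A \<and> (\<forall>\<^sub>F q in nhds p. g q = G b (c q))" for b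
    proof (rule smooth_extension[OF W(1,2)])
      show "msmooth_at A (\<lambda>q. G b (c q)) q" if "q \<in> W" for q
        by (rule msmooth_at_compose[OF msmooth_at_chart[OF c(1)]])
          (use W(3)[OF that] G(1)[of b] in \<open>auto simp: smooth_on_iff_smooth_at\<close>)
    qed blast
    then obtain g where g: "\<And>b. g b \<in> Cinf A" "\<And>b. \<forall>\<^sub>F q in nhds p. g b q = G b (c q)" by metis
    have gp: "g b p = G b (c p)" for b using eventually_nhds_x_imp_x[OF g(2)] .
    have xp: "x b p = c p \<bullet> b" for b using eventually_nhds_x_imp_x[OF xe] by blast
    define f' where "f' = (\<lambda>q. f p + (\<Sum>b\<in>onb. (x b q - x b p) * g b q))"
    have sumC: "(\<lambda>q. \<Sum>b\<in>onb. (x b q - x b p) * g b q) \<in> Cinf A"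
      by (intro Cinf_sum Cinf_mult Cinf_diff Cinf_const xC g(1))
    then have "f' \<in> Cinf A" unfolding f'_def by (intro Cinf_add Cinf_const)
    have "\<forall>\<^sub>F q in nhds p. \<forall>b\<in>onb. g b q = G b (c q)" using g(2) by (intro eventually_ball_finite) auto
    then have "\<forall>\<^sub>F q in nhds p. f q = f' q"
      using xe eventually_nhds_in_open[OF W(1,2)]
    proof eventually_elim
      case (elim q)
      have "f q = ?F (c q)" using W(3)[OF elim(3)] c by simp
      also have "\<dots> = f p + (\<Sum>b\<in>onb. ((c q - c p) \<bullet> b) * G b (c q))"
        using G(3)[of "c q"] W(3)[OF elim(3)] c by simp
      also have "\<dots> = f' q" unfolding f'_def
        using elim by (simp add: xp inner_diff_left)
      finally show ?case .
    qed
    then have "v f = v f'" using tangent_local[OF v f \<open>f' \<in> Cinf A\<close>] by blast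
    also have "\<dots> = v (\<lambda>q. \<Sum>b\<in>onb. (x b q - x b p) * g b q)"
      unfolding f'_def using tangentD(1)[OF v Cinf_const sumC] tangent_const[OF v] by simp
    also have "\<dots> = (\<Sum>b\<in>onb. v (\<lambda>q. (x b q - x b p) * g b q))"
      by (intro tangent_sum[OF v] Cinf_mult Cinf_diff Cinf_const xC g(1))
    also have "\<dots> = (\<Sum>b\<in>onb. G b (c p) * v (x b))"
      using tangentD(3)[OF v Cinf_diff[OF xC Cinf_const] g(1)] tangent_diff[OF v xC Cinf_const] tangent_const[OF v]
      by (simp add: gp)
    also have "\<dots> = frechet_derivative ?F (at (c p)) (\<Sum>b\<in>onb. v (x b) *\<^sub>R b)"
      using has_derivative_linear[OF Cinf_chart_derivative[OF f c]]
      by (simp add: linear_sum linear_cmul G(2) mult.commute)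
    finally show ?thesis using f by (simp add: dirder_def)
  qed (simp add: tangentD(4)[OF v] dirder_def)
qed

text \<open>The local trivialisation of the tangent bundle over the chart \<open>(U, c)\<close>.\<close>

definition tcoord :: "'m set \<Rightarrow> ('m \<Rightarrow> 'a) \<Rightarrow> 'm \<Rightarrow> (('m \<Rightarrow> real) \<Rightarrow> real) \<Rightarrow> 'a" where
  "tcoord U c p v = (THE a. \<forall>f\<in>Cinf A. v f = frechet_derivative (f \<circ> inv_into U c) (at (c p)) a)"

lemma dirder_inj:
  assumes "(U, c) \<in> A" "p \<in> U" "dirder U c p a = dirder U c p a'"
  shows "a = a'"
proof -
  obtain x where "is_coords U c p x" using ex_coords[OF assms(1,2)] by blast
  from dirder_coords[OF this, of a] dirder_coords[OF this, of a'] assms(3)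
  have "a \<bullet> b = a' \<bullet> b" for b by simp
  then show ?thesis by (rule onb_eqI)
qed

lemma tcoord_dirder:
  assumes "(U, c) \<in> A" "p \<in> U"
  shows "tcoord U c p (dirder U c p a) = a"
  unfolding tcoord_def
proof (rule the_equality)
  fix a' assume "\<forall>f\<in>Cinf A. dirder U c p a f = frechet_derivative (f \<circ> inv_into U c) (at (c p)) a'"
  then have "dirder U c p a = dirder U c p a'" by (auto simp: dirder_def fun_eq_iff)
  then show "a' = a" using dirder_inj[OF assms] by simp
qed (simp add: dirder_def)

lemma dirder_tcoord:
  assumes "(U, c) \<in> A" "p \<in> U" "v \<in> tangent_space A p"
  shows "dirder U c p (tcoord U c p v) = v"
proof -
  obtain x where "is_coords U c p x" using ex_coords[OF assms(1,2)] by blast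
  from tangent_eq_dirder[OF this assms(3)] show ?thesis
    by (rule ssubst) (simp only: tcoord_dirder[OF assms(1,2)])
qed

lemma tcoord_eq:
  assumes "is_coords U c p x" "v \<in> tangent_space A p"
  shows "tcoord U c p v = (\<Sum>b\<in>onb. v (x b) *\<^sub>R b)"
  by (subst tangent_eq_dirder[OF assms], rule tcoord_dirder)
    (use assms(1) in \<open>auto simp: is_coords_def\<close>)

lemma tangent_coords_expand:
  assumes "is_coords U c p x" "v \<in> tangent_space A p" "f \<in> Cinf A"
  shows "v f = (\<Sum>b\<in>onb. v (x b) * dirder U c p b f)"
proof -
  have c: "(U, c) \<in> A" "p \<in> U" using assms by (auto simp: is_coords_def)
  have "v f = dirder U c p (\<Sum>b\<in>onb. v (x b) *\<^sub>R b) f"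
    using arg_cong[OF tangent_eq_dirder[OF assms(1,2)], of "\<lambda>v. v f"] by simp
  also have "\<dots> = (\<Sum>b\<in>onb. v (x b) * dirder U c p b f)"
    using has_derivative_linear[OF Cinf_chart_derivative[OF assms(3) c]] assms(3)
    by (simp add: dirder_def linear_sum linear_cmul)
  finally show ?thesis .
qed

lemma msmooth_at_tangent_apply:
  assumes "(U, c) \<in> A" "p \<in> U" "\<And>q. V q \<in> tangent_space A q" "msmooth_at A (\<lambda>q. tcoord U c q (V q)) p"
    "f \<in> Cinf A"
  shows "msmooth_at A (\<lambda>q. V q f) p"
proof -
  let ?F = "f \<circ> inv_into U c"
  have "msmooth_at A (\<lambda>q. \<Sum>b\<in>onb. (tcoord U c q (V q) \<bullet> b) * frechet_derivative ?F (at (c q)) b) p"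
  proof (intro msmooth_at_sum msmooth_at_mult msmooth_at_inner_const assms(4))
    show "msmooth_at A (\<lambda>q. frechet_derivative ?F (at (c q)) b) p" for b
      by (rule msmooth_at_compose[OF msmooth_at_chart[OF assms(1,2)]
            smooth_at_frechet_derivative[OF Cinf_chart_smooth_at[OF assms(5,1,2)]]])
  qed
  moreover have "\<forall>\<^sub>F q in nhds p. (\<Sum>b\<in>onb. (tcoord U c q (V q) \<bullet> b) * frechet_derivative ?F (at (c q)) b) = V q f"
    using eventually_nhds_in_open[OF chart(1)[OF assms(1)] assms(2)]
  proof eventually_elim
    case (elim q)
    have "V q f = dirder U c q (tcoord U c q (V q)) f" using dirder_tcoord[OF assms(1) elim assms(3)] by simp
    then show ?case
      using linear_onb_expand[OF has_derivative_linear[OF Cinf_chart_derivative[OF assms(5,1) elim]],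
          of "tcoord U c q (V q)"] assms(5)
      by (simp add: dirder_def)
  qed
  ultimately show ?thesis by (rule msmooth_at_cong)
qed

end

context smooth_mfd
begin

section \<open>Cotangent vectors are differentials\<close>

lemma tangent_bundle_simps [simp]:
  "fibre (tangent_bundle A) = tangent_space A"
  "vzero (tangent_bundle A) = (\<lambda>p. \<lambda>f\<in>Cinf A. 0)"
  "vadd (tangent_bundle A) = (\<lambda>p v w. \<lambda>f\<in>Cinf A. v f + w f)"
  "vscale (tangent_bundle A) = (\<lambda>p r v. \<lambda>f\<in>Cinf A. r * v f)"
  "trivs (tangent_bundle A) = {(U, tcoord U c) | U c. (U, c) \<in> A}"
  by (simp_all add: tangent_bundle_def tcoord_def[abs_def])

lemma dirder_linear:
  assumes "(U, c) \<in> A" "p \<in> U"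
  shows "dirder U c p (a + a') = (\<lambda>f\<in>Cinf A. dirder U c p a f + dirder U c p a' f)"
    and "dirder U c p (r *\<^sub>R a) = (\<lambda>f\<in>Cinf A. r * dirder U c p a f)"
  using has_derivative_linear[OF Cinf_chart_derivative[OF _ assms]]
  by (auto simp: dirder_def fun_eq_iff linear_add linear_cmul)

lemma tangent_space_closed:
  assumes "v \<in> tangent_space A p" "w \<in> tangent_space A p"
  shows "(\<lambda>f\<in>Cinf A. v f + w f) \<in> tangent_space A p" "(\<lambda>f\<in>Cinf A. r * v f) \<in> tangent_space A p"
proof -
  obtain U c where c: "(U, c) \<in> A" "p \<in> U" by (rule ex_chart)
  show "(\<lambda>f\<in>Cinf A. v f + w f) \<in> tangent_space A p" "(\<lambda>f\<in>Cinf A. r * v f) \<in> tangent_space A p"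
    using dirder_tangent[OF c, of "tcoord U c p v + tcoord U c p w"]
      dirder_tangent[OF c, of "r *\<^sub>R tcoord U c p v"]
    by (simp_all add: dirder_linear[OF c] dirder_tcoord[OF c assms(1)] dirder_tcoord[OF c assms(2)])
qed

lemma tcoord_linear:
  assumes c: "(U, c) \<in> A" "p \<in> U" and v: "v \<in> tangent_space A p" and w: "w \<in> tangent_space A p"
  shows "tcoord U c p (\<lambda>f\<in>Cinf A. v f + w f) = tcoord U c p v + tcoord U c p w"
    and "tcoord U c p (\<lambda>f\<in>Cinf A. r * v f) = r *\<^sub>R tcoord U c p v"
  using tcoord_dirder[OF c, of "tcoord U c p v + tcoord U c p w"] tcoord_dirder[OF c, of "r *\<^sub>R tcoord U c p v"]
  by (simp_all add: dirder_linear[OF c] dirder_tcoord[OF c v] dirder_tcoord[OF c w])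

lemma cotangent_linear:
  assumes "\<xi> \<in> dual_fibre (tangent_bundle A) p" "(U, c) \<in> A" "p \<in> U"
  shows "linear (\<lambda>a. \<xi> (dirder U c p a))"
  using assms(1) dirder_tangent[OF assms(2,3)]
  by (intro linearI)
    (simp_all add: dual_fibre_def linear_wrt_def dirder_linear[OF assms(2,3)])

lemma cotangent_expand:
  assumes "\<xi> \<in> dual_fibre (tangent_bundle A) p" "is_coords U c p x" "v \<in> tangent_space A p"
  shows "\<xi> v = (\<Sum>b\<in>onb. v (x b) * \<xi> (dirder U c p b))"
proof -
  have c: "(U, c) \<in> A" "p \<in> U" using assms(2) by (auto simp: is_coords_def)
  have "\<xi> v = \<xi> (dirder U c p (\<Sum>b\<in>onb. v (x b) *\<^sub>R b))"
    using tangent_eq_dirder[OF assms(2,3)] by simp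
  also have "\<dots> = (\<Sum>b\<in>onb. v (x b) * \<xi> (dirder U c p b))"
    by (simp add: linear_sum[OF cotangent_linear[OF assms(1) c]] linear_cmul[OF cotangent_linear[OF assms(1) c]])
  finally show ?thesis .
qed

lemma differential_in_dual: "f \<in> Cinf A \<Longrightarrow> differential A f p \<in> dual_fibre (tangent_bundle A) p"
  by (simp add: dual_fibre_def differential_def linear_wrt_def tangent_space_closed)

lemma dual_fibre_ext:
  assumes "\<xi> \<in> dual_fibre V p" "\<eta> \<in> dual_fibre V p" "\<And>v. v \<in> fibre V p \<Longrightarrow> \<xi> v = \<eta> v"
  shows "\<xi> = \<eta>"
  using assms by (auto simp: dual_fibre_def intro: extensionalityI)

text \<open>The function is the linear combination of coordinate functions whose coefficients are the values of
  \<open>\<xi>\<close> on the coordinate directions. It makes \<open>\<alpha>\<close> defined, and unique, on all covectors although the bracket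
  only sees differentials.\<close>

lemma ex_differential:
  assumes "\<xi> \<in> dual_fibre (tangent_bundle A) p"
  obtains f where "f \<in> Cinf A" "differential A f p = \<xi>"
proof -
  obtain U c where c: "(U, c) \<in> A" "p \<in> U" by (rule ex_chart)
  obtain x where x: "is_coords U c p x" by (rule ex_coords[OF c])
  have xC: "x b \<in> Cinf A" for b using x by (simp add: is_coords_def)
  define f where "f q = (\<Sum>b\<in>onb. \<xi> (dirder U c p b) * x b q)" for q
  have C: "(\<lambda>q. \<xi> (dirder U c p b) * x b q) \<in> Cinf A" for b by (intro Cinf_mult Cinf_const xC)
  have f: "f \<in> Cinf A" unfolding f_def by (rule Cinf_sum[OF C])
  have "v f = \<xi> v" if v: "v \<in> tangent_space A p" for v
  proof -
    have "v f = (\<Sum>b\<in>onb. v (\<lambda>q. \<xi> (dirder U c p b) * x b q))"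
      unfolding f_def by (rule tangent_sum[OF v C])
    then show ?thesis
      unfolding tangentD(2)[OF v xC] cotangent_expand[OF assms x v] by (simp add: mult.commute)
  qed
  then have "differential A f p = \<xi>"
    by (intro dual_fibre_ext[OF differential_in_dual[OF f] assms]) (simp add: differential_def)
  then show ?thesis using that f by blast
qed

lemma differential_dirder:
  assumes "(U, c) \<in> A" "p \<in> U"
  shows "differential A f p (dirder U c p a) = dirder U c p a f"
  using dirder_tangent[OF assms] by (simp add: differential_def)

end

section \<open>Sections of a vector bundle\<close>

locale bundle_mfd = smooth_mfd A
  for A :: "('m::{t2_space, second_countable_topology}, 'a::finite_dim_inner) atlas" +
  fixes E :: "('m, 'e, 'f::finite_dim_inner) vbundle"
  assumes vector_bundle: "vector_bundle A E"
begin

definition triv_at :: "'m \<Rightarrow> ('m \<Rightarrow> 'e \<Rightarrow> 'f) \<Rightarrow> bool" where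
  "triv_at p \<phi> \<longleftrightarrow> (\<exists>U. (U, \<phi>) \<in> trivs E \<and> p \<in> U)"

lemma fibre_closed [simp]:
  "vzero E p \<in> fibre E p"
  "x \<in> fibre E p \<Longrightarrow> y \<in> fibre E p \<Longrightarrow> vadd E p x y \<in> fibre E p"
  "x \<in> fibre E p \<Longrightarrow> vscale E p r x \<in> fibre E p"
  using vector_bundle[unfolded vector_bundle_def, THEN conjunct1, rule_format, of p] by auto

lemma ex_triv: obtains U \<phi> where "(U, \<phi>) \<in> trivs E" "p \<in> U"
proof -
  have "p \<in> (\<Union>(U, \<phi>)\<in>trivs E. U)" using vector_bundle by (simp add: vector_bundle_def)
  then show ?thesis using that by auto
qed

lemma ex_triv_at: obtains \<phi> where "triv_at p \<phi>"
proof -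
  obtain U \<phi> where "(U, \<phi>) \<in> trivs E" "p \<in> U" by (rule ex_triv)
  then show ?thesis using that by (auto simp: triv_at_def)
qed

lemma triv:
  assumes "(U, \<phi>) \<in> trivs E"
  shows "open U" "p \<in> U \<Longrightarrow> bij_betw (\<phi> p) (fibre E p) UNIV" "p \<in> U \<Longrightarrow> \<phi> p (vzero E p) = 0"
    "p \<in> U \<Longrightarrow> linear_wrt (fibre E p) (vadd E p) (vscale E p) (+) (*\<^sub>R) (\<phi> p)"
proof -
  have "open U \<and> (\<forall>p\<in>U. bij_betw (\<phi> p) (fibre E p) UNIV \<and> \<phi> p (vzero E p) = 0 \<and>
               linear_wrt (fibre E p) (vadd E p) (vscale E p) (+) (*\<^sub>R) (\<phi> p))"
    using vector_bundle assms unfolding vector_bundle_def by fast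
  then show "open U" "p \<in> U \<Longrightarrow> bij_betw (\<phi> p) (fibre E p) UNIV" "p \<in> U \<Longrightarrow> \<phi> p (vzero E p) = 0"
    "p \<in> U \<Longrightarrow> linear_wrt (fibre E p) (vadd E p) (vscale E p) (+) (*\<^sub>R) (\<phi> p)" by auto
qed

lemma triv_transition:
  assumes "(U, \<phi>) \<in> trivs E" "(V, \<psi>) \<in> trivs E" "p \<in> U" "p \<in> V"
  shows "mfamily_at A (\<lambda>p v. \<psi> p (inv_into (fibre E p) (\<phi> p) v)) p v"
proof -
  have "smooth_family_on A (U \<inter> V) (\<lambda>p v. \<psi> p (inv_into (fibre E p) (\<phi> p) v))"
    using vector_bundle assms unfolding vector_bundle_def by fast
  then show ?thesis using smooth_family_on_iff[OF open_Int[OF triv(1)[OF assms(1)] triv(1)[OF assms(2)]]] assms by auto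
qed

lemma triv_atD:
  assumes "triv_at p \<phi>"
  shows "\<phi> p (vzero E p) = 0"
    "x \<in> fibre E p \<Longrightarrow> y \<in> fibre E p \<Longrightarrow> \<phi> p (vadd E p x y) = \<phi> p x + \<phi> p y"
    "x \<in> fibre E p \<Longrightarrow> \<phi> p (vscale E p r x) = r *\<^sub>R \<phi> p x"
    "inv_into (fibre E p) (\<phi> p) v \<in> fibre E p"
    "\<phi> p (inv_into (fibre E p) (\<phi> p) v) = v"
    "x \<in> fibre E p \<Longrightarrow> inv_into (fibre E p) (\<phi> p) (\<phi> p x) = x"
proof -
  obtain U where U: "(U, \<phi>) \<in> trivs E" "p \<in> U" using assms triv_at_def by blast
  note t = triv[OF U(1)]
  show "\<phi> p (vzero E p) = 0" using t(3)[OF U(2)] .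
  show "x \<in> fibre E p \<Longrightarrow> y \<in> fibre E p \<Longrightarrow> \<phi> p (vadd E p x y) = \<phi> p x + \<phi> p y"
    "x \<in> fibre E p \<Longrightarrow> \<phi> p (vscale E p r x) = r *\<^sub>R \<phi> p x"
    using t(4)[OF U(2)] by (auto simp: linear_wrt_def)
  show "inv_into (fibre E p) (\<phi> p) v \<in> fibre E p" "\<phi> p (inv_into (fibre E p) (\<phi> p) v) = v"
    "x \<in> fibre E p \<Longrightarrow> inv_into (fibre E p) (\<phi> p) (\<phi> p x) = x"
    using t(2)[OF U(2)] by (auto simp: bij_betw_def inv_into_into f_inv_into_f)
qed

lemma triv_at_eqI:
  assumes "triv_at p \<phi>" "x \<in> fibre E p" "y \<in> fibre E p" "\<phi> p x = \<phi> p y"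
  shows "x = y"
  using arg_cong[OF assms(4), of "inv_into (fibre E p) (\<phi> p)"]
  unfolding triv_atD(6)[OF assms(1,2)] triv_atD(6)[OF assms(1,3)] .

lemma Sec_fibre [simp]: "X \<in> Sec A E \<Longrightarrow> X p \<in> fibre E p"
  by (simp add: Sec_def)

lemma Sec_smooth:
  assumes "X \<in> Sec A E" "(U, \<phi>) \<in> trivs E" "p \<in> U"
  shows "msmooth_at A (\<lambda>q. \<phi> q (X q)) p"
proof -
  have "\<forall>(U, \<phi>)\<in>trivs E. smooth_fun_on A U (\<lambda>q. \<phi> q (X q))" using assms(1) by (simp add: Sec_def del: Sec_fibre)
  from bspec[OF this assms(2)] have "smooth_fun_on A U (\<lambda>q. \<phi> q (X q))" by simp
  then show ?thesis
    using smooth_fun_on_iff[OF triv(1)[OF assms(2)], of "\<lambda>q. \<phi> q (X q)"] assms(3) by simp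
qed

text \<open>One trivialisation around each point is enough, as the transition maps are smooth.\<close>

lemma SecI:
  assumes "\<And>p. X p \<in> fibre E p" "\<And>p. \<exists>U \<phi>. (U, \<phi>) \<in> trivs E \<and> p \<in> U \<and> msmooth_at A (\<lambda>q. \<phi> q (X q)) p"
  shows "X \<in> Sec A E"
proof -
  have "msmooth_at A (\<lambda>q. \<psi> q (X q)) p" if V: "(V, \<psi>) \<in> trivs E" "p \<in> V" for V \<psi> p
  proof -
    obtain U \<phi> where U: "(U, \<phi>) \<in> trivs E" "p \<in> U" "msmooth_at A (\<lambda>q. \<phi> q (X q)) p"
      using assms(2) by blast
    have "msmooth_at A (\<lambda>q. \<psi> q (inv_into (fibre E q) (\<phi> q) (\<phi> q (X q)))) p"
      by (rule mfamily_at_compose[OF triv_transition[OF U(1) V(1) U(2) V(2)] U(3)])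
    moreover have "\<forall>\<^sub>F q in nhds p. \<psi> q (inv_into (fibre E q) (\<phi> q) (\<phi> q (X q))) = \<psi> q (X q)"
      using eventually_nhds_in_open[OF triv(1)[OF U(1)] U(2)]
    proof eventually_elim
      case (elim q)
      then have "triv_at q \<phi>" using U(1) triv_at_def by blast
      then show ?case using assms(1) by (simp add: triv_atD(6))
    qed
    ultimately show ?thesis by (rule msmooth_at_cong)
  qed
  then have "\<forall>(V, \<psi>)\<in>trivs E. smooth_fun_on A V (\<lambda>q. \<psi> q (X q))"
  proof clarify
    fix V \<psi> assume V: "(V, \<psi>) \<in> trivs E"
    assume "\<And>V \<psi> p. (V, \<psi>) \<in> trivs E \<Longrightarrow> p \<in> V \<Longrightarrow> msmooth_at A (\<lambda>q. \<psi> q (X q)) p"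
    from this[OF V] show "smooth_fun_on A V (\<lambda>q. \<psi> q (X q))"
      using smooth_fun_on_iff[OF triv(1)[OF V], of "\<lambda>q. \<psi> q (X q)"] by simp
  qed
  then show ?thesis using assms(1) by (simp add: Sec_def del: Sec_fibre)
qed

lemma sec_apply:
  "sec_zero E p = vzero E p"
  "sec_add E X Y p = vadd E p (X p) (Y p)"
  "sec_scale E f X p = vscale E p (f p) (X p)"
  "sec_diff E X Y p = vadd E p (X p) (vscale E p (-1) (Y p))"
  by (simp_all add: sec_zero_def sec_add_def sec_scale_def sec_diff_def)

text \<open>The linearity of \<open>\<phi>\<close> is spelled out so that it can be used for rewriting at each of the nearby
  points.\<close>

lemma triv_near:
  assumes "(U, \<phi>) \<in> trivs E" "p \<in> U"
  shows "\<forall>\<^sub>F q in nhds p. triv_at q \<phi> \<and> \<phi> q (vzero E q) = 0 \<and>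
    (\<forall>x\<in>fibre E q. \<forall>y\<in>fibre E q. \<phi> q (vadd E q x y) = \<phi> q x + \<phi> q y) \<and>
    (\<forall>r. \<forall>x\<in>fibre E q. \<phi> q (vscale E q r x) = r *\<^sub>R \<phi> q x)"
  using eventually_nhds_in_open[OF triv(1)[OF assms(1)] assms(2)]
proof eventually_elim
  case (elim q)
  then have tr: "triv_at q \<phi>" using assms(1) triv_at_def by blast
  then show ?case by (simp add: triv_atD[OF tr])
qed

lemma Sec_closed [simp]:
  shows sec_zero_Sec: "sec_zero E \<in> Sec A E"
    and sec_add_Sec: "X \<in> Sec A E \<Longrightarrow> Y \<in> Sec A E \<Longrightarrow> sec_add E X Y \<in> Sec A E"
    and sec_scale_Sec: "f \<in> Cinf A \<Longrightarrow> X \<in> Sec A E \<Longrightarrow> sec_scale E f X \<in> Sec A E"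
proof -
  show "sec_zero E \<in> Sec A E"
  proof (rule SecI)
    fix p
    obtain U \<phi> where U: "(U, \<phi>) \<in> trivs E" "p \<in> U" by (rule ex_triv)
    have "msmooth_at A (\<lambda>q. \<phi> q (sec_zero E q)) p"
      by (rule msmooth_at_cong[OF msmooth_at_const[of 0]])
        (use triv_near[OF U] in \<open>eventually_elim, simp add: sec_apply\<close>)
    then show "\<exists>U \<phi>. (U, \<phi>) \<in> trivs E \<and> p \<in> U \<and> msmooth_at A (\<lambda>q. \<phi> q (sec_zero E q)) p" using U by blast
  qed (simp add: sec_apply)
next
  assume X: "X \<in> Sec A E"
  show "sec_add E X Y \<in> Sec A E" if Y: "Y \<in> Sec A E"
  proof (rule SecI)
    fix p
    obtain U \<phi> where U: "(U, \<phi>) \<in> trivs E" "p \<in> U" by (rule ex_triv)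
    have "msmooth_at A (\<lambda>q. \<phi> q (sec_add E X Y q)) p"
      by (rule msmooth_at_cong[OF msmooth_at_add[OF Sec_smooth[OF X U] Sec_smooth[OF Y U]]])
        (use triv_near[OF U] in \<open>eventually_elim, simp add: sec_apply X Y\<close>)
    then show "\<exists>U \<phi>. (U, \<phi>) \<in> trivs E \<and> p \<in> U \<and> msmooth_at A (\<lambda>q. \<phi> q (sec_add E X Y q)) p" using U by blast
  qed (use X Y in \<open>simp add: sec_apply\<close>)
  show "sec_scale E f X \<in> Sec A E" if f: "f \<in> Cinf A"
  proof (rule SecI)
    fix p
    have fp: "msmooth_at A f p" using f by (simp add: Cinf_iff)
    obtain U \<phi> where U: "(U, \<phi>) \<in> trivs E" "p \<in> U" by (rule ex_triv)
    have "msmooth_at A (\<lambda>q. \<phi> q (sec_scale E f X q)) p"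
      by (rule msmooth_at_cong[OF msmooth_at_scaleR[OF fp Sec_smooth[OF X U]]])
        (use triv_near[OF U] in \<open>eventually_elim, simp add: sec_apply X\<close>)
    then show "\<exists>U \<phi>. (U, \<phi>) \<in> trivs E \<and> p \<in> U \<and> msmooth_at A (\<lambda>q. \<phi> q (sec_scale E f X q)) p" using U by blast
  qed (use X in \<open>simp add: sec_apply\<close>)
qed

lemma sec_diff_Sec [simp]: "X \<in> Sec A E \<Longrightarrow> Y \<in> Sec A E \<Longrightarrow> sec_diff E X Y \<in> Sec A E"
  by (simp add: sec_diff_def Cinf_const)

lemma sec_eqI:
  assumes "\<And>p. X p \<in> fibre E p" "\<And>p. Y p \<in> fibre E p" "\<And>p \<phi>. triv_at p \<phi> \<Longrightarrow> \<phi> p (X p) = \<phi> p (Y p)"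
  shows "X = Y"
proof
  fix p
  obtain \<phi> where "triv_at p \<phi>" by (rule ex_triv_at)
  then show "X p = Y p" using triv_at_eqI assms by blast
qed

text \<open>Global sections that are constant in the trivialisation \<open>\<phi>\<close> near \<open>p\<close>, one for each vector \<open>b\<close> of the
  model fibre.\<close>

definition is_frame :: "'m set \<Rightarrow> ('m \<Rightarrow> 'e \<Rightarrow> 'f) \<Rightarrow> 'm \<Rightarrow> ('f \<Rightarrow> 'm \<Rightarrow> 'e) \<Rightarrow> bool" where
  "is_frame U \<phi> p s \<longleftrightarrow> (U, \<phi>) \<in> trivs E \<and> p \<in> U \<and> (\<forall>b. s b \<in> Sec A E) \<and>
     (\<forall>\<^sub>F q in nhds p. \<forall>b. \<phi> q (s b q) = b)"

lemma ex_frame: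
  assumes "(U, \<phi>) \<in> trivs E" "p \<in> U"
  obtains s where "is_frame U \<phi> p s"
proof -
  obtain \<beta> K where \<beta>: "\<beta> \<in> Cinf A" "\<forall>\<^sub>F q in nhds p. \<beta> q = 1" "closed K" "K \<subseteq> U" "\<And>q. q \<notin> K \<Longrightarrow> \<beta> q = 0"
    using ex_manifold_bump[OF triv(1)[OF assms(1)] assms(2)] by blast
  define s where "s b q = (if q \<in> U then inv_into (fibre E q) (\<phi> q) (\<beta> q *\<^sub>R b) else vzero E q)" for b q
  have tr: "triv_at q \<phi>" if "q \<in> U" for q using that assms(1) triv_at_def by blast
  have s0: "s b q = vzero E q" if "q \<notin> K" for b q
  proof (cases "q \<in> U")
    case True
    have "s b q = inv_into (fibre E q) (\<phi> q) (\<phi> q (vzero E q))"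
      using True \<beta>(5)[OF that] by (simp add: s_def triv_atD(1)[OF tr[OF True]])
    then show ?thesis by (simp only: triv_atD(6)[OF tr[OF True] fibre_closed(1)])
  qed (simp add: s_def)
  have "s b \<in> Sec A E" for b
  proof (rule SecI)
    fix q
    show "s b q \<in> fibre E q" by (simp add: s_def triv_atD(4)[OF tr])
    show "\<exists>V \<psi>. (V, \<psi>) \<in> trivs E \<and> q \<in> V \<and> msmooth_at A (\<lambda>q'. \<psi> q' (s b q')) q"
    proof (cases "q \<in> U")
      case True
      have "msmooth_at A (\<lambda>q. \<beta> q *\<^sub>R b) q"
        using \<beta>(1) by (intro msmooth_at_scaleR msmooth_at_const) (auto simp: Cinf_iff)
      then have "msmooth_at A (\<lambda>q. \<phi> q (s b q)) q"
        by (rule msmooth_at_cong) (use eventually_nhds_in_open[OF triv(1)[OF assms(1)] True] in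
            \<open>eventually_elim, simp add: s_def triv_atD(5)[OF tr]\<close>)
      then show ?thesis using assms(1) True by blast
    next
      case False
      then have "q \<in> - K" using \<beta>(4) by auto
      then have ev: "\<forall>\<^sub>F q in nhds q. q \<in> - K" using \<beta>(3) by (intro eventually_nhds_in_open) auto
      obtain V \<psi> where V: "(V, \<psi>) \<in> trivs E" "q \<in> V" by (rule ex_triv)
      have "\<forall>\<^sub>F q' in nhds q. 0 = \<psi> q' (s b q')"
        using ev triv_near[OF V] by eventually_elim (simp add: s0)
      from msmooth_at_cong[OF msmooth_at_const this] show ?thesis using V by blast
    qed
  qed
  moreover have "\<forall>\<^sub>F q in nhds p. \<forall>b. \<phi> q (s b q) = b"
    using \<beta>(2) eventually_nhds_in_open[OF triv(1)[OF assms(1)] assms(2)]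
    by eventually_elim (simp add: s_def triv_atD(5)[OF tr])
  ultimately show ?thesis using that assms by (auto simp: is_frame_def)
qed

lemma eventually_is_frame:
  assumes "is_frame U \<phi> p s"
  shows "\<forall>\<^sub>F q in nhds p. is_frame U \<phi> q s"
proof -
  have U: "(U, \<phi>) \<in> trivs E" "p \<in> U" using assms by (auto simp: is_frame_def)
  have "\<forall>\<^sub>F q in nhds p. \<forall>\<^sub>F q in nhds q. \<forall>b. \<phi> q (s b q) = b"
    using assms by (simp add: is_frame_def eventually_eventually)
  with eventually_nhds_in_open[OF triv(1)[OF U(1)] U(2)] show ?thesis
    by eventually_elim (use assms in \<open>simp add: is_frame_def\<close>)
qed

lemma ex_section_through:
  assumes "e \<in> fibre E p"
  obtains X where "X \<in> Sec A E" "X p = e"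
proof -
  obtain U \<phi> where U: "(U, \<phi>) \<in> trivs E" "p \<in> U" by (rule ex_triv)
  have tr: "triv_at p \<phi>" using U triv_at_def by blast
  obtain s where s: "is_frame U \<phi> p s" by (rule ex_frame[OF U])
  then have "\<phi> p (s b p) = b" "s b \<in> Sec A E" for b
    using eventually_nhds_x_imp_x by (fastforce simp: is_frame_def)+
  then show ?thesis using that[of "s (\<phi> p e)"] triv_at_eqI[OF tr _ assms] by simp
qed

definition sec_at :: "'m \<Rightarrow> 'e \<Rightarrow> 'm \<Rightarrow> 'e" where
  "sec_at p e = (SOME X. X \<in> Sec A E \<and> X p = e)"

lemma sec_at [simp]:
  assumes "e \<in> fibre E p"
  shows "sec_at p e \<in> Sec A E" "sec_at p e p = e"
proof -
  have "\<exists>X. X \<in> Sec A E \<and> X p = e" using ex_section_through[OF assms] by blast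
  from someI_ex[OF this] show "sec_at p e \<in> Sec A E" "sec_at p e p = e" by (auto simp: sec_at_def)
qed

text \<open>Linearity over the smooth functions after evaluation at \<open>p\<close>.\<close>

definition tensorial_at :: "'m \<Rightarrow> (('m \<Rightarrow> 'e) \<Rightarrow> 'w::real_vector) \<Rightarrow> bool" where
  "tensorial_at p T \<longleftrightarrow>
     (\<forall>X\<in>Sec A E. \<forall>Y\<in>Sec A E. T (sec_add E X Y) = T X + T Y) \<and>
     (\<forall>f\<in>Cinf A. \<forall>X\<in>Sec A E. T (sec_scale E f X) = f p *\<^sub>R T X)"

text \<open>If \<open>\<beta>\<close> is a bump function supported where the frame is constant, then \<open>\<beta> X\<close> is globally the
  combination of the sections \<open>s b\<close> with the smooth coefficients \<open>\<beta> X\<^sub>b\<close>; and \<open>T (\<beta> X) = T X\<close> since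
  \<open>\<beta> p = 1\<close>.\<close>

lemma tensorial_frame_expand:
  assumes T: "tensorial_at p T" and s: "is_frame U \<phi> p s" and X: "X \<in> Sec A E"
  shows "T X = (\<Sum>b\<in>onb. (\<phi> p (X p) \<bullet> b) *\<^sub>R T (s b))"
proof -
  have U: "(U, \<phi>) \<in> trivs E" "p \<in> U" and sS: "\<And>b. s b \<in> Sec A E"
    using s by (auto simp: is_frame_def)
  have "\<forall>\<^sub>F q in nhds p. q \<in> U \<and> (\<forall>b. \<phi> q (s b q) = b)"
    using s eventually_nhds_in_open[OF triv(1)[OF U(1)] U(2)] by (simp add: is_frame_def eventually_conj)
  then obtain W where W: "open W" "p \<in> W" "\<And>q b. q \<in> W \<Longrightarrow> q \<in> U \<and> \<phi> q (s b q) = b"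
    unfolding eventually_nhds by blast
  have tr: "triv_at q \<phi>" if "q \<in> W" for q using W(3)[OF that] U(1) triv_at_def by blast
  obtain \<beta> K where \<beta>: "\<beta> \<in> Cinf A" "\<forall>\<^sub>F q in nhds p. \<beta> q = 1" "closed K" "K \<subseteq> W" "\<And>q. q \<notin> K \<Longrightarrow> \<beta> q = 0"
    using ex_manifold_bump[OF W(1,2)] by blast
  define g where "g b q = (if q \<in> W then \<beta> q * (\<phi> q (X q) \<bullet> b) else 0)" for b q
  have g: "g b \<in> Cinf A" for b
    unfolding g_def
    using \<beta> W(3) by (intro Cinf_extend_by_zero W(1) msmooth_at_inner_const Sec_smooth[OF X U(1)]) auto
  have \<beta>p: "\<beta> p = 1" using eventually_nhds_x_imp_x[OF \<beta>(2)] .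
  have T0: "T (sec_zero E) = 0"
  proof -
    have "sec_zero E = sec_scale E (\<lambda>q. 0) X"
    proof (rule sec_eqI)
      fix q \<psi> assume \<psi>: "triv_at q \<psi>"
      show "\<psi> q (sec_zero E q) = \<psi> q (sec_scale E (\<lambda>q. 0) X q)"
        using X by (simp add: sec_apply triv_atD[OF \<psi>])
    qed (simp_all add: sec_apply X)
    then show ?thesis using T X Cinf_const[of 0] by (simp add: tensorial_at_def)
  qed
  have "\<exists>Y. Y \<in> Sec A E \<and> (\<forall>q \<psi>. triv_at q \<psi> \<longrightarrow> \<psi> q (Y q) = (\<Sum>b\<in>I. g b q *\<^sub>R \<psi> q (s b q))) \<and>
      T Y = (\<Sum>b\<in>I. g b p *\<^sub>R T (s b))" if "finite I" for I
    using that
  proof (induction I rule: finite_induct)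
    case empty
    have "\<psi> q (sec_zero E q) = 0" if "triv_at q \<psi>" for q \<psi>
      by (simp add: sec_zero_def triv_atD(1)[OF that])
    then show ?case by (intro exI[of _ "sec_zero E"]) (simp add: T0)
  next
    case (insert b I)
    then obtain Y where Y: "Y \<in> Sec A E" "\<And>q \<psi>. triv_at q \<psi> \<Longrightarrow> \<psi> q (Y q) = (\<Sum>b\<in>I. g b q *\<^sub>R \<psi> q (s b q))"
      "T Y = (\<Sum>b\<in>I. g b p *\<^sub>R T (s b))" by blast
    let ?Y = "sec_add E (sec_scale E (g b) (s b)) Y"
    have "\<psi> q (?Y q) = (\<Sum>b\<in>insert b I. g b q *\<^sub>R \<psi> q (s b q))" if \<psi>: "triv_at q \<psi>" for q \<psi>
      using insert.hyps Y(1) sS by (simp add: sec_apply triv_atD[OF \<psi>] Y(2)[OF \<psi>])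
    moreover have "T ?Y = (\<Sum>b\<in>insert b I. g b p *\<^sub>R T (s b))"
      using insert.hyps Y(1,3) sS g T by (simp add: tensorial_at_def)
    ultimately show ?case using Y(1) sS g by (intro exI[of _ ?Y]) simp
  qed
  from this[OF finite_onb] obtain Y where Y: "Y \<in> Sec A E"
    "\<And>q \<psi>. triv_at q \<psi> \<Longrightarrow> \<psi> q (Y q) = (\<Sum>b\<in>onb. g b q *\<^sub>R \<psi> q (s b q))"
    "T Y = (\<Sum>b\<in>onb. g b p *\<^sub>R T (s b))" by blast
  have "sec_scale E \<beta> X = Y"
  proof
    fix q
    show "sec_scale E \<beta> X q = Y q"
    proof (cases "q \<in> W")
      case True
      have "\<phi> q (Y q) = \<beta> q *\<^sub>R (\<Sum>b\<in>onb. (\<phi> q (X q) \<bullet> b) *\<^sub>R b)"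
        using Y(2)[OF tr[OF True]] W(3)[OF True] True by (simp add: g_def scaleR_sum_right)
      then show ?thesis
        using X Y(1) by (intro triv_at_eqI[OF tr[OF True]])
          (simp_all add: sec_apply onb_expand triv_atD[OF tr[OF True]])
    next
      case False
      obtain \<psi> where \<psi>: "triv_at q \<psi>" by (rule ex_triv_at)
      have "\<beta> q = 0" using False \<beta>(4,5) by blast
      then show ?thesis
        using X Y(1) Y(2)[OF \<psi>] False
        by (intro triv_at_eqI[OF \<psi>]) (simp_all add: sec_apply g_def triv_atD[OF \<psi>])
    qed
  qed
  then have "T X = T Y" using T X \<beta>(1) \<beta>p by (auto simp: tensorial_at_def)
  then show ?thesis using Y(3) W(2) \<beta>p by (simp add: g_def)
qed

lemma tensorial_local:
  assumes "tensorial_at p T" "X \<in> Sec A E" "Y \<in> Sec A E" "X p = Y p"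
  shows "T X = T Y"
proof -
  obtain U \<phi> where U: "(U, \<phi>) \<in> trivs E" "p \<in> U" by (rule ex_triv)
  obtain s where s: "is_frame U \<phi> p s" by (rule ex_frame[OF U])
  show ?thesis
    using tensorial_frame_expand[OF assms(1) s assms(2)] tensorial_frame_expand[OF assms(1) s assms(3)] assms(4)
    by simp
qed

text \<open>The section chosen through a vector does not depend on the vector linearly, but the value of a tensorial
  operator on it does.\<close>

lemma tensorial_sec_at:
  assumes T: "tensorial_at p T" and e: "e \<in> fibre E p" "e' \<in> fibre E p"
  shows "T (sec_at p (vadd E p e e')) = T (sec_at p e) + T (sec_at p e')"
    "T (sec_at p (vscale E p r e)) = r *\<^sub>R T (sec_at p e)"
proof -
  have "T (sec_at p (vadd E p e e')) = T (sec_add E (sec_at p e) (sec_at p e'))"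
    by (rule tensorial_local[OF T]) (simp_all add: e sec_apply)
  then show "T (sec_at p (vadd E p e e')) = T (sec_at p e) + T (sec_at p e')"
    using T e by (simp add: tensorial_at_def)
  have "T (sec_at p (vscale E p r e)) = T (sec_scale E (\<lambda>q. r) (sec_at p e))"
    by (rule tensorial_local[OF T]) (simp_all add: e sec_apply Cinf_const)
  then show "T (sec_at p (vscale E p r e)) = r *\<^sub>R T (sec_at p e)"
    using T e by (simp add: tensorial_at_def Cinf_const)
qed

section \<open>The bundle of endomorphisms and its tensor product with the tangent bundle\<close>

lemma End_bundle_simps [simp]:
  "fibre (End_bundle E) p = {\<Phi> \<in> fibre E p \<rightarrow>\<^sub>E fibre E p.
     linear_wrt (fibre E p) (vadd E p) (vscale E p) (vadd E p) (vscale E p) \<Phi>}"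
  "vzero (End_bundle E) p = (\<lambda>x\<in>fibre E p. vzero E p)"
  "vadd (End_bundle E) p = (\<lambda>\<Phi> \<Psi>. \<lambda>x\<in>fibre E p. vadd E p (\<Phi> x) (\<Psi> x))"
  "vscale (End_bundle E) p = (\<lambda>r \<Phi>. \<lambda>x\<in>fibre E p. vscale E p r (\<Phi> x))"
  "trivs (End_bundle E) = {(U, \<lambda>p \<Phi>. Blinfun (\<lambda>v. \<phi> p (\<Phi> (inv_into (fibre E p) (\<phi> p) v)))) | U \<phi>.
        (U, \<phi>) \<in> trivs E}"
  by (simp_all add: End_bundle_def)

lemma End_fibreI:
  assumes "\<And>x. x \<notin> fibre E p \<Longrightarrow> \<Phi> x = undefined" "\<And>x. x \<in> fibre E p \<Longrightarrow> \<Phi> x \<in> fibre E p"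
    "triv_at p \<phi>"
    "\<And>x y. x \<in> fibre E p \<Longrightarrow> y \<in> fibre E p \<Longrightarrow> \<phi> p (\<Phi> (vadd E p x y)) = \<phi> p (\<Phi> x) + \<phi> p (\<Phi> y)"
    "\<And>r x. x \<in> fibre E p \<Longrightarrow> \<phi> p (\<Phi> (vscale E p r x)) = r *\<^sub>R \<phi> p (\<Phi> x)"
  shows "\<Phi> \<in> fibre (End_bundle E) p"
  using assms(1,2,4,5)
  by (auto simp: linear_wrt_def PiE_def extensional_def triv_atD[OF assms(3)] intro!: triv_at_eqI[OF assms(3)])

lemma End_fibreD:
  assumes "\<Phi> \<in> fibre (End_bundle E) p"
  shows "x \<notin> fibre E p \<Longrightarrow> \<Phi> x = undefined" "x \<in> fibre E p \<Longrightarrow> \<Phi> x \<in> fibre E p"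
    "x \<in> fibre E p \<Longrightarrow> y \<in> fibre E p \<Longrightarrow> \<Phi> (vadd E p x y) = vadd E p (\<Phi> x) (\<Phi> y)"
    "x \<in> fibre E p \<Longrightarrow> \<Phi> (vscale E p r x) = vscale E p r (\<Phi> x)"
  using assms by (auto simp: linear_wrt_def PiE_def extensional_def)

lemma End_fibre_closed:
  assumes "\<Phi> \<in> fibre (End_bundle E) p" "\<Psi> \<in> fibre (End_bundle E) p"
  shows "vadd (End_bundle E) p \<Phi> \<Psi> \<in> fibre (End_bundle E) p"
    and "vscale (End_bundle E) p r \<Phi> \<in> fibre (End_bundle E) p"
proof -
  obtain \<phi> where tr: "triv_at p \<phi>" by (rule ex_triv_at)
  note D = End_fibreD[OF assms(1)] End_fibreD[OF assms(2)]
  show "vadd (End_bundle E) p \<Phi> \<Psi> \<in> fibre (End_bundle E) p"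
    by (rule End_fibreI[OF _ _ tr]) (auto simp: D triv_atD[OF tr] scaleR_add_right)
  show "vscale (End_bundle E) p r \<Phi> \<in> fibre (End_bundle E) p"
    by (rule End_fibreI[OF _ _ tr]) (auto simp: D triv_atD[OF tr] scaleR_add_right)
qed

lemma End_zero: "vzero (End_bundle E) p \<in> fibre (End_bundle E) p"
proof -
  obtain \<phi> where tr: "triv_at p \<phi>" by (rule ex_triv_at)
  show ?thesis by (rule End_fibreI[OF _ _ tr]) (auto simp: triv_atD[OF tr])
qed

abbreviation TE where "TE \<equiv> tensor_bundle (tangent_bundle A) (End_bundle E)"

lemma tensor_bundle_simps:
  "fibre TE = tensor_fibre (tangent_bundle A) (End_bundle E)"
  "vadd TE = tensor_add (tangent_bundle A) (End_bundle E)"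
  "vscale TE = tensor_scale (tangent_bundle A) (End_bundle E)"
  by (simp_all add: tensor_bundle_def)

lemma tensor_fibreD:
  assumes "t \<in> tensor_fibre (tangent_bundle A) (End_bundle E) p"
  shows "\<xi> \<notin> dual_fibre (tangent_bundle A) p \<Longrightarrow> t \<xi> = undefined"
    and "\<xi> \<in> dual_fibre (tangent_bundle A) p \<Longrightarrow> t \<xi> \<in> fibre (End_bundle E) p"
  using assms
proof (induction rule: tensor_fibre.induct)
  case zero
  {
    case 1
    then show ?case by (simp add: tensor_zero_def)
  next
    case 2
    then show ?case using End_zero by (simp add: tensor_zero_def del: End_bundle_simps)
  }
next
  case (add v w t)
  {
    case 1
    then show ?case by (simp add: tensor_add_def)
  next
    case 2
    then show ?case using add End_fibre_closed
      by (simp add: tensor_add_def elem_tensor_def del: End_bundle_simps)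
  }
qed

end

section \<open>Loday brackets\<close>

locale loday_mfd = bundle_mfd A E
  for A :: "('m::{t2_space, second_countable_topology}, 'a::finite_dim_inner) atlas"
    and E :: "('m, 'e, 'f::finite_dim_inner) vbundle" +
  fixes B :: "('m \<Rightarrow> 'e) \<Rightarrow> ('m \<Rightarrow> 'e) \<Rightarrow> ('m \<Rightarrow> 'e)"
  assumes nonzero_rank: "\<exists>v::'f. v \<noteq> 0"
    and loday: "loday_bracket A E B"
begin

lemma bracket_Sec [simp]: "X \<in> Sec A E \<Longrightarrow> Y \<in> Sec A E \<Longrightarrow> B X Y \<in> Sec A E"
  and bracket_add_right: "X \<in> Sec A E \<Longrightarrow> Y \<in> Sec A E \<Longrightarrow> Z \<in> Sec A E \<Longrightarrow>
    B X (sec_add E Y Z) = sec_add E (B X Y) (B X Z)"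
  and bracket_add_left: "X \<in> Sec A E \<Longrightarrow> Y \<in> Sec A E \<Longrightarrow> Z \<in> Sec A E \<Longrightarrow>
    B (sec_add E X Z) Y = sec_add E (B X Y) (B Z Y)"
  and bracket_scale_right: "X \<in> Sec A E \<Longrightarrow> Y \<in> Sec A E \<Longrightarrow>
    B X (sec_scale E (\<lambda>p. r) Y) = sec_scale E (\<lambda>p. r) (B X Y)"
  and bracket_scale_left: "X \<in> Sec A E \<Longrightarrow> Y \<in> Sec A E \<Longrightarrow>
    B (sec_scale E (\<lambda>p. r) X) Y = sec_scale E (\<lambda>p. r) (B X Y)"
  using loday unfolding loday_bracket_def real_bilinear_sec_def real_linear_sec_def linear_wrt_def
  by blast+

lemma jacobi: "X \<in> Sec A E \<Longrightarrow> Y \<in> Sec A E \<Longrightarrow> Z \<in> Sec A E \<Longrightarrow>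
    B X (B Y Z) = sec_add E (B (B X Y) Z) (B Y (B X Z))"
  using loday unfolding loday_bracket_def by blast

lemma ex_nonvanishing:
  assumes "triv_at p \<phi>"
  obtains Y where "Y \<in> Sec A E" "\<phi> p (Y p) \<noteq> 0"
proof -
  obtain v :: 'f where v: "v \<noteq> 0" using nonzero_rank by blast
  let ?e = "inv_into (fibre E p) (\<phi> p) v"
  have "sec_at p ?e \<in> Sec A E" "\<phi> p (sec_at p ?e p) = v"
    using triv_atD(4,5)[OF assms, of v] by simp_all
  then show ?thesis using that v by metis
qed

lemma sec_scale_add_fun:
  assumes "Y \<in> Sec A E"
  shows "sec_scale E (\<lambda>p. f p + g p) Y = sec_add E (sec_scale E f Y) (sec_scale E g Y)"
proof (rule sec_eqI)
  fix p \<phi> assume "triv_at p \<phi>"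
  then show "\<phi> p (sec_scale E (\<lambda>p. f p + g p) Y p) = \<phi> p (sec_add E (sec_scale E f Y) (sec_scale E g Y) p)"
    using assms by (simp add: sec_apply triv_atD[of p \<phi>] scaleR_add_left)
qed (simp_all add: sec_apply assms)

lemma sec_scale_add:
  assumes "X \<in> Sec A E" "Y \<in> Sec A E"
  shows "sec_scale E f (sec_add E X Y) = sec_add E (sec_scale E f X) (sec_scale E f Y)"
proof (rule sec_eqI)
  fix p \<phi> assume "triv_at p \<phi>"
  then show "\<phi> p (sec_scale E f (sec_add E X Y) p) = \<phi> p (sec_add E (sec_scale E f X) (sec_scale E f Y) p)"
    using assms by (simp add: sec_apply triv_atD[of p \<phi>] scaleR_add_right)
qed (simp_all add: sec_apply assms)

lemma sec_scale_mult_fun: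
  assumes "Y \<in> Sec A E"
  shows "sec_scale E (\<lambda>p. f p * g p) Y = sec_scale E f (sec_scale E g Y)"
proof (rule sec_eqI)
  fix p \<phi> assume "triv_at p \<phi>"
  then show "\<phi> p (sec_scale E (\<lambda>p. f p * g p) Y p) = \<phi> p (sec_scale E f (sec_scale E g Y) p)"
    using assms by (simp add: sec_apply triv_atD[of p \<phi>])
qed (simp_all add: sec_apply assms)

lemma delta_Sec:
  assumes "f \<in> Cinf A" "X \<in> Sec A E" "Y \<in> Sec A E"
  shows "delta1 E f B X Y \<in> Sec A E" and "delta2 E f B X Y \<in> Sec A E"
  using assms by (simp_all add: delta1_def delta2_def)

lemma delta_apply:
  assumes "triv_at p \<phi>" "f \<in> Cinf A" "X \<in> Sec A E" "Y \<in> Sec A E"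
  shows "\<phi> p (delta1 E f B X Y p) = \<phi> p (B (sec_scale E f X) Y p) - f p *\<^sub>R \<phi> p (B X Y p)"
    and "\<phi> p (delta2 E f B X Y p) = \<phi> p (B X (sec_scale E f Y) p) - f p *\<^sub>R \<phi> p (B X Y p)"
  using assms by (simp_all add: delta1_def delta2_def sec_apply triv_atD[OF assms(1)])

text \<open>One statement covers the four iterated operators of the degree condition.\<close>

lemma delta_delta_apply:
  assumes "triv_at p \<phi>" "f \<in> Cinf A" "g \<in> Cinf A" "X \<in> Sec A E" "Y \<in> Sec A E"
    and D: "D \<in> {delta1 E g B, delta2 E g B}"
  shows "\<phi> p (delta1 E f D X Y p) = \<phi> p (D (sec_scale E f X) Y p) - f p *\<^sub>R \<phi> p (D X Y p)"
    and "\<phi> p (delta2 E f D X Y p) = \<phi> p (D X (sec_scale E f Y) p) - f p *\<^sub>R \<phi> p (D X Y p)"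
    and "delta1 E f D X Y \<in> Sec A E" and "delta2 E f D X Y \<in> Sec A E"
proof -
  have DS: "D X' Y' \<in> Sec A E" if "X' \<in> Sec A E" "Y' \<in> Sec A E" for X' Y'
    using delta_Sec[OF assms(3) that] D by auto
  show "\<phi> p (delta1 E f D X Y p) = \<phi> p (D (sec_scale E f X) Y p) - f p *\<^sub>R \<phi> p (D X Y p)"
    "\<phi> p (delta2 E f D X Y p) = \<phi> p (D X (sec_scale E f Y) p) - f p *\<^sub>R \<phi> p (D X Y p)"
    "delta1 E f D X Y \<in> Sec A E" "delta2 E f D X Y \<in> Sec A E"
    using assms(2-5) DS by (simp_all add: delta1_def delta2_def sec_apply triv_atD[OF assms(1)])
qed

end

section \<open>The symbols of a Loday algebroid and the left anchor\<close>

locale loday_algebroid_mfd = loday_mfd A E B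
  for A :: "('m::{t2_space, second_countable_topology}, 'a::finite_dim_inner) atlas"
    and E :: "('m, 'e, 'f::finite_dim_inner) vbundle"
    and B :: "('m \<Rightarrow> 'e) \<Rightarrow> ('m \<Rightarrow> 'e) \<Rightarrow> ('m \<Rightarrow> 'e)" +
  assumes algebroid: "loday_algebroid A E B"
begin

text \<open>The function called \<open>\<rho>(X)(f)\<close> in the anchor equations.\<close>

definition left_symbol :: "('m \<Rightarrow> 'e) \<Rightarrow> ('m \<Rightarrow> real) \<Rightarrow> 'm \<Rightarrow> real" where
  "left_symbol X f = (SOME f'. f' \<in> Cinf A \<and> (\<forall>Y\<in>Sec A E.
     sec_diff E (B X (sec_scale E f Y)) (sec_scale E f (B X Y)) = sec_scale E f' Y))"

lemma left_symbol:
  assumes "X \<in> Sec A E" "f \<in> Cinf A"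
  shows "left_symbol X f \<in> Cinf A"
    and "Y \<in> Sec A E \<Longrightarrow>
      sec_diff E (B X (sec_scale E f Y)) (sec_scale E f (B X Y)) = sec_scale E (left_symbol X f) Y"
proof -
  have "\<exists>f'. f' \<in> Cinf A \<and> (\<forall>Y\<in>Sec A E.
     sec_diff E (B X (sec_scale E f Y)) (sec_scale E f (B X Y)) = sec_scale E f' Y)"
    using algebroid assms unfolding loday_algebroid_def derivative_endomorphism_def by blast
  from someI_ex[OF this]
  show "left_symbol X f \<in> Cinf A"
    "Y \<in> Sec A E \<Longrightarrow>
      sec_diff E (B X (sec_scale E f Y)) (sec_scale E f (B X Y)) = sec_scale E (left_symbol X f) Y"
    unfolding left_symbol_def by blast+
qed

lemma left_symbol_eq:
  assumes "triv_at p \<phi>" "X \<in> Sec A E" "Y \<in> Sec A E" "f \<in> Cinf A"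
  shows "\<phi> p (B X (sec_scale E f Y) p) = f p *\<^sub>R \<phi> p (B X Y p) + left_symbol X f p *\<^sub>R \<phi> p (Y p)"
  using arg_cong[OF left_symbol(2)[OF assms(2,4,3)], of "\<lambda>Z. \<phi> p (Z p)"] assms(2-4)
  by (simp add: sec_apply triv_atD[OF assms(1)] algebra_simps)

text \<open>As the rank is nonzero, \<open>k\<close> can be read off from a section that does not vanish at \<open>p\<close>.
  All identities of the symbol are obtained by checking its defining equation.\<close>

lemma left_symbol_unique:
  assumes "triv_at p \<phi>" "X \<in> Sec A E" "f \<in> Cinf A"
    and "\<And>Y. Y \<in> Sec A E \<Longrightarrow> \<phi> p (B X (sec_scale E f Y) p) = f p *\<^sub>R \<phi> p (B X Y p) + k *\<^sub>R \<phi> p (Y p)"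
  shows "left_symbol X f p = k"
proof -
  obtain Y where Y: "Y \<in> Sec A E" "\<phi> p (Y p) \<noteq> 0" by (rule ex_nonvanishing[OF assms(1)])
  then show ?thesis using left_symbol_eq[OF assms(1,2) Y(1) assms(3)] assms(4)[OF Y(1)] by simp
qed

lemma left_symbol_derivation:
  assumes X: "X \<in> Sec A E"
  shows "(\<lambda>f\<in>Cinf A. left_symbol X f p) \<in> tangent_space A p"
proof -
  obtain \<phi> where tr: "triv_at p \<phi>" by (rule ex_triv_at)
  note eq = left_symbol_eq[OF tr] and T = triv_atD[OF tr]
  have "left_symbol X (\<lambda>q. f q + g q) p = left_symbol X f p + left_symbol X g p"
    if "f \<in> Cinf A" "g \<in> Cinf A" for f g
    by (rule left_symbol_unique[OF tr X Cinf_add[OF that]])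
      (simp add: that X sec_scale_add_fun bracket_add_right sec_apply T eq algebra_simps)
  moreover have "left_symbol X (\<lambda>q. r * f q) p = r * left_symbol X f p" if "f \<in> Cinf A" for r f
    by (rule left_symbol_unique[OF tr X Cinf_mult[OF Cinf_const that]])
      (simp add: that X sec_scale_mult_fun bracket_scale_right sec_apply T eq algebra_simps)
  moreover have "left_symbol X (\<lambda>q. f q * g q) p = f p * left_symbol X g p + g p * left_symbol X f p"
    if "f \<in> Cinf A" "g \<in> Cinf A" for f g
    by (rule left_symbol_unique[OF tr X Cinf_mult[OF that]])
      (simp add: that X sec_scale_mult_fun sec_apply T eq algebra_simps)
  ultimately show ?thesis by (auto simp: tangent_space_def Cinf_add Cinf_mult Cinf_const)
qed

lemma bidiff:
  assumes "f \<in> Cinf A" "g \<in> Cinf A" "X \<in> Sec A E" "Y \<in> Sec A E"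
  shows "delta1 E f (delta1 E g B) X Y = sec_zero E"
    and "delta2 E f (delta1 E g B) X Y = sec_zero E"
    and "delta1 E f (delta2 E g B) X Y = sec_zero E"
proof -
  have "\<forall>\<delta>\<^sub>i\<in>{delta1 E, delta2 E}. \<forall>\<delta>\<^sub>j\<in>{delta1 E, delta2 E}.
      \<forall>f\<in>Cinf A. \<forall>g\<in>Cinf A. \<forall>X\<in>Sec A E. \<forall>Y\<in>Sec A E. \<delta>\<^sub>i f (\<delta>\<^sub>j g B) X Y = sec_zero E"
    using algebroid unfolding loday_algebroid_def bidiff_degree_le_1_def by (elim conjE)
  note D = this[THEN bspec, THEN bspec, THEN bspec[OF _ assms(1)], THEN bspec[OF _ assms(2)],
      THEN bspec[OF _ assms(3)], THEN bspec[OF _ assms(4)]]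
  show "delta1 E f (delta1 E g B) X Y = sec_zero E" by (rule D[of "delta1 E" "delta1 E"]) simp_all
  show "delta2 E f (delta1 E g B) X Y = sec_zero E" by (rule D[of "delta2 E" "delta1 E"]) simp_all
  show "delta1 E f (delta2 E g B) X Y = sec_zero E" by (rule D[of "delta1 E" "delta2 E"]) simp_all
qed

text \<open>Linearity over functions is the condition \<open>\<delta>\<^sub>1(g)\<delta>\<^sub>2(f)B = 0\<close>.\<close>

lemma left_symbol_tensorial:
  assumes f: "f \<in> Cinf A"
  shows "tensorial_at p (\<lambda>X. left_symbol X f p)"
  unfolding tensorial_at_def
proof (intro conjI ballI)
  obtain \<phi> where tr: "triv_at p \<phi>" by (rule ex_triv_at)
  note eq = left_symbol_eq[OF tr] and T = triv_atD[OF tr]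
  fix X assume X: "X \<in> Sec A E"
  show "left_symbol (sec_add E X Y) f p = left_symbol X f p + left_symbol Y f p" if Y: "Y \<in> Sec A E" for Y
    by (rule left_symbol_unique[OF tr sec_add_Sec[OF X Y] f])
      (simp add: X Y f bracket_add_left sec_apply T eq algebra_simps)
  show "left_symbol (sec_scale E g X) f p = g p *\<^sub>R left_symbol X f p" if g: "g \<in> Cinf A" for g
  proof (rule left_symbol_unique[OF tr sec_scale_Sec[OF g X] f])
    fix Y assume Y: "Y \<in> Sec A E"
    have "\<phi> p (delta1 E g (delta2 E f B) X Y p) = 0"
      unfolding bidiff(3)[OF g f X Y] by (simp add: sec_zero_def T)
    then have "\<phi> p (delta2 E f B (sec_scale E g X) Y p) = g p *\<^sub>R \<phi> p (delta2 E f B X Y p)"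
      using delta_delta_apply(1)[OF tr g f X Y] by simp
    then show "\<phi> p (B (sec_scale E g X) (sec_scale E f Y) p)
        = f p *\<^sub>R \<phi> p (B (sec_scale E g X) Y p) + (g p *\<^sub>R left_symbol X f p) *\<^sub>R \<phi> p (Y p)"
      using X Y f g by (simp add: delta_apply[OF tr f] eq algebra_simps)
  qed
qed

text \<open>The term that the second anchor equation attributes to \<open>\<alpha>(Y)(df \<otimes> X)\<close>.\<close>

definition right_symbol :: "('m \<Rightarrow> real) \<Rightarrow> ('m \<Rightarrow> 'e) \<Rightarrow> ('m \<Rightarrow> 'e) \<Rightarrow> 'm \<Rightarrow> 'e" where
  "right_symbol f X Y = sec_add E (delta1 E f B X Y) (sec_scale E (left_symbol Y f) X)"

lemma right_symbol_Sec [simp]: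
  "f \<in> Cinf A \<Longrightarrow> X \<in> Sec A E \<Longrightarrow> Y \<in> Sec A E \<Longrightarrow> right_symbol f X Y \<in> Sec A E"
  by (simp add: right_symbol_def delta1_def left_symbol(1))

lemma right_symbol_apply:
  assumes "triv_at p \<phi>" "f \<in> Cinf A" "X \<in> Sec A E" "Y \<in> Sec A E"
  shows "\<phi> p (right_symbol f X Y p) = \<phi> p (delta1 E f B X Y p) + left_symbol Y f p *\<^sub>R \<phi> p (X p)"
  using assms by (simp add: right_symbol_def sec_apply triv_atD[OF assms(1)] delta_Sec[OF assms(2)])

text \<open>The conditions \<open>\<delta>\<^sub>1(f)\<delta>\<^sub>1(g)B = 0\<close> and \<open>\<delta>\<^sub>2(f)\<delta>\<^sub>1(g)B = 0\<close>.\<close>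

lemma delta1_tensorial:
  assumes tr: "triv_at p \<phi>" and g: "g \<in> Cinf A"
  shows "Y \<in> Sec A E \<Longrightarrow> tensorial_at p (\<lambda>X. \<phi> p (delta1 E g B X Y p))"
    and "X \<in> Sec A E \<Longrightarrow> tensorial_at p (\<lambda>Y. \<phi> p (delta1 E g B X Y p))"
proof -
  note T = triv_atD[OF tr] and D = delta_apply(1)[OF tr g]
  show "tensorial_at p (\<lambda>X. \<phi> p (delta1 E g B X Y p))" if Y: "Y \<in> Sec A E"
    unfolding tensorial_at_def
  proof (intro conjI ballI)
    fix X assume X: "X \<in> Sec A E"
    show "\<phi> p (delta1 E g B (sec_add E X X') Y p) = \<phi> p (delta1 E g B X Y p) + \<phi> p (delta1 E g B X' Y p)"
      if X': "X' \<in> Sec A E" for X'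
      using X X' Y g by (simp add: D sec_scale_add bracket_add_left sec_apply T algebra_simps)
    show "\<phi> p (delta1 E g B (sec_scale E f X) Y p) = f p *\<^sub>R \<phi> p (delta1 E g B X Y p)" if f: "f \<in> Cinf A" for f
    proof -
      have "\<phi> p (delta1 E f (delta1 E g B) X Y p) = 0"
        unfolding bidiff(1)[OF f g X Y] by (simp add: sec_zero_def T)
      then show ?thesis using delta_delta_apply(1)[OF tr f g X Y] by simp
    qed
  qed
  show "tensorial_at p (\<lambda>Y. \<phi> p (delta1 E g B X Y p))" if X: "X \<in> Sec A E"
    unfolding tensorial_at_def
  proof (intro conjI ballI)
    fix Y assume Y: "Y \<in> Sec A E"
    show "\<phi> p (delta1 E g B X (sec_add E Y Y') p) = \<phi> p (delta1 E g B X Y p) + \<phi> p (delta1 E g B X Y' p)"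
      if Y': "Y' \<in> Sec A E" for Y'
      using X Y Y' g by (simp add: D bracket_add_right sec_apply T algebra_simps)
    show "\<phi> p (delta1 E g B X (sec_scale E f Y) p) = f p *\<^sub>R \<phi> p (delta1 E g B X Y p)" if f: "f \<in> Cinf A" for f
    proof -
      have "\<phi> p (delta2 E f (delta1 E g B) X Y p) = 0"
        unfolding bidiff(2)[OF f g X Y] by (simp add: sec_zero_def T)
      then show ?thesis using delta_delta_apply(2)[OF tr f g X Y] by simp
    qed
  qed
qed

lemma right_symbol_tensorial:
  assumes tr: "triv_at p \<phi>" and g: "g \<in> Cinf A"
  shows "Y \<in> Sec A E \<Longrightarrow> tensorial_at p (\<lambda>X. \<phi> p (right_symbol g X Y p))"
    and "X \<in> Sec A E \<Longrightarrow> tensorial_at p (\<lambda>Y. \<phi> p (right_symbol g X Y p))"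
  using delta1_tensorial[OF tr g] left_symbol_tensorial[OF g, of p]
  by (simp_all add: tensorial_at_def right_symbol_apply[OF tr g] sec_apply triv_atD[OF tr] algebra_simps)

text \<open>For the product rule write \<open>(fg)X\<close> as \<open>f(gX)\<close> and use that \<open>\<delta>\<^sub>1(f)B\<close> is function-linear in its first
  argument. Pairing with \<open>w\<close> makes the vector-valued derivation a tangent vector.\<close>

lemma right_symbol_derivation:
  assumes tr: "triv_at p \<phi>" and X: "X \<in> Sec A E" and Y: "Y \<in> Sec A E"
  shows "(\<lambda>f\<in>Cinf A. \<phi> p (right_symbol f X Y p) \<bullet> w) \<in> tangent_space A p"
proof -
  note T = triv_atD[OF tr]
  note L = tangentD[OF left_symbol_derivation[OF Y, of p]]
  have LC: "left_symbol Y (\<lambda>q. f q + g q) p = left_symbol Y f p + left_symbol Y g p"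
     "left_symbol Y (\<lambda>q. f q * g q) p = f p * left_symbol Y g p + g p * left_symbol Y f p"
    if "f \<in> Cinf A" "g \<in> Cinf A" for f g
    using L(1)[OF that] L(3)[OF that] that by (simp_all add: Cinf_add Cinf_mult)
  have LC': "left_symbol Y (\<lambda>q. r * f q) p = r * left_symbol Y f p" if "f \<in> Cinf A" for f r
    using L(2)[OF that, of r] that by (simp add: Cinf_mult Cinf_const)
  have D: "\<phi> p (right_symbol f X' Y p) = \<phi> p (B (sec_scale E f X') Y p) - f p *\<^sub>R \<phi> p (B X' Y p)
      + left_symbol Y f p *\<^sub>R \<phi> p (X' p)" if "f \<in> Cinf A" "X' \<in> Sec A E" for f X'
    using right_symbol_apply[OF tr that Y] delta_apply(1)[OF tr that Y] by simp
  have add: "\<phi> p (right_symbol (\<lambda>q. f q + g q) X Y p) = \<phi> p (right_symbol f X Y p) + \<phi> p (right_symbol g X Y p)"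
    if "f \<in> Cinf A" "g \<in> Cinf A" for f g
    using that X Y
    by (simp add: D Cinf_add LC sec_scale_add_fun bracket_add_left sec_apply T algebra_simps)
  have scale: "\<phi> p (right_symbol (\<lambda>q. r * f q) X Y p) = r *\<^sub>R \<phi> p (right_symbol f X Y p)"
    if "f \<in> Cinf A" for r f
    using that X Y
    by (simp add: D Cinf_mult Cinf_const LC' sec_scale_mult_fun bracket_scale_left sec_apply T algebra_simps)
  have mult: "\<phi> p (right_symbol (\<lambda>q. f q * g q) X Y p)
      = f p *\<^sub>R \<phi> p (right_symbol g X Y p) + g p *\<^sub>R \<phi> p (right_symbol f X Y p)"
    if f: "f \<in> Cinf A" and g: "g \<in> Cinf A" for f g
  proof -
    have "\<phi> p (delta1 E f B (sec_scale E g X) Y p) = g p *\<^sub>R \<phi> p (delta1 E f B X Y p)"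
      using delta1_tensorial(1)[OF tr f Y] X g by (simp add: tensorial_at_def)
    then have "\<phi> p (B (sec_scale E f (sec_scale E g X)) Y p) =
        f p *\<^sub>R \<phi> p (B (sec_scale E g X) Y p)
        + g p *\<^sub>R (\<phi> p (B (sec_scale E f X) Y p) - f p *\<^sub>R \<phi> p (B X Y p))"
      using X Y f g by (simp add: delta_apply(1)[OF tr f] algebra_simps)
    then show ?thesis
      using f g X Y by (simp add: D Cinf_mult LC sec_scale_mult_fun algebra_simps)
  qed
  show ?thesis
    unfolding tangent_space_def mem_Collect_eq
  proof (intro conjI ballI allI)
    fix f g :: "'m \<Rightarrow> real" and r :: real
    let ?v = "\<lambda>f\<in>Cinf A. \<phi> p (right_symbol f X Y p) \<bullet> w"
    assume f: "f \<in> Cinf A"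
    show "?v (\<lambda>q. r * f q) = r * ?v f" using f scale[OF f, of r] by (simp add: Cinf_mult Cinf_const)
    assume g: "g \<in> Cinf A"
    show "?v (\<lambda>q. f q + g q) = ?v f + ?v g" using f g add[OF f g] by (simp add: Cinf_add inner_add_left)
    show "?v (\<lambda>q. f q * g q) = f p * ?v g + g p * ?v f"
      using f g mult[OF f g] by (simp add: Cinf_mult inner_add_left)
  qed simp
qed

lemma right_symbol_coords:
  assumes tr: "triv_at p \<phi>" and x: "is_coords U c p x" and X: "X \<in> Sec A E" and Y: "Y \<in> Sec A E"
    and f: "f \<in> Cinf A"
  shows "\<phi> p (right_symbol f X Y p) = (\<Sum>b\<in>onb. dirder U c p b f *\<^sub>R \<phi> p (right_symbol (x b) X Y p))"
proof (rule onb_eqI)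
  fix w
  have "x b \<in> Cinf A" for b using x by (simp add: is_coords_def)
  then show "\<phi> p (right_symbol f X Y p) \<bullet> w
      = (\<Sum>b\<in>onb. dirder U c p b f *\<^sub>R \<phi> p (right_symbol (x b) X Y p)) \<bullet> w"
    using tangent_coords_expand[OF x right_symbol_derivation[OF tr X Y] f, of w] f
    by (simp add: inner_sum_left mult.commute)
qed

definition left_anchor :: "'m \<Rightarrow> 'e \<Rightarrow> ('m \<Rightarrow> real) \<Rightarrow> real" where
  "left_anchor p e = (\<lambda>f\<in>Cinf A. left_symbol (sec_at p e) f p)"

lemma left_anchor_apply:
  assumes "X \<in> Sec A E" "f \<in> Cinf A"
  shows "left_anchor p (X p) f = left_symbol X f p"
  using tensorial_local[OF left_symbol_tensorial[OF assms(2)], of "sec_at p (X p)" X] assms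
  by (simp add: left_anchor_def)

lemma left_anchor_tangent: "e \<in> fibre E p \<Longrightarrow> left_anchor p e \<in> tangent_space A p"
  unfolding left_anchor_def by (rule left_symbol_derivation) simp

text \<open>Near \<open>p\<close> the coefficients with respect to a frame \<open>s\<close> and coordinates \<open>x\<close> are the smooth functions
  \<open>left_symbol (s b) (x j)\<close>.\<close>

lemma left_anchor_morphism: "bundle_morphism A E (tangent_bundle A) left_anchor"
  unfolding bundle_morphism_def
proof (intro conjI allI)
  fix p
  show "left_anchor p \<in> fibre E p \<rightarrow> fibre (tangent_bundle A) p"
    by (simp add: left_anchor_tangent)
  show "linear_wrt (fibre E p) (vadd E p) (vscale E p) (vadd (tangent_bundle A) p)
      (vscale (tangent_bundle A) p) (left_anchor p)"
    using tensorial_sec_at[OF left_symbol_tensorial]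
    by (auto simp: linear_wrt_def left_anchor_def fun_eq_iff)
next
  show "\<forall>(U, \<phi>)\<in>trivs E. \<forall>(V, \<psi>)\<in>trivs (tangent_bundle A).
      smooth_family_on A (U \<inter> V) (\<lambda>p v. \<psi> p (left_anchor p (inv_into (fibre E p) (\<phi> p) v)))"
  proof clarify
    fix U \<phi> V \<psi> assume U: "(U, \<phi>) \<in> trivs E" and "(V, \<psi>) \<in> trivs (tangent_bundle A)"
    then obtain c where c: "(V, c) \<in> A" "\<psi> = tcoord V c" by auto
    have "mfamily_at A (\<lambda>p v. tcoord V c p (left_anchor p (inv_into (fibre E p) (\<phi> p) v))) p v"
      if p: "p \<in> U \<inter> V" for p v
    proof -
      obtain s where s: "is_frame U \<phi> p s" using ex_frame[OF U] p by blast
      obtain x where x: "is_coords V c p x" using ex_coords[OF c(1)] p by blast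
      have sS: "s b \<in> Sec A E" and xC: "x j \<in> Cinf A" for b j
        using s x by (auto simp: is_frame_def is_coords_def)
      show ?thesis
      proof (rule mfamily_at_linearI)
        show "\<forall>\<^sub>F q in nhds p. \<forall>v. tcoord V c q (left_anchor q (inv_into (fibre E q) (\<phi> q) v))
            = (\<Sum>b\<in>onb. (v \<bullet> b) *\<^sub>R (\<Sum>j\<in>onb. left_symbol (s b) (x j) q *\<^sub>R j))"
          using eventually_is_frame[OF s] eventually_is_coords[OF x]
        proof eventually_elim
          case (elim q)
          have tr: "triv_at q \<phi>" using elim(1) by (auto simp: is_frame_def triv_at_def)
          show ?case
          proof
            fix v
            let ?e = "inv_into (fibre E q) (\<phi> q) v"
            have e: "?e \<in> fibre E q" by (rule triv_atD(4)[OF tr])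
            have "left_anchor q ?e (x j) = (\<Sum>b\<in>onb. (v \<bullet> b) * left_symbol (s b) (x j) q)" for j
              using tensorial_frame_expand[OF left_symbol_tensorial[OF xC] elim(1), of "sec_at q ?e"] e
              by (simp add: left_anchor_def xC triv_atD(5)[OF tr])
            then show "tcoord V c q (left_anchor q ?e)
                = (\<Sum>b\<in>onb. (v \<bullet> b) *\<^sub>R (\<Sum>j\<in>onb. left_symbol (s b) (x j) q *\<^sub>R j))"
              unfolding tcoord_eq[OF elim(2) left_anchor_tangent[OF e]]
              by (simp add: scaleR_sum_left scaleR_sum_right) (rule sum.swap)
          qed
        qed
        show "msmooth_at A (\<lambda>q. \<Sum>j\<in>onb. left_symbol (s b) (x j) q *\<^sub>R j) p" for b
          using left_symbol(1)[OF sS xC]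
          by (intro msmooth_at_sum msmooth_at_scaleR msmooth_at_const) (auto simp: Cinf_iff)
      qed
    qed
    then show "smooth_family_on A (U \<inter> V) (\<lambda>p v. \<psi> p (left_anchor p (inv_into (fibre E p) (\<phi> p) v)))"
      using smooth_family_on_iff[OF open_Int[OF triv(1)[OF U] chart(1)[OF c(1)]],
        of "\<lambda>p v. \<psi> p (left_anchor p (inv_into (fibre E p) (\<phi> p) v))"] c(2) by simp
  qed
qed

end

section \<open>The right anchor\<close>

text \<open>The elementary tensors in the model fibre of \<open>TM \<otimes> End(E)\<close>, linear in \<open>w\<close>. As all spaces have
  finite dimension, a map into this model fibre is smooth as soon as it is a sum of such terms with
  smooth \<open>w\<close>.\<close>

definition elem_blinfun ::
  "'a \<Rightarrow> 'f \<Rightarrow> 'f \<Rightarrow> ('a::finite_dim_inner \<Rightarrow>\<^sub>L real) \<Rightarrow>\<^sub>L ('f::finite_dim_inner \<Rightarrow>\<^sub>L 'f)" where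
  "elem_blinfun j k w = blinfun_scaleR_left (blinfun_scaleR_left w o\<^sub>L blinfun_inner_left k)
     o\<^sub>L Blinfun (\<lambda>\<eta>. blinfun_apply \<eta> j)"

lemma elem_blinfun_apply:
  "blinfun_apply (blinfun_apply (elem_blinfun j k w) \<eta>) v = (blinfun_apply \<eta> j * (v \<bullet> k)) *\<^sub>R w"
  by (simp add: elem_blinfun_def bounded_linear_Blinfun_apply[OF blinfun.bounded_linear_left]
      blinfun.scaleR_left inner_commute)

lemma bounded_linear_elem_blinfun: "bounded_linear (elem_blinfun j k)"
  by (intro linear_imp_bounded_linear linearI blinfun_eqI)
    (simp_all add: elem_blinfun_apply blinfun.add_left blinfun.scaleR_left scaleR_add_right)

context loday_algebroid_mfd
begin

text \<open>A covector is represented by a function and the vectors by sections; the choices do not matter by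
  \<open>right_symbol_local\<close>.\<close>

definition right_anchor :: "'m \<Rightarrow> 'e \<Rightarrow> ((('m \<Rightarrow> real) \<Rightarrow> real) \<Rightarrow> real) \<Rightarrow> 'e \<Rightarrow> 'e" where
  "right_anchor p e = (\<lambda>\<xi>\<in>dual_fibre (tangent_bundle A) p. \<lambda>x\<in>fibre E p.
     right_symbol (SOME f. f \<in> Cinf A \<and> differential A f p = \<xi>) (sec_at p x) (sec_at p e) p)"

lemma right_symbol_local:
  assumes f: "f \<in> Cinf A" "g \<in> Cinf A" "differential A f p = differential A g p"
    and X: "X \<in> Sec A E" "X' \<in> Sec A E" "X p = X' p" and Y: "Y \<in> Sec A E" "Y' \<in> Sec A E" "Y p = Y' p"
  shows "right_symbol f X Y p = right_symbol g X' Y' p"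
proof -
  obtain \<phi> where tr: "triv_at p \<phi>" by (rule ex_triv_at)
  obtain U c where c: "(U, c) \<in> A" "p \<in> U" by (rule ex_chart)
  obtain x where x: "is_coords U c p x" by (rule ex_coords[OF c])
  have "dirder U c p b f = dirder U c p b g" for b
    using f(3) differential_dirder[OF c, of f b] differential_dirder[OF c, of g b] by simp
  then have "\<phi> p (right_symbol f X Y p) = \<phi> p (right_symbol g X Y p)"
    unfolding right_symbol_coords[OF tr x X(1) Y(1) f(1)] right_symbol_coords[OF tr x X(1) Y(1) f(2)] by simp
  also have "\<dots> = \<phi> p (right_symbol g X' Y p)"
    by (rule tensorial_local[OF right_symbol_tensorial(1)[OF tr f(2) Y(1)] X])
  also have "\<dots> = \<phi> p (right_symbol g X' Y' p)"
    by (rule tensorial_local[OF right_symbol_tensorial(2)[OF tr f(2) X(2)] Y])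
  finally show ?thesis
    by (intro triv_at_eqI[OF tr]) (simp_all add: assms)
qed

lemma right_anchor_apply:
  assumes f: "f \<in> Cinf A" and X: "X \<in> Sec A E" and Y: "Y \<in> Sec A E"
  shows "right_anchor p (Y p) (differential A f p) (X p) = right_symbol f X Y p"
proof -
  let ?g = "SOME g. g \<in> Cinf A \<and> differential A g p = differential A f p"
  have g: "?g \<in> Cinf A \<and> differential A ?g p = differential A f p"
    by (rule someI[of _ f]) (simp add: f)
  then have "right_symbol ?g (sec_at p (X p)) (sec_at p (Y p)) p = right_symbol f X Y p"
    using X Y f by (intro right_symbol_local) simp_all
  then show ?thesis using differential_in_dual[OF f] X by (simp add: right_anchor_def)
qed

lemma right_anchor_sec_at:
  assumes "f \<in> Cinf A" "e \<in> fibre E p" "x \<in> fibre E p"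
  shows "right_anchor p e (differential A f p) x = right_symbol f (sec_at p x) (sec_at p e) p"
  using right_anchor_apply[OF assms(1), of "sec_at p x" "sec_at p e" p] assms(2,3) by simp

lemma right_anchor_End:
  assumes e: "e \<in> fibre E p" and \<xi>: "\<xi> \<in> dual_fibre (tangent_bundle A) p"
  shows "right_anchor p e \<xi> \<in> fibre (End_bundle E) p"
proof -
  obtain \<phi> where tr: "triv_at p \<phi>" by (rule ex_triv_at)
  obtain f where f: "f \<in> Cinf A" "differential A f p = \<xi>" by (rule ex_differential[OF \<xi>])
  note R = right_anchor_sec_at[OF f(1) e, unfolded f(2)]
  show ?thesis
  proof (rule End_fibreI[OF _ _ tr])
    show "right_anchor p e \<xi> x = undefined" if "x \<notin> fibre E p" for x
      using that \<xi> by (simp add: right_anchor_def)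
    show "right_anchor p e \<xi> x \<in> fibre E p" if "x \<in> fibre E p" for x
      using that f e by (simp add: R)
  qed (use tensorial_sec_at[OF right_symbol_tensorial(1)[OF tr f(1)]] e in \<open>simp_all add: R\<close>)
qed

lemma right_anchor_coords:
  assumes e: "e \<in> fibre E p" and \<xi>: "\<xi> \<in> dual_fibre (tangent_bundle A) p" and y: "y \<in> fibre E p"
    and x: "is_coords U c p x" and tr: "triv_at p \<phi>"
  shows "\<phi> p (right_anchor p e \<xi> y)
    = (\<Sum>b\<in>onb. \<xi> (dirder U c p b) *\<^sub>R \<phi> p (right_anchor p e (differential A (x b) p) y))"
proof -
  obtain f where f: "f \<in> Cinf A" "differential A f p = \<xi>" by (rule ex_differential[OF \<xi>])
  have c: "(U, c) \<in> A" "p \<in> U" and xC: "x b \<in> Cinf A" for b using x by (auto simp: is_coords_def)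
  note R = right_anchor_sec_at[OF f(1) e y, unfolded f(2)] right_anchor_sec_at[OF xC e y]
  show ?thesis
    unfolding R using right_symbol_coords[OF tr x _ _ f(1), of "sec_at p y" "sec_at p e"] e y
      differential_dirder[OF c, of f] f(2) by simp
qed

text \<open>By \<open>right_anchor_coords\<close> the value at \<open>e\<close> is the sum of the tensors \<open>\<partial>\<^sub>b \<otimes> \<Phi>\<^sub>b\<close>, where \<open>\<Phi>\<^sub>b\<close> is its value on
  \<open>dx\<^sub>b\<close>. The induction over finite sets of indices follows the inductive definition of the tensor product.\<close>

lemma right_anchor_tensor:
  assumes e: "e \<in> fibre E p"
  shows "right_anchor p e \<in> tensor_fibre (tangent_bundle A) (End_bundle E) p"
proof -
  obtain \<phi> where tr: "triv_at p \<phi>" by (rule ex_triv_at)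
  obtain U c where c: "(U, c) \<in> A" "p \<in> U" by (rule ex_chart)
  obtain x where x: "is_coords U c p x" by (rule ex_coords[OF c])
  have xC: "x b \<in> Cinf A" for b using x by (auto simp: is_coords_def)
  let ?v = "dirder U c p" and ?\<Phi> = "\<lambda>b. right_anchor p e (differential A (x b) p)"
  have \<Phi>: "?\<Phi> b \<in> fibre (End_bundle E) p" for b
    by (rule right_anchor_End[OF e differential_in_dual[OF xC]])
  have "\<exists>t. t \<in> tensor_fibre (tangent_bundle A) (End_bundle E) p \<and>
      (\<forall>\<xi>\<in>dual_fibre (tangent_bundle A) p. \<forall>y\<in>fibre E p.
        \<phi> p (t \<xi> y) = (\<Sum>b\<in>I. \<xi> (?v b) *\<^sub>R \<phi> p (?\<Phi> b y)))" if "finite I" for I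
    using that
  proof (induction I rule: finite_induct)
    case empty
    show ?case
      by (rule exI, rule conjI, rule tensor_fibre.zero) (simp add: tensor_zero_def triv_atD[OF tr])
  next
    case (insert b I)
    then obtain t where t: "t \<in> tensor_fibre (tangent_bundle A) (End_bundle E) p"
      "\<And>\<xi> y. \<xi> \<in> dual_fibre (tangent_bundle A) p \<Longrightarrow> y \<in> fibre E p \<Longrightarrow>
        \<phi> p (t \<xi> y) = (\<Sum>b\<in>I. \<xi> (?v b) *\<^sub>R \<phi> p (?\<Phi> b y))" by blast
    let ?t = "tensor_add (tangent_bundle A) (End_bundle E) p
      (elem_tensor (tangent_bundle A) (End_bundle E) p (?v b) (?\<Phi> b)) t"
    have "?t \<in> tensor_fibre (tangent_bundle A) (End_bundle E) p"
      by (intro tensor_fibre.add \<Phi> t(1)) (simp add: dirder_tangent[OF c])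
    moreover have "\<phi> p (?t \<xi> y) = (\<Sum>b\<in>insert b I. \<xi> (?v b) *\<^sub>R \<phi> p (?\<Phi> b y))"
      if \<xi>: "\<xi> \<in> dual_fibre (tangent_bundle A) p" and y: "y \<in> fibre E p" for \<xi> y
    proof -
      have "t \<xi> y \<in> fibre E p" "?\<Phi> b y \<in> fibre E p"
        using End_fibreD(2)[OF tensor_fibreD(2)[OF t(1) \<xi>] y] End_fibreD(2)[OF \<Phi> y] by auto
      then show ?thesis
        using \<xi> y insert.hyps
        by (simp add: tensor_add_def elem_tensor_def triv_atD[OF tr] t(2)[OF \<xi> y])
    qed
    ultimately show ?case by blast
  qed
  from this[OF finite_onb] obtain t where t: "t \<in> tensor_fibre (tangent_bundle A) (End_bundle E) p"
    "\<And>\<xi> y. \<xi> \<in> dual_fibre (tangent_bundle A) p \<Longrightarrow> y \<in> fibre E p \<Longrightarrow>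
      \<phi> p (t \<xi> y) = (\<Sum>b\<in>onb. \<xi> (?v b) *\<^sub>R \<phi> p (?\<Phi> b y))" by blast
  have "right_anchor p e \<xi> y = t \<xi> y" for \<xi> y
  proof (cases "\<xi> \<in> dual_fibre (tangent_bundle A) p")
    case \<xi>: True
    note D = right_anchor_End[OF e \<xi>] tensor_fibreD(2)[OF t(1) \<xi>]
    show ?thesis
    proof (cases "y \<in> fibre E p")
      case True
      then show ?thesis
        using right_anchor_coords[OF e \<xi> True x tr] t(2)[OF \<xi> True]
          End_fibreD(2)[OF D(1) True] End_fibreD(2)[OF D(2) True]
        by (intro triv_at_eqI[OF tr]) simp_all
    qed (simp add: End_fibreD(1)[OF D(1)] End_fibreD(1)[OF D(2)])
  qed (simp add: right_anchor_def tensor_fibreD(1)[OF t(1)])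
  then have "right_anchor p e = t" by (intro ext)
  then show ?thesis using t(1) by simp
qed

lemma right_anchor_linear:
  "linear_wrt (fibre E p) (vadd E p) (vscale E p) (vadd TE p) (vscale TE p) (right_anchor p)"
  unfolding linear_wrt_def
proof (intro conjI ballI allI ext)
  obtain \<phi> where tr: "triv_at p \<phi>" by (rule ex_triv_at)
  fix e \<xi> y r assume e: "e \<in> fibre E p"
  show "right_anchor p (vscale E p r e) \<xi> y = vscale TE p r (right_anchor p e) \<xi> y"
  proof (cases "\<xi> \<in> dual_fibre (tangent_bundle A) p \<and> y \<in> fibre E p")
    case True
    then obtain f where f: "f \<in> Cinf A" "differential A f p = \<xi>" using ex_differential by blast
    note R = right_anchor_sec_at[where p = p, OF f(1), unfolded f(2)]
    have "right_anchor p (vscale E p r e) \<xi> y = vscale E p r (right_anchor p e \<xi> y)"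
      using tensorial_sec_at(2)[OF right_symbol_tensorial(2)[OF tr f(1), of "sec_at p y"] e, of e r] e f(1) True
      by (intro triv_at_eqI[OF tr]) (simp_all add: R triv_atD[OF tr])
    then show ?thesis using True by (simp add: tensor_bundle_simps tensor_scale_def)
  qed (auto simp: right_anchor_def tensor_bundle_simps tensor_scale_def)
  fix e' assume e': "e' \<in> fibre E p"
  show "right_anchor p (vadd E p e e') \<xi> y = vadd TE p (right_anchor p e) (right_anchor p e') \<xi> y"
  proof (cases "\<xi> \<in> dual_fibre (tangent_bundle A) p \<and> y \<in> fibre E p")
    case True
    then obtain f where f: "f \<in> Cinf A" "differential A f p = \<xi>" using ex_differential by blast
    note R = right_anchor_sec_at[where p = p, OF f(1), unfolded f(2)]
    have "right_anchor p (vadd E p e e') \<xi> y = vadd E p (right_anchor p e \<xi> y) (right_anchor p e' \<xi> y)"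
      using tensorial_sec_at(1)[OF right_symbol_tensorial(2)[OF tr f(1), of "sec_at p y"] e e'] e e' f(1) True
      by (intro triv_at_eqI[OF tr]) (simp_all add: R triv_atD[OF tr])
    then show ?thesis using True by (simp add: tensor_bundle_simps tensor_add_def)
  qed (auto simp: right_anchor_def tensor_bundle_simps tensor_add_def)
qed

text \<open>Near \<open>p\<close> all three arguments are expanded: the covector in coordinates and the two vectors in frames.
  Two trivialisations of \<open>E\<close> occur, one for the source of the morphism and one for the
  endomorphisms.\<close>

lemma right_anchor_smooth:
  assumes U: "(U, \<phi>) \<in> trivs E" "p \<in> U" and c: "(V, c) \<in> A" "p \<in> V" and U': "(U', \<phi>') \<in> trivs E" "p \<in> U'"
  shows "mfamily_at A (\<lambda>p v. Blinfun (\<lambda>\<eta>. Blinfun (\<lambda>u. \<phi>' p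
     (right_anchor p (inv_into (fibre E p) (\<phi> p) v)
       (\<lambda>w\<in>tangent_space A p. blinfun_apply \<eta> (tcoord V c p w)) (inv_into (fibre E p) (\<phi>' p) u))))) p v"
proof -
  obtain s where s: "is_frame U \<phi> p s" by (rule ex_frame[OF U])
  obtain s' where s': "is_frame U' \<phi>' p s'" by (rule ex_frame[OF U'])
  obtain x where x: "is_coords V c p x" by (rule ex_coords[OF c])
  have S: "s b \<in> Sec A E" "s' b \<in> Sec A E" and xC: "x j \<in> Cinf A" for b j
    using s s' x by (auto simp: is_frame_def is_coords_def)
  let ?W = "\<lambda>j k b q. \<phi>' q (right_symbol (x j) (s' k) (s b) q)"
  show ?thesis
  proof (rule mfamily_at_linearI)
    show "msmooth_at A (\<lambda>q. \<Sum>j\<in>onb. \<Sum>k\<in>onb. elem_blinfun j k (?W j k b q)) p" for b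
      by (intro msmooth_at_sum msmooth_at_bounded_linear[OF bounded_linear_elem_blinfun]
          Sec_smooth[OF right_symbol_Sec U'] S xC)
    show "\<forall>\<^sub>F q in nhds p. \<forall>v. Blinfun (\<lambda>\<eta>. Blinfun (\<lambda>u. \<phi>' q
       (right_anchor q (inv_into (fibre E q) (\<phi> q) v)
         (\<lambda>w\<in>tangent_space A q. blinfun_apply \<eta> (tcoord V c q w)) (inv_into (fibre E q) (\<phi>' q) u))))
      = (\<Sum>b\<in>onb. (v \<bullet> b) *\<^sub>R (\<Sum>j\<in>onb. \<Sum>k\<in>onb. elem_blinfun j k (?W j k b q)))"
      using eventually_is_frame[OF s] eventually_is_frame[OF s'] eventually_is_coords[OF x]
    proof eventually_elim
      case (elim q)
      have tr: "triv_at q \<phi>" "triv_at q \<phi>'" and cq: "(V, c) \<in> A" "q \<in> V"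
        using elim by (auto simp: is_frame_def triv_at_def is_coords_def)
      show ?case
      proof
        fix v
        define e where "e = inv_into (fibre E q) (\<phi> q) v"
        define Q where "Q = (\<Sum>b\<in>onb. (v \<bullet> b) *\<^sub>R (\<Sum>j\<in>onb. \<Sum>k\<in>onb. elem_blinfun j k (?W j k b q)))"
        have e: "e \<in> fibre E q" "\<phi> q e = v" using triv_atD(4,5)[OF tr(1)] by (auto simp: e_def)
        have "\<phi>' q (right_anchor q e (\<lambda>w\<in>tangent_space A q. blinfun_apply \<eta> (tcoord V c q w))
            (inv_into (fibre E q) (\<phi>' q) u)) = blinfun_apply (blinfun_apply Q \<eta>) u" for \<eta> u
        proof -
          define y where "y = inv_into (fibre E q) (\<phi>' q) u"
          define \<xi> where "\<xi> = (\<lambda>w\<in>tangent_space A q. blinfun_apply \<eta> (tcoord V c q w))"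
          have y: "y \<in> fibre E q" "\<phi>' q y = u" using triv_atD(4,5)[OF tr(2)] by (auto simp: y_def)
          have \<xi>: "\<xi> \<in> dual_fibre (tangent_bundle A) q"
            by (auto simp: dual_fibre_def linear_wrt_def \<xi>_def tangent_space_closed tcoord_linear[OF cq]
                blinfun.add_right blinfun.scaleR_right)
          have \<xi>d: "\<xi> (dirder V c q j) = blinfun_apply \<eta> j" for j
            by (simp add: \<xi>_def dirder_tangent[OF cq] tcoord_dirder[OF cq])
          have W: "\<phi>' q (right_anchor q e (differential A (x j) q) y)
              = (\<Sum>k\<in>onb. \<Sum>b\<in>onb. ((u \<bullet> k) * (v \<bullet> b)) *\<^sub>R ?W j k b q)" for j
          proof -
            have "\<phi>' q (right_anchor q e (differential A (x j) q) y)
                = \<phi>' q (right_symbol (x j) (sec_at q y) (sec_at q e) q)"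
              by (simp add: right_anchor_sec_at[OF xC e(1) y(1)])
            also have "\<dots> = (\<Sum>k\<in>onb. (u \<bullet> k) *\<^sub>R \<phi>' q (right_symbol (x j) (s' k) (sec_at q e) q))"
              using tensorial_frame_expand[OF right_symbol_tensorial(1)[OF tr(2) xC] elim(2)] e y by simp
            also have "\<dots> = (\<Sum>k\<in>onb. (u \<bullet> k) *\<^sub>R (\<Sum>b\<in>onb. (v \<bullet> b) *\<^sub>R ?W j k b q))"
              using tensorial_frame_expand[OF right_symbol_tensorial(2)[OF tr(2) xC S(2)] elim(1), of "sec_at q e"]
                e y by simp
            finally show ?thesis by (simp add: scaleR_sum_right)
          qed
          have "\<phi>' q (right_anchor q e \<xi> y)
              = (\<Sum>j\<in>onb. \<Sum>k\<in>onb. \<Sum>b\<in>onb. (v \<bullet> b) *\<^sub>R (blinfun_apply \<eta> j * (u \<bullet> k)) *\<^sub>R ?W j k b q)"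
            unfolding right_anchor_coords[OF e(1) \<xi> y(1) elim(3) tr(2)] W
            by (simp add: \<xi>d scaleR_sum_right mult_ac)
          also have "\<dots> = (\<Sum>j\<in>onb. \<Sum>b\<in>onb. \<Sum>k\<in>onb. (v \<bullet> b) *\<^sub>R (blinfun_apply \<eta> j * (u \<bullet> k)) *\<^sub>R ?W j k b q)"
            by (rule sum.cong[OF refl], rule sum.swap)
          also have "\<dots> = (\<Sum>b\<in>onb. \<Sum>j\<in>onb. \<Sum>k\<in>onb. (v \<bullet> b) *\<^sub>R (blinfun_apply \<eta> j * (u \<bullet> k)) *\<^sub>R ?W j k b q)"
            by (rule sum.swap)
          also have "\<dots> = blinfun_apply (blinfun_apply Q \<eta>) u"
            by (simp add: Q_def blinfun.sum_left blinfun.scaleR_left elem_blinfun_apply scaleR_sum_right)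
          finally show ?thesis by (simp add: y_def \<xi>_def)
        qed
        then show "Blinfun (\<lambda>\<eta>. Blinfun (\<lambda>u. \<phi>' q
           (right_anchor q (inv_into (fibre E q) (\<phi> q) v)
             (\<lambda>w\<in>tangent_space A q. blinfun_apply \<eta> (tcoord V c q w)) (inv_into (fibre E q) (\<phi>' q) u))))
          = (\<Sum>b\<in>onb. (v \<bullet> b) *\<^sub>R (\<Sum>j\<in>onb. \<Sum>k\<in>onb. elem_blinfun j k (?W j k b q)))"
          unfolding e_def[symmetric] Q_def[symmetric] by (simp add: blinfun_apply_inverse)
      qed
    qed
  qed
qed

lemma right_anchor_morphism: "bundle_morphism A E TE right_anchor"
  unfolding bundle_morphism_def
proof (intro conjI allI)
  show "right_anchor p \<in> fibre E p \<rightarrow> fibre TE p" for p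
    by (simp add: right_anchor_tensor tensor_bundle_simps)
  show "linear_wrt (fibre E p) (vadd E p) (vscale E p) (vadd TE p) (vscale TE p) (right_anchor p)" for p
    by (rule right_anchor_linear)
  show "\<forall>(U, \<phi>)\<in>trivs E. \<forall>(V, \<psi>)\<in>trivs TE.
      smooth_family_on A (U \<inter> V) (\<lambda>p v. \<psi> p (right_anchor p (inv_into (fibre E p) (\<phi> p) v)))"
  proof clarify
    fix U \<phi> W \<psi> assume U: "(U, \<phi>) \<in> trivs E" and "(W, \<psi>) \<in> trivs TE"
    then obtain V c U' \<phi>' where W: "W = V \<inter> U'" and c: "(V, c) \<in> A" and U': "(U', \<phi>') \<in> trivs E"
      and \<psi>: "\<psi> = (\<lambda>p t. Blinfun (\<lambda>\<eta>. Blinfun (\<lambda>u. \<phi>' p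
       (t (\<lambda>w\<in>tangent_space A p. blinfun_apply \<eta> (tcoord V c p w)) (inv_into (fibre E p) (\<phi>' p) u)))))"
      by (auto simp: tensor_bundle_def)
    have "open (U \<inter> W)" unfolding W using triv(1)[OF U] triv(1)[OF U'] chart(1)[OF c] by auto
    then show "smooth_family_on A (U \<inter> W) (\<lambda>p v. \<psi> p (right_anchor p (inv_into (fibre E p) (\<phi> p) v)))"
      using right_anchor_smooth[OF U _ c _ U'] by (simp add: smooth_family_on_iff W \<psi>)
  qed
qed

theorem anchors_exist: "anchors A E B left_anchor right_anchor"
  unfolding anchors_def
proof (intro conjI ballI left_anchor_morphism right_anchor_morphism)
  fix X Y f assume X: "X \<in> Sec A E" and Y: "Y \<in> Sec A E" and f: "f \<in> Cinf A"
  have vf: "vf_apply (along left_anchor Z) f = left_symbol Z f" if "Z \<in> Sec A E" for Z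
    using left_anchor_apply[OF that f] by (simp add: vf_apply_def along_def)
  have act: "tensor_act (along right_anchor Y) (differential A f) X = right_symbol f X Y"
    using right_anchor_apply[OF f X Y] by (simp add: tensor_act_def along_def)
  show "B X (sec_scale E f Y) =
      sec_add E (sec_scale E f (B X Y)) (sec_scale E (vf_apply (along left_anchor X) f) Y)"
    unfolding vf[OF X]
  proof (rule sec_eqI)
    fix p \<phi> assume tr: "triv_at p \<phi>"
    show "\<phi> p (B X (sec_scale E f Y) p)
        = \<phi> p (sec_add E (sec_scale E f (B X Y)) (sec_scale E (left_symbol X f) Y) p)"
      using X Y f by (simp add: left_symbol_eq[OF tr] sec_apply triv_atD[OF tr])
  qed (use X Y f left_symbol(1) in simp_all)
  show "B (sec_scale E f X) Y =
      sec_add E (sec_diff E (sec_scale E f (B X Y)) (sec_scale E (vf_apply (along left_anchor Y) f) X))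
        (tensor_act (along right_anchor Y) (differential A f) X)"
    unfolding vf[OF Y] act
  proof (rule sec_eqI)
    fix p \<phi> assume tr: "triv_at p \<phi>"
    show "\<phi> p (B (sec_scale E f X) Y p)
        = \<phi> p (sec_add E (sec_diff E (sec_scale E f (B X Y)) (sec_scale E (left_symbol Y f) X))
            (right_symbol f X Y) p)"
      using X Y f
      by (simp add: sec_apply triv_atD[OF tr] right_symbol_apply[OF tr] delta_apply(1)[OF tr f])
  qed (use X Y f left_symbol(1) in simp_all)
qed

end

section \<open>Brackets with anchors\<close>

locale anchored_loday = loday_mfd A E B
  for A :: "('m::{t2_space, second_countable_topology}, 'a::finite_dim_inner) atlas"
    and E :: "('m, 'e, 'f::finite_dim_inner) vbundle"
    and B :: "('m \<Rightarrow> 'e) \<Rightarrow> ('m \<Rightarrow> 'e) \<Rightarrow> ('m \<Rightarrow> 'e)" +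
  fixes \<rho> :: "'m \<Rightarrow> 'e \<Rightarrow> ('m \<Rightarrow> real) \<Rightarrow> real"
    and \<alpha> :: "'m \<Rightarrow> 'e \<Rightarrow> ((('m \<Rightarrow> real) \<Rightarrow> real) \<Rightarrow> real) \<Rightarrow> 'e \<Rightarrow> 'e"
  assumes anchors: "anchors A E B \<rho> \<alpha>"
begin

lemma \<rho>_tangent: "e \<in> fibre E p \<Longrightarrow> \<rho> p e \<in> tangent_space A p"
  and \<rho>_scale: "e \<in> fibre E p \<Longrightarrow> f \<in> Cinf A \<Longrightarrow> \<rho> p (vscale E p r e) f = r * \<rho> p e f"
proof -
  have m: "bundle_morphism A E (tangent_bundle A) \<rho>" using anchors by (simp add: anchors_def)
  then show "e \<in> fibre E p \<Longrightarrow> \<rho> p e \<in> tangent_space A p"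
    unfolding bundle_morphism_def by auto
  have "linear_wrt (fibre E p) (vadd E p) (vscale E p) (vadd (tangent_bundle A) p)
      (vscale (tangent_bundle A) p) (\<rho> p)"
    using m unfolding bundle_morphism_def by blast
  then show "e \<in> fibre E p \<Longrightarrow> f \<in> Cinf A \<Longrightarrow> \<rho> p (vscale E p r e) f = r * \<rho> p e f"
    by (simp add: linear_wrt_def)
qed

lemma \<alpha>_tensor: "e \<in> fibre E p \<Longrightarrow> \<alpha> p e \<in> tensor_fibre (tangent_bundle A) (End_bundle E) p"
  and \<alpha>_scale: "e \<in> fibre E p \<Longrightarrow> y \<in> fibre E p \<Longrightarrow> \<xi> \<in> dual_fibre (tangent_bundle A) p \<Longrightarrow>
    \<alpha> p (vscale E p r e) \<xi> y = vscale E p r (\<alpha> p e \<xi> y)"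
proof -
  have m: "bundle_morphism A E TE \<alpha>" using anchors by (simp add: anchors_def)
  then show "e \<in> fibre E p \<Longrightarrow> \<alpha> p e \<in> tensor_fibre (tangent_bundle A) (End_bundle E) p"
    unfolding bundle_morphism_def by (auto simp: tensor_bundle_simps)
  have "linear_wrt (fibre E p) (vadd E p) (vscale E p) (vadd TE p) (vscale TE p) (\<alpha> p)"
    using m unfolding bundle_morphism_def by blast
  then show "e \<in> fibre E p \<Longrightarrow> y \<in> fibre E p \<Longrightarrow> \<xi> \<in> dual_fibre (tangent_bundle A) p \<Longrightarrow>
    \<alpha> p (vscale E p r e) \<xi> y = vscale E p r (\<alpha> p e \<xi> y)"
    by (simp add: linear_wrt_def tensor_bundle_simps tensor_scale_def)
qed

lemma \<alpha>_End: "e \<in> fibre E p \<Longrightarrow> \<xi> \<in> dual_fibre (tangent_bundle A) p \<Longrightarrow> \<alpha> p e \<xi> \<in> fibre (End_bundle E) p"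
  by (rule tensor_fibreD(2)[OF \<alpha>_tensor])

text \<open>Composing the smooth morphism with a smooth section gives smooth coordinates of the vector field.\<close>

lemma \<rho>_Cinf:
  assumes X: "X \<in> Sec A E" and f: "f \<in> Cinf A"
  shows "(\<lambda>p. \<rho> p (X p) f) \<in> Cinf A"
  unfolding Cinf_iff
proof
  fix p
  obtain U \<phi> where U: "(U, \<phi>) \<in> trivs E" "p \<in> U" by (rule ex_triv)
  obtain V c where c: "(V, c) \<in> A" "p \<in> V" by (rule ex_chart)
  have "\<forall>(U, \<phi>)\<in>trivs E. \<forall>(V, \<psi>)\<in>trivs (tangent_bundle A).
      smooth_family_on A (U \<inter> V) (\<lambda>p v. \<psi> p (\<rho> p (inv_into (fibre E p) (\<phi> p) v)))"
    using anchors by (simp add: anchors_def bundle_morphism_def)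
  from bspec[OF this U(1)] c(1)
  have "smooth_family_on A (U \<inter> V) (\<lambda>p v. tcoord V c p (\<rho> p (inv_into (fibre E p) (\<phi> p) v)))"
    by auto
  then have "mfamily_at A (\<lambda>p v. tcoord V c p (\<rho> p (inv_into (fibre E p) (\<phi> p) v))) p (\<phi> p (X p))"
    using smooth_family_on_iff[OF open_Int[OF triv(1)[OF U(1)] chart(1)[OF c(1)]],
      of "\<lambda>p v. tcoord V c p (\<rho> p (inv_into (fibre E p) (\<phi> p) v))"] U(2) c(2) by simp
  from mfamily_at_compose[OF this Sec_smooth[OF X U]]
  have "msmooth_at A (\<lambda>q. tcoord V c q (\<rho> q (inv_into (fibre E q) (\<phi> q) (\<phi> q (X q))))) p" .
  then have "msmooth_at A (\<lambda>q. tcoord V c q (\<rho> q (X q))) p"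
  proof (rule msmooth_at_cong)
    show "\<forall>\<^sub>F q in nhds p. tcoord V c q (\<rho> q (inv_into (fibre E q) (\<phi> q) (\<phi> q (X q)))) = tcoord V c q (\<rho> q (X q))"
      using triv_near[OF U]
    proof eventually_elim
      case (elim q)
      then have tr: "triv_at q \<phi>" by blast
      show ?case using X by (simp add: triv_atD(6)[OF tr])
    qed
  qed
  then show "msmooth_at A (\<lambda>q. \<rho> q (X q) f) p"
    using X by (intro msmooth_at_tangent_apply[OF c _ _ f] \<rho>_tangent) simp_all
qed

lemma bracket_right_apply:
  assumes "triv_at p \<phi>" "X \<in> Sec A E" "Y \<in> Sec A E" "f \<in> Cinf A"
  shows "\<phi> p (B X (sec_scale E f Y) p) = f p *\<^sub>R \<phi> p (B X Y p) + \<rho> p (X p) f *\<^sub>R \<phi> p (Y p)"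
proof -
  have "B X (sec_scale E f Y) =
      sec_add E (sec_scale E f (B X Y)) (sec_scale E (vf_apply (along \<rho> X) f) Y)"
    using anchors assms unfolding anchors_def by blast
  then show ?thesis
    using assms(2-4) by (simp add: sec_apply triv_atD[OF assms(1)] vf_apply_def along_def)
qed

lemma bracket_left_apply:
  assumes "triv_at p \<phi>" "X \<in> Sec A E" "Y \<in> Sec A E" "f \<in> Cinf A"
  shows "\<phi> p (B (sec_scale E f X) Y p) = f p *\<^sub>R \<phi> p (B X Y p) - \<rho> p (Y p) f *\<^sub>R \<phi> p (X p)
    + \<phi> p (\<alpha> p (Y p) (differential A f p) (X p))"
proof -
  have "B (sec_scale E f X) Y =
          sec_add E
            (sec_diff E (sec_scale E f (B X Y)) (sec_scale E (vf_apply (along \<rho> Y) f) X))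
            (tensor_act (along \<alpha> Y) (differential A f) X)"
    using anchors assms unfolding anchors_def by blast
  moreover have "\<alpha> p (Y p) (differential A f p) (X p) \<in> fibre E p"
    using assms by (intro End_fibreD(2)[OF \<alpha>_End] differential_in_dual) simp_all
  ultimately show ?thesis
    using assms(2-4) by (simp add: sec_apply triv_atD[OF assms(1)] vf_apply_def along_def tensor_act_def)
qed

text \<open>By the anchor equations, \<open>\<delta>\<^sub>1(g)B\<close> and \<open>\<delta>\<^sub>2(g)B\<close> are values of \<open>\<rho>\<close> and \<open>\<alpha>\<close>, hence linear over
  functions in both arguments.\<close>

lemma delta_delta_zero:
  assumes f: "f \<in> Cinf A" and g: "g \<in> Cinf A" and X: "X \<in> Sec A E" and Y: "Y \<in> Sec A E"
  shows "delta1 E f (delta1 E g B) X Y = sec_zero E" "delta1 E f (delta2 E g B) X Y = sec_zero E"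
    and "delta2 E f (delta1 E g B) X Y = sec_zero E" "delta2 E f (delta2 E g B) X Y = sec_zero E"
proof -
  have End: "\<alpha> p (Y p) (differential A g p) \<in> fibre (End_bundle E) p" for p
    using Y by (intro \<alpha>_End differential_in_dual g) simp
  note D = End_fibreD(2,4)[OF End] and dd = differential_in_dual[OF g]
  have Z: "D f D' X Y = sec_zero E"
    if "D \<in> {delta1 E, delta2 E}" "D' \<in> {delta1 E g B, delta2 E g B}"
      "\<And>p \<phi>. triv_at p \<phi> \<Longrightarrow> \<phi> p (D f D' X Y p) = 0" for D D'
  proof
    fix p
    obtain \<phi> where tr: "triv_at p \<phi>" by (rule ex_triv_at)
    have "D f D' X Y \<in> Sec A E" using that(1) delta_delta_apply(3,4)[OF tr f g X Y that(2)] by auto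
    then show "D f D' X Y p = sec_zero E p"
      using that(3)[OF tr] by (intro triv_at_eqI[OF tr]) (simp_all add: sec_zero_def triv_atD[OF tr])
  qed
  show "delta1 E f (delta1 E g B) X Y = sec_zero E"
  proof (rule Z[of "delta1 E" "delta1 E g B"])
    show "\<phi> p (delta1 E f (delta1 E g B) X Y p) = 0" if tr: "triv_at p \<phi>" for p \<phi>
      using f g X Y by (simp add: delta_delta_apply(1)[OF tr f g] delta_apply(1)[OF tr g]
        bracket_left_apply[OF tr _ _ g] sec_apply triv_atD[OF tr] D algebra_simps)
  qed simp_all
  show "delta2 E f (delta1 E g B) X Y = sec_zero E"
  proof (rule Z[of "delta2 E" "delta1 E g B"])
    show "\<phi> p (delta2 E f (delta1 E g B) X Y p) = 0" if tr: "triv_at p \<phi>" for p \<phi>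
      using f g X Y by (simp add: delta_delta_apply(2)[OF tr f g] delta_apply(1)[OF tr g]
        bracket_left_apply[OF tr _ _ g] sec_apply triv_atD[OF tr] D \<rho>_scale \<alpha>_scale dd algebra_simps)
  qed simp_all
  show "delta1 E f (delta2 E g B) X Y = sec_zero E"
  proof (rule Z[of "delta1 E" "delta2 E g B"])
    show "\<phi> p (delta1 E f (delta2 E g B) X Y p) = 0" if tr: "triv_at p \<phi>" for p \<phi>
      using f g X Y by (simp add: delta_delta_apply(1)[OF tr f g] delta_apply(2)[OF tr g]
        bracket_right_apply[OF tr _ _ g] sec_apply triv_atD[OF tr] \<rho>_scale algebra_simps)
  qed simp_all
  show "delta2 E f (delta2 E g B) X Y = sec_zero E"
  proof (rule Z[of "delta2 E" "delta2 E g B"])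
    show "\<phi> p (delta2 E f (delta2 E g B) X Y p) = 0" if tr: "triv_at p \<phi>" for p \<phi>
      using f g X Y by (simp add: delta_delta_apply(2)[OF tr f g] delta_apply(2)[OF tr g]
        bracket_right_apply[OF tr _ _ g] sec_apply triv_atD[OF tr] algebra_simps)
  qed simp_all
qed

lemma bidiff_degree_le_1: "bidiff_degree_le_1 A E B"
  using loday by (simp add: bidiff_degree_le_1_def loday_bracket_def delta_delta_zero)

lemma is_loday_algebroid: "loday_algebroid A E B"
  unfolding loday_algebroid_def
proof (intro conjI ballI loday bidiff_degree_le_1)
  fix X assume X: "X \<in> Sec A E"
  have "real_linear_sec A E (B X)" using loday X by (simp add: loday_bracket_def real_bilinear_sec_def)
  moreover have "sec_diff E (B X (sec_scale E f Y)) (sec_scale E f (B X Y)) = sec_scale E (\<lambda>p. \<rho> p (X p) f) Y"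
    if f: "f \<in> Cinf A" and Y: "Y \<in> Sec A E" for f Y
  proof (rule sec_eqI)
    fix p \<phi> assume tr: "triv_at p \<phi>"
    show "\<phi> p (sec_diff E (B X (sec_scale E f Y)) (sec_scale E f (B X Y)) p)
        = \<phi> p (sec_scale E (\<lambda>p. \<rho> p (X p) f) Y p)"
      using X Y f by (simp add: sec_apply triv_atD[OF tr] bracket_right_apply[OF tr])
  qed (use X Y f \<rho>_Cinf[OF X f] in simp_all)
  ultimately show "derivative_endomorphism A E (\<lambda>Y. B X Y)"
    unfolding derivative_endomorphism_def using \<rho>_Cinf[OF X] by blast
qed

text \<open>Compare the two sides of the Jacobi identity for \<open>X\<close>, \<open>Y\<close>, \<open>fZ\<close>, where \<open>Z\<close> does not vanish at \<open>p\<close>.\<close>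

lemma \<rho>_bracket:
  assumes X: "X \<in> Sec A E" and Y: "Y \<in> Sec A E"
  shows "along \<rho> (B X Y) = vf_bracket A (along \<rho> X) (along \<rho> Y)"
proof (intro ext)
  fix p f
  show "along \<rho> (B X Y) p f = vf_bracket A (along \<rho> X) (along \<rho> Y) p f"
  proof (cases "f \<in> Cinf A")
    case False
    have "\<rho> p (B X Y p) \<in> tangent_space A p" using X Y by (intro \<rho>_tangent) simp
    from tangentD(4)[OF this False] False show ?thesis by (simp add: along_def vf_bracket_def)
  next
    case f: True
    let ?X = "\<lambda>q. \<rho> q (X q) f" and ?Y = "\<lambda>q. \<rho> q (Y q) f"
    have C: "?X \<in> Cinf A" "?Y \<in> Cinf A" using \<rho>_Cinf f X Y by auto
    obtain \<phi> where tr: "triv_at p \<phi>" by (rule ex_triv_at)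
    obtain Z where Z: "Z \<in> Sec A E" "\<phi> p (Z p) \<noteq> 0" by (rule ex_nonvanishing[OF tr])
    note T = triv_atD[OF tr] and R = bracket_right_apply[OF tr]
    have sec: "B W (sec_scale E f Z) = sec_add E (sec_scale E f (B W Z)) (sec_scale E (\<lambda>q. \<rho> q (W q) f) Z)"
      if "W \<in> Sec A E" for W
    proof (rule sec_eqI)
      fix q \<psi> assume t: "triv_at q \<psi>"
      show "\<psi> q (B W (sec_scale E f Z) q)
          = \<psi> q (sec_add E (sec_scale E f (B W Z)) (sec_scale E (\<lambda>q. \<rho> q (W q) f) Z) q)"
        using that Z f by (simp add: bracket_right_apply[OF t] sec_apply triv_atD[OF t])
    qed (use that Z f \<rho>_Cinf[OF that f] in simp_all)
    have XY: "\<phi> p (B X (B Y (sec_scale E f Z)) p) = f p *\<^sub>R \<phi> p (B X (B Y Z) p) + ?X p *\<^sub>R \<phi> p (B Y Z p)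
        + ?Y p *\<^sub>R \<phi> p (B X Z p) + \<rho> p (X p) ?Y *\<^sub>R \<phi> p (Z p)"
      using X Y Z f C by (simp add: sec bracket_add_right sec_apply T R algebra_simps)
    have YX: "\<phi> p (B Y (B X (sec_scale E f Z)) p) = f p *\<^sub>R \<phi> p (B Y (B X Z) p) + ?Y p *\<^sub>R \<phi> p (B X Z p)
        + ?X p *\<^sub>R \<phi> p (B Y Z p) + \<rho> p (Y p) ?X *\<^sub>R \<phi> p (Z p)"
      using X Y Z f C by (simp add: sec bracket_add_right sec_apply T R algebra_simps)
    have "\<phi> p (B X (B Y (sec_scale E f Z)) p)
        = \<phi> p (B (B X Y) (sec_scale E f Z) p) + \<phi> p (B Y (B X (sec_scale E f Z)) p)"
      using X Y Z f jacobi[of X Y "sec_scale E f Z"] by (simp add: sec_apply T)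
    moreover have "\<phi> p (B X (B Y Z) p) = \<phi> p (B (B X Y) Z p) + \<phi> p (B Y (B X Z) p)"
      using X Y Z f jacobi[of X Y Z] by (simp add: sec_apply T)
    moreover have "\<phi> p (B (B X Y) (sec_scale E f Z) p)
        = f p *\<^sub>R \<phi> p (B (B X Y) Z p) + \<rho> p (B X Y p) f *\<^sub>R \<phi> p (Z p)"
      using X Y Z f by (simp add: R)
    ultimately have "\<rho> p (B X Y p) f *\<^sub>R \<phi> p (Z p) = (\<rho> p (X p) ?Y - \<rho> p (Y p) ?X) *\<^sub>R \<phi> p (Z p)"
      unfolding XY YX by (simp add: algebra_simps)
    then have "\<rho> p (B X Y p) f = \<rho> p (X p) ?Y - \<rho> p (Y p) ?X" using Z(2) by simp
    then show ?thesis using f by (simp add: along_def vf_bracket_def vf_apply_def)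
  qed
qed

text \<open>The anchor equations determine \<open>\<rho> p e f\<close> for smooth \<open>f\<close> and \<open>\<alpha> p e \<xi> x\<close> for differentials \<open>\<xi>\<close>, that is,
  for all covectors. Outside these domains tangent vectors, tensors and endomorphisms are \<open>undefined\<close>
  by convention.\<close>

lemma anchors_unique:
  assumes "anchors A E B \<rho>' \<alpha>'" and e: "e \<in> fibre E p"
  shows "\<rho> p e = \<rho>' p e" and "\<alpha> p e = \<alpha>' p e"
proof -
  interpret other: anchored_loday A E B \<rho>' \<alpha>' by unfold_locales (rule assms(1))
  obtain \<phi> where tr: "triv_at p \<phi>" by (rule ex_triv_at)
  show \<rho>: "\<rho> p e = \<rho>' p e"
  proof
    fix f
    show "\<rho> p e f = \<rho>' p e f"
    proof (cases "f \<in> Cinf A")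
      case True
      obtain Y where Y: "Y \<in> Sec A E" "\<phi> p (Y p) \<noteq> 0" by (rule ex_nonvanishing[OF tr])
      show ?thesis
        using bracket_right_apply[OF tr sec_at(1)[OF e] Y(1) True]
          other.bracket_right_apply[OF tr sec_at(1)[OF e] Y(1) True] Y(2) e by simp
    qed (simp add: tangentD(4)[OF \<rho>_tangent[OF e]] tangentD(4)[OF other.\<rho>_tangent[OF e]])
  qed
  show "\<alpha> p e = \<alpha>' p e"
  proof (intro ext)
    fix \<xi> x
    show "\<alpha> p e \<xi> x = \<alpha>' p e \<xi> x"
    proof (cases "\<xi> \<in> dual_fibre (tangent_bundle A) p")
      case \<xi>: True
      note D = \<alpha>_End[OF e \<xi>] other.\<alpha>_End[OF e \<xi>]
      obtain f where f: "f \<in> Cinf A" "differential A f p = \<xi>" by (rule ex_differential[OF \<xi>])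
      show ?thesis
      proof (cases "x \<in> fibre E p")
        case x: True
        show ?thesis
          using bracket_left_apply[OF tr sec_at(1)[OF x] sec_at(1)[OF e] f(1)]
            other.bracket_left_apply[OF tr sec_at(1)[OF x] sec_at(1)[OF e] f(1)] e x f(2) \<rho>
            End_fibreD(2)[OF D(1) x] End_fibreD(2)[OF D(2) x]
          by (intro triv_at_eqI[OF tr]) simp_all
      qed (simp add: End_fibreD(1)[OF D(1)] End_fibreD(1)[OF D(2)])
    qed (simp add: tensor_fibreD(1)[OF \<alpha>_tensor[OF e]] tensor_fibreD(1)[OF other.\<alpha>_tensor[OF e]])
  qed
qed

end

section \<open>Characterisation of Loday algebroids by their anchors\<close>

theorem theorem4p4p8:
  fixes A :: "('m::{t2_space, second_countable_topology}, 'a::finite_dim_inner) atlas"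
    and E :: "('m, 'e, 'f::finite_dim_inner) vbundle"
    and B :: "('m \<Rightarrow> 'e) \<Rightarrow> ('m \<Rightarrow> 'e) \<Rightarrow> ('m \<Rightarrow> 'e)"
  assumes "smooth_manifold A"
    and "vector_bundle A E"
    and nonzero_rank: "\<exists>v::'f. v \<noteq> 0"
    and "loday_bracket A E B"
  shows "(loday_algebroid A E B \<longleftrightarrow> (\<exists>\<rho> \<alpha>. anchors A E B \<rho> \<alpha>)) \<and>
    (loday_algebroid A E B \<longrightarrow>
      (\<forall>\<rho> \<alpha> \<rho>' \<alpha>'. anchors A E B \<rho> \<alpha> \<and> anchors A E B \<rho>' \<alpha>' \<longrightarrow>
        (\<forall>p. \<forall>e\<in>fibre E p. \<rho> p e = \<rho>' p e \<and> \<alpha> p e = \<alpha>' p e)) \<and>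
      (\<forall>\<rho> \<alpha>. anchors A E B \<rho> \<alpha> \<longrightarrow>
        (\<forall>X\<in>Sec A E. \<forall>Y\<in>Sec A E.
          along \<rho> (B X Y) = vf_bracket A (along \<rho> X) (along \<rho> Y))))"
proof -
  interpret loday_mfd A E B
    using assms by unfold_locales
  have anchored: "anchored_loday A E B \<rho> \<alpha>" if "anchors A E B \<rho> \<alpha>" for \<rho> \<alpha>
    using that by unfold_locales
  have "\<exists>\<rho> \<alpha>. anchors A E B \<rho> \<alpha>" if "loday_algebroid A E B"
  proof -
    interpret loday_algebroid_mfd A E B using that by unfold_locales
    show ?thesis using anchors_exist by blast
  qed
  then show ?thesis
    using anchored_loday.is_loday_algebroid[OF anchored] anchored_loday.anchors_unique[OF anchored]
      anchored_loday.\<rho>_bracket[OF anchored] by blast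
qed

end
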